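(* There exists an FPTAS for the maximum cardinality robustness problem for the knapsack problem: for every $\epsilon>0$ it computes $p\in\Delta(\mathcal{I})$ whose cardinality robustness is at least $(1-\epsilon)$ times the maximum cardinality robustness over $\Delta(\mathcal{I})$, in time polynomial in $n$ and $1/\epsilon$.
   Context: Items $E=\{1,\dots,n\}$ with sizes $s\colon E\to\mathbb{R}_{>0}$, values $v\colon E\to\mathbb{R}_{>0}$ and capacity $C$ with $s(e)\le C$ for all $e$; $\mathcal{I}=\{X\subseteq E:\sum_{e\in X}s(e)\le C\}$. For $X\subseteq E$ and $k\in[n]$, $v_{\le k}(X)=\max\{\sum_{e\in X'}v(e): X'\subseteq X,|X'|\le k\}$, and $X_k^*\in\arg\max_{X\in\mathcal{I}}v_{\le k}(X)$. The cardinality robustness of $p\in\Delta(\mathcal{I})$ (a probability distribution over $\mathcal{I}$) is $\min_{k\in[n]}\sum_{X\in\mathcal{I}}p_Xv_{\le k}(X)/v_{\le k}(X_k^* )$; the maximum cardinality robustness problem asks for $p\in\Delta(\mathcal{I})$ maximizing it. *)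

theory Defs
  imports "HOL-Probability.Probability"
begin

section \<open>Cardinality robustness for the knapsack problem\<close>

definition knapsack_instance ::
    "nat \<Rightarrow> (nat \<Rightarrow> real) \<Rightarrow> (nat \<Rightarrow> real) \<Rightarrow> real \<Rightarrow> bool" where
  "knapsack_instance n s v C \<longleftrightarrow>
     n \<ge> 1 \<and> (\<forall>e\<in>{1..n}. 0 < s e \<and> 0 < v e \<and> s e \<le> C)"

definition feasible :: "nat \<Rightarrow> (nat \<Rightarrow> real) \<Rightarrow> real \<Rightarrow> nat set set" where
  "feasible n s C = {X. X \<subseteq> {1..n} \<and> (\<Sum>e\<in>X. s e) \<le> C}"

definition v_le :: "(nat \<Rightarrow> real) \<Rightarrow> nat \<Rightarrow> nat set \<Rightarrow> real" where
  "v_le v k X = Max {(\<Sum>e\<in>X'. v e) | X'. X' \<subseteq> X \<and> card X' \<le> k}"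

definition X_opt ::
    "nat \<Rightarrow> (nat \<Rightarrow> real) \<Rightarrow> (nat \<Rightarrow> real) \<Rightarrow> real \<Rightarrow> nat \<Rightarrow> nat set" where
  "X_opt n s v C k = arg_max (v_le v k) (\<lambda>X. X \<in> feasible n s C)"

definition distributions :: "nat \<Rightarrow> (nat \<Rightarrow> real) \<Rightarrow> real \<Rightarrow> nat set pmf set" where
  "distributions n s C = {p. set_pmf p \<subseteq> feasible n s C}"

definition robustness ::
    "nat \<Rightarrow> (nat \<Rightarrow> real) \<Rightarrow> (nat \<Rightarrow> real) \<Rightarrow> real \<Rightarrow> nat set pmf \<Rightarrow> real" where
  "robustness n s v C p =
     Min ((\<lambda>k. \<Sum>X\<in>feasible n s C. pmf p X * v_le v k X / v_le v k (X_opt n s v C k)) ` {1..n})"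

text \<open>The supremum below is over a nonempty set that is bounded above; both are shown
  at the end of this section.\<close>

definition max_robustness ::
    "nat \<Rightarrow> (nat \<Rightarrow> real) \<Rightarrow> (nat \<Rightarrow> real) \<Rightarrow> real \<Rightarrow> real" where
  "max_robustness n s v C = (SUP p\<in>distributions n s C. robustness n s v C p)"

lemma finite_feasible: "finite (feasible n s C)"
  unfolding feasible_def by (rule finite_subset[of _ "Pow {1..n}"]) auto

lemma empty_feasible:
  assumes "knapsack_instance n s v C" shows "{} \<in> feasible n s C"
proof -
  have "0 < s 1" "s 1 \<le> C" using assms unfolding knapsack_instance_def by auto
  then show ?thesis unfolding feasible_def by auto
qed

lemma X_opt_is_arg_max:
  assumes "knapsack_instance n s v C"
  shows "is_arg_max (v_le v k) (\<lambda>X. X \<in> feasible n s C) (X_opt n s v C k)"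
proof -
  have fin: "finite (v_le v k ` feasible n s C)" and ne: "v_le v k ` feasible n s C \<noteq> {}"
    using finite_feasible empty_feasible[OF assms] by auto
  obtain X where X: "X \<in> feasible n s C" "v_le v k X = Max (v_le v k ` feasible n s C)"
    using Max_in[OF fin ne] by auto
  have "is_arg_max (v_le v k) (\<lambda>X. X \<in> feasible n s C) X"
    unfolding is_arg_max_linorder using X fin by auto
  then show ?thesis unfolding X_opt_def arg_max_def by (rule someI)
qed

lemma distributions_nonempty:
  assumes "knapsack_instance n s v C" shows "distributions n s C \<noteq> {}"
proof -
  have "return_pmf {} \<in> distributions n s C"
    using empty_feasible[OF assms] unfolding distributions_def by simp
  then show ?thesis by blast
qed

lemma robustness_bdd_above:
  assumes "knapsack_instance n s v C"
  shows "bdd_above (robustness n s v C ` distributions n s C)"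
proof (rule bdd_aboveI2)
  fix p assume "p \<in> distributions n s C"
  let ?f = "\<lambda>k. \<Sum>X\<in>feasible n s C. pmf p X * v_le v k X / v_le v k (X_opt n s v C k)"
  have "robustness n s v C p \<le> ?f 1"
    unfolding robustness_def
    using assms by (intro Min_le) (auto simp: knapsack_instance_def)
  also have "\<dots> \<le> (\<Sum>X\<in>feasible n s C. \<bar>v_le v 1 X / v_le v 1 (X_opt n s v C 1)\<bar>)"
  proof (rule sum_mono)
    fix X
    let ?q = "v_le v 1 X / v_le v 1 (X_opt n s v C 1)"
    have "pmf p X * ?q \<le> pmf p X * \<bar>?q\<bar>" by (rule mult_left_mono[OF abs_ge_self pmf_nonneg])
    also have "\<dots> \<le> 1 * \<bar>?q\<bar>" by (rule mult_right_mono[OF pmf_le_1 abs_ge_zero])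
    finally show "pmf p X * v_le v 1 X / v_le v 1 (X_opt n s v C 1) \<le> \<bar>?q\<bar>"
      by (simp only: times_divide_eq_right mult_1)
  qed
  finally show "robustness n s v C p
    \<le> (\<Sum>X\<in>feasible n s C. \<bar>v_le v 1 X / v_le v 1 (X_opt n s v C 1)\<bar>)" .
qed

section \<open>A real random access machine\<close>

text \<open>
  Sizes, values, capacity and accuracy are arbitrary real numbers, so the model of computation
  is a real RAM: a structured language over arrays of reals and arrays of naturals, with unit
  cost for each operation. A scalar variable is cell 0 of its array. Two restrictions
  avoid the usual abuses of unit-cost models: on reals there is no rounding
  and all constants are rational, so that digits of a real cannot be extracted in unit time;
  on naturals (used for counters and addresses) there is no multiplication, so
  \<open>t\<close> steps produce numbers with only \<open>O(t)\<close> more bits than the largest number present at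
  the start. A program is a finite syntactic object that does not depend on the instance.
\<close>

datatype nexp =
    NConst nat
  | NCell string nexp
  | NAdd nexp nexp
  | NSub nexp nexp

datatype rexp =
    RConst rat
  | RCell string nexp
  | RAdd rexp rexp
  | RSub rexp rexp
  | RMul rexp rexp
  | RDiv rexp rexp

datatype bexp =
    NLess nexp nexp
  | RLess rexp rexp
  | BNot bexp
  | BAnd bexp bexp

datatype com =
    Skip
  | NWrite string nexp nexp
  | RWrite string nexp rexp
  | Seq com com
  | Cond bexp com com
  | While bexp com

record state =
  nats :: "string \<Rightarrow> nat \<Rightarrow> nat"
  reals :: "string \<Rightarrow> nat \<Rightarrow> real"

fun nval :: "nexp \<Rightarrow> state \<Rightarrow> nat" where
  "nval (NConst c) \<sigma> = c"
| "nval (NCell x a) \<sigma> = nats \<sigma> x (nval a \<sigma>)"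
| "nval (NAdd a b) \<sigma> = nval a \<sigma> + nval b \<sigma>"
| "nval (NSub a b) \<sigma> = nval a \<sigma> - nval b \<sigma>"

fun rval :: "rexp \<Rightarrow> state \<Rightarrow> real" where
  "rval (RConst c) \<sigma> = of_rat c"
| "rval (RCell x a) \<sigma> = reals \<sigma> x (nval a \<sigma>)"
| "rval (RAdd a b) \<sigma> = rval a \<sigma> + rval b \<sigma>"
| "rval (RSub a b) \<sigma> = rval a \<sigma> - rval b \<sigma>"
| "rval (RMul a b) \<sigma> = rval a \<sigma> * rval b \<sigma>"
| "rval (RDiv a b) \<sigma> = rval a \<sigma> / rval b \<sigma>"

fun bval :: "bexp \<Rightarrow> state \<Rightarrow> bool" where
  "bval (NLess a b) \<sigma> \<longleftrightarrow> nval a \<sigma> < nval b \<sigma>"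
| "bval (RLess a b) \<sigma> \<longleftrightarrow> rval a \<sigma> < rval b \<sigma>"
| "bval (BNot b) \<sigma> \<longleftrightarrow> \<not> bval b \<sigma>"
| "bval (BAnd b c) \<sigma> \<longleftrightarrow> bval b \<sigma> \<and> bval c \<sigma>"

fun ncost :: "nexp \<Rightarrow> nat" where
  "ncost (NConst c) = 1"
| "ncost (NCell x a) = 1 + ncost a"
| "ncost (NAdd a b) = 1 + ncost a + ncost b"
| "ncost (NSub a b) = 1 + ncost a + ncost b"

fun rcost :: "rexp \<Rightarrow> nat" where
  "rcost (RConst c) = 1"
| "rcost (RCell x a) = 1 + ncost a"
| "rcost (RAdd a b) = 1 + rcost a + rcost b"
| "rcost (RSub a b) = 1 + rcost a + rcost b"
| "rcost (RMul a b) = 1 + rcost a + rcost b"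
| "rcost (RDiv a b) = 1 + rcost a + rcost b"

fun bcost :: "bexp \<Rightarrow> nat" where
  "bcost (NLess a b) = 1 + ncost a + ncost b"
| "bcost (RLess a b) = 1 + rcost a + rcost b"
| "bcost (BNot b) = 1 + bcost b"
| "bcost (BAnd b c) = 1 + bcost b + bcost c"

definition nwrite :: "string \<Rightarrow> nat \<Rightarrow> nat \<Rightarrow> state \<Rightarrow> state" where
  "nwrite x i c \<sigma> = \<sigma>\<lparr>nats := (nats \<sigma>)(x := (nats \<sigma> x)(i := c))\<rparr>"

definition rwrite :: "string \<Rightarrow> nat \<Rightarrow> real \<Rightarrow> state \<Rightarrow> state" where
  "rwrite x i c \<sigma> = \<sigma>\<lparr>reals := (reals \<sigma>)(x := (reals \<sigma> x)(i := c))\<rparr>"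

text \<open>\<open>exec c \<sigma> t \<tau>\<close>: started in \<open>\<sigma>\<close>, program \<open>c\<close> halts in \<open>\<tau>\<close> after exactly \<open>t\<close> operations.\<close>

inductive exec :: "com \<Rightarrow> state \<Rightarrow> nat \<Rightarrow> state \<Rightarrow> bool" where
  Skip: "exec Skip \<sigma> 1 \<sigma>"
| NWrite: "exec (NWrite x a b) \<sigma> (1 + ncost a + ncost b) (nwrite x (nval a \<sigma>) (nval b \<sigma>) \<sigma>)"
| RWrite: "exec (RWrite x a r) \<sigma> (1 + ncost a + rcost r) (rwrite x (nval a \<sigma>) (rval r \<sigma>) \<sigma>)"
| Seq: "exec c \<sigma> t \<sigma>' \<Longrightarrow> exec d \<sigma>' t' \<tau> \<Longrightarrow> exec (Seq c d) \<sigma> (t + t') \<tau>"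
| CondTrue: "bval b \<sigma> \<Longrightarrow> exec c \<sigma> t \<tau> \<Longrightarrow> exec (Cond b c d) \<sigma> (1 + bcost b + t) \<tau>"
| CondFalse: "\<not> bval b \<sigma> \<Longrightarrow> exec d \<sigma> t \<tau> \<Longrightarrow> exec (Cond b c d) \<sigma> (1 + bcost b + t) \<tau>"
| WhileFalse: "\<not> bval b \<sigma> \<Longrightarrow> exec (While b c) \<sigma> (1 + bcost b) \<sigma>"
| WhileTrue: "bval b \<sigma> \<Longrightarrow> exec c \<sigma> t \<sigma>' \<Longrightarrow> exec (While b c) \<sigma>' t' \<tau> \<Longrightarrow>
    exec (While b c) \<sigma> (1 + bcost b + t + t') \<tau>"

inductive_cases SkipE: "exec Skip \<sigma> t \<tau>"
inductive_cases NWriteE: "exec (NWrite x a b) \<sigma> t \<tau>"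
inductive_cases RWriteE: "exec (RWrite x a r) \<sigma> t \<tau>"
inductive_cases SeqE: "exec (Seq c d) \<sigma> t \<tau>"
inductive_cases CondE: "exec (Cond b c d) \<sigma> t \<tau>"
inductive_cases WhileE: "exec (While b c) \<sigma> t \<tau>"

lemma exec_deterministic:
  "exec c \<sigma> t \<tau> \<Longrightarrow> exec c \<sigma> t' \<tau>' \<Longrightarrow> t' = t \<and> \<tau>' = \<tau>"
proof (induction arbitrary: t' \<tau>' rule: exec.induct)
  case Skip then show ?case by (auto elim: SkipE)
next
  case NWrite then show ?case by (auto elim: NWriteE)
next
  case RWrite then show ?case by (auto elim: RWriteE)
next
  case Seq from Seq.prems Seq.IH show ?case by (elim SeqE) metis
next
  case (CondTrue b \<sigma> c t \<tau> d)
  from CondTrue.prems CondTrue.hyps(1) obtain u where "exec c \<sigma> u \<tau>'" "t' = 1 + bcost b + u"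
    by (auto elim: CondE)
  with CondTrue.IH show ?case by blast
next
  case (CondFalse b \<sigma> d t \<tau> c)
  from CondFalse.prems CondFalse.hyps(1) obtain u where "exec d \<sigma> u \<tau>'" "t' = 1 + bcost b + u"
    by (auto elim: CondE)
  with CondFalse.IH show ?case by blast
next
  case (WhileFalse b \<sigma> c)
  from WhileFalse.prems WhileFalse.hyps show ?case by (rule_tac WhileE) auto
next
  case (WhileTrue b \<sigma> c t \<sigma>' u \<tau>)
  from WhileTrue.prems WhileTrue.hyps(1) obtain t1 t2 \<sigma>1 where
    "exec c \<sigma> t1 \<sigma>1" "exec (While b c) \<sigma>1 t2 \<tau>'" "t' = 1 + bcost b + t1 + t2"
    by (rule_tac WhileE) auto
  with WhileTrue.IH show ?case by blast
qed

section \<open>Input and output\<close>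

text \<open>Every cell that does not hold part of the input is 0. In particular the values of
  \<open>s\<close> and \<open>v\<close> outside the item set are not available to the program.\<close>

definition input_state ::
    "nat \<Rightarrow> (nat \<Rightarrow> real) \<Rightarrow> (nat \<Rightarrow> real) \<Rightarrow> real \<Rightarrow> real \<Rightarrow> state" where
  "input_state n s v C \<epsilon> =
     \<lparr>nats = (\<lambda>x i. if x = ''n'' \<and> i = 0 then n else 0),
      reals = (\<lambda>x i.
        if x = ''s'' \<and> i \<in> {1..n} then s i
        else if x = ''v'' \<and> i \<in> {1..n} then v i
        else if x = ''C'' \<and> i = 0 then C
        else if x = ''eps'' \<and> i = 0 then \<epsilon>
        else 0)\<rparr>"

text \<open>
  The output is a list of \<open>m\<close> pairs of a set and a probability; the sets are stored as the rows
  of an incidence matrix with \<open>n\<close> columns. The same set may occur several times, in which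
  case its probabilities add up.
\<close>

definition output_length :: "state \<Rightarrow> nat" where
  "output_length \<tau> = nats \<tau> ''m'' 0"

definition output_set :: "nat \<Rightarrow> state \<Rightarrow> nat \<Rightarrow> nat set" where
  "output_set n \<tau> j = {i\<in>{1..n}. nats \<tau> ''X'' (j * n + i) \<noteq> 0}"

definition output_prob :: "state \<Rightarrow> nat \<Rightarrow> real" where
  "output_prob \<tau> j = reals \<tau> ''p'' j"

definition outputs :: "nat \<Rightarrow> state \<Rightarrow> nat set pmf \<Rightarrow> bool" where
  "outputs n \<tau> p \<longleftrightarrow>
     (\<forall>j<output_length \<tau>. 0 \<le> output_prob \<tau> j) \<and>
     (\<forall>X. pmf p X = (\<Sum>j | j < output_length \<tau> \<and> output_set n \<tau> j = X. output_prob \<tau> j))"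

text \<open>Running time: \<open>t\<close> operations, plus the \<open>m * (n + 1)\<close> cells occupied by the output,
  so that the output cannot be longer than the time allows.\<close>

definition total_time :: "nat \<Rightarrow> nat \<Rightarrow> state \<Rightarrow> nat" where
  "total_time n t \<tau> = t + output_length \<tau> * (n + 1)"

definition poly2 :: "nat \<Rightarrow> (nat \<Rightarrow> nat \<Rightarrow> real) \<Rightarrow> real \<Rightarrow> real \<Rightarrow> real" where
  "poly2 d a x y = (\<Sum>i\<le>d. \<Sum>j\<le>d. a i j * x ^ i * y ^ j)"

end

theory Submission
  imports Defs
begin

text \<open>
  Finding the best distribution is a zero-sum game: one player picks a feasible set \<open>X\<close>, the
  adversary picks a cardinality \<open>k\<close>, and the payoff is \<open>v_le v k X\<close> divided by its maximum. Against
  weights \<open>y\<close> on the cardinalities, the payoff of \<open>X\<close>, with its items sorted by decreasing value,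
  is a sum in which the item at position \<open>c\<close> counts with the factor \<open>W c = (\<Sum>k\<ge>c. y k)\<close> of its value.
  A dynamic program over the sorted items, with the number of chosen items and the profit rounded
  to multiples of \<open>M / L\<close> as its state and the least size as its entry, therefore yields a
  \<open>(1 - n / L)\<close>-approximate best response. The special weights concentrated on one \<open>k\<close> give
  approximations of the optima that scale the payoffs. The adversary plays regret matching
  (weights proportional to the positive part of the regret): the squared norm of the positive regrets
  grows by at most \<open>4 n\<close> in each of the \<open>T = n L\<^sup>2\<close> rounds, so the uniform distribution on the sets
  played is nearly optimal, because the value of the game is at least \<open>1 / n\<close>.
\<close>

section \<open>Programs with bounded loops\<close>

text \<open>The machine shapes the proof: it has no rounding, no roots and no multiplication of
  naturals. Regret matching fits it because the weights and their updates need only field operations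
  and comparisons, without a learning rate. Regret is an additive error, whereas a relative one is
  wanted; the lower bound \<open>1 / n\<close> on the value converts the first into the second and
  dictates the number of rounds. Rounding in the dynamic program is likewise made relative: its unit
  is a fraction of the largest profit of a single item, and a single item always fits, so this
  profit never exceeds the optimum. The approximate optima never exceed the true ones. Dividing by
  them can only raise the value of the game that is played, and returning to the true optima costs
  one factor at the end. With \<delta> = n / L the losses are \<delta> for the optima, \<delta> for
  the responses and 2 \<delta> for the regret, hence 4 \<delta> in all. \<open>L\<close> is the
  least number with \<open>8 * n <= L * min eps 1\<close>; this makes 4 \<delta> at most \<epsilon>
  / 2, and it gives \<open>2 * n <= L\<close>, which keeps all scaled payoffs between 0 and
  2.\<close>

text \<open>The bound of a loop is a variable that the loop does not write. Such programs always halt, so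
  that they denote a total function \<open>sem\<close> on states, and correctness can be separated from running time.\<close>

datatype prog =
    PSkip
  | PN string nexp nexp
  | PR string nexp rexp
  | PSeq prog prog (infixr \<open>;;\<close> 60)
  | PIf bexp prog prog
  | PFor string string prog

abbreviation NVar :: "string \<Rightarrow> nexp" where "NVar x \<equiv> NCell x (NConst 0)"
abbreviation RVar :: "string \<Rightarrow> rexp" where "RVar x \<equiv> RCell x (NConst 0)"

primrec compile :: "prog \<Rightarrow> com" where
  "compile PSkip = Skip"
| "compile (PN x a b) = NWrite x a b"
| "compile (PR x a r) = RWrite x a r"
| "compile (p ;; q) = Seq (compile p) (compile q)"
| "compile (PIf b p q) = Cond b (compile p) (compile q)"
| "compile (PFor i b p) = Seq (NWrite i (NConst 0) (NConst 0))
     (While (NLess (NVar i) (NVar b))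
       (Seq (compile p) (NWrite i (NConst 0) (NAdd (NVar i) (NConst 1)))))"

primrec sem :: "prog \<Rightarrow> state \<Rightarrow> state" where
  "sem PSkip = (\<lambda>\<sigma>. \<sigma>)"
| "sem (PN x a b) = (\<lambda>\<sigma>. nwrite x (nval a \<sigma>) (nval b \<sigma>) \<sigma>)"
| "sem (PR x a r) = (\<lambda>\<sigma>. rwrite x (nval a \<sigma>) (rval r \<sigma>) \<sigma>)"
| "sem (p ;; q) = (\<lambda>\<sigma>. sem q (sem p \<sigma>))"
| "sem (PIf b p q) = (\<lambda>\<sigma>. if bval b \<sigma> then sem p \<sigma> else sem q \<sigma>)"
| "sem (PFor i b p) = (\<lambda>\<sigma>. ((\<lambda>\<tau>. nwrite i 0 (Suc (nats (sem p \<tau>) i 0)) (sem p \<tau>)) ^^ nats \<sigma> b 0)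
     (nwrite i 0 0 \<sigma>))"

primrec nvars :: "prog \<Rightarrow> string set" where
  "nvars PSkip = {}"
| "nvars (PN x a b) = {x}"
| "nvars (PR x a r) = {}"
| "nvars (p ;; q) = nvars p \<union> nvars q"
| "nvars (PIf b p q) = nvars p \<union> nvars q"
| "nvars (PFor i b p) = insert i (nvars p)"

primrec rvars :: "prog \<Rightarrow> string set" where
  "rvars PSkip = {}"
| "rvars (PN x a b) = {}"
| "rvars (PR x a r) = {x}"
| "rvars (p ;; q) = rvars p \<union> rvars q"
| "rvars (PIf b p q) = rvars p \<union> rvars q"
| "rvars (PFor i b p) = rvars p"

primrec bounds :: "prog \<Rightarrow> string set" where
  "bounds PSkip = {}"
| "bounds (PN x a b) = {}"
| "bounds (PR x a r) = {}"
| "bounds (p ;; q) = bounds p \<union> bounds q"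
| "bounds (PIf b p q) = bounds p \<union> bounds q"
| "bounds (PFor i b p) = insert b (bounds p)"

primrec fresh_counters :: "prog \<Rightarrow> bool" where
  "fresh_counters PSkip = True"
| "fresh_counters (PN x a b) = True"
| "fresh_counters (PR x a r) = True"
| "fresh_counters (p ;; q) = (fresh_counters p \<and> fresh_counters q)"
| "fresh_counters (PIf b p q) = (fresh_counters p \<and> fresh_counters q)"
| "fresh_counters (PFor i b p) = (fresh_counters p \<and> i \<notin> nvars p)"

text \<open>\<open>N\<close> stands for a common bound on all loop bounds. Branches are added
  instead of maximised, and 20 is a generous allowance for the bookkeeping of a loop.\<close>

primrec time_bound :: "prog \<Rightarrow> nat \<Rightarrow> nat" where
  "time_bound PSkip N = 1"
| "time_bound (PN x a b) N = 1 + ncost a + ncost b"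
| "time_bound (PR x a r) N = 1 + ncost a + rcost r"
| "time_bound (p ;; q) N = time_bound p N + time_bound q N"
| "time_bound (PIf b p q) N = 1 + bcost b + time_bound p N + time_bound q N"
| "time_bound (PFor i b p) N = 20 + N * (20 + time_bound p N)"

section \<open>State updates, frame properties and the loop rule\<close>

lemma nats_nwrite [simp]:
  "nats (nwrite x i c \<sigma>) y j = (if x = y \<and> i = j then c else nats \<sigma> y j)"
  by (auto simp: nwrite_def)

lemma reals_nwrite [simp]: "reals (nwrite x i c \<sigma>) = reals \<sigma>"
  by (auto simp: nwrite_def)

lemma reals_rwrite [simp]:
  "reals (rwrite x i c \<sigma>) y j = (if x = y \<and> i = j then c else reals \<sigma> y j)"
  by (auto simp: rwrite_def)

lemma nats_rwrite [simp]: "nats (rwrite x i c \<sigma>) = nats \<sigma>"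
  by (auto simp: rwrite_def)

lemma nats_nwrite_other: "x \<noteq> y \<Longrightarrow> nats (nwrite x i c \<sigma>) y = nats \<sigma> y"
  by (auto simp: nwrite_def)

lemma reals_rwrite_other: "x \<noteq> y \<Longrightarrow> reals (rwrite x i c \<sigma>) y = reals \<sigma> y"
  by (auto simp: rwrite_def)

lemma nats_sem: "x \<notin> nvars p \<Longrightarrow> nats (sem p \<sigma>) x = nats \<sigma> x"
proof (induction p arbitrary: \<sigma>)
  case (PFor i b p)
  let ?f = "\<lambda>\<tau>. nwrite i 0 (Suc (nats (sem p \<tau>) i 0)) (sem p \<tau>)"
  have "nats ((?f ^^ m) (nwrite i 0 0 \<sigma>)) x = nats \<sigma> x" for m
    using PFor by (induction m) (auto simp: nats_nwrite_other)
  then show ?case by simp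
qed (auto simp: nats_nwrite_other)

lemma reals_sem: "x \<notin> rvars p \<Longrightarrow> reals (sem p \<sigma>) x = reals \<sigma> x"
proof (induction p arbitrary: \<sigma>)
  case (PFor i b p)
  let ?f = "\<lambda>\<tau>. nwrite i 0 (Suc (nats (sem p \<tau>) i 0)) (sem p \<tau>)"
  have "reals ((?f ^^ m) (nwrite i 0 0 \<sigma>)) x = reals \<sigma> x" for m
    using PFor by (induction m) auto
  then show ?case by simp
qed (auto simp: reals_rwrite_other)

lemma for_funpow:
  assumes "i \<notin> nvars p"
  shows "nats (((\<lambda>\<tau>. nwrite i 0 (Suc (nats (sem p \<tau>) i 0)) (sem p \<tau>)) ^^ m) (nwrite i 0 0 \<sigma>)) i 0 = m"
  using assms by (induction m) (auto simp: nats_sem)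

text \<open>The step receives for free that nothing outside the variables written by the body has
  changed, so an invariant \<open>I\<close> need only speak of cells that do change. In the
  applications below, \<open>case 4\<close> is this step: 4(1) bounds \<open>m\<close>, 4(2) is the
  counter, 4(3) and 4(4) are the frames and 4(5) is the invariant.\<close>

lemma sem_for:
  assumes "i \<notin> nvars p" and N: "nats \<sigma> b 0 = N"
    and "I 0 (nwrite i 0 0 \<sigma>)"
    and step: "\<And>m \<tau>. \<lbrakk>m < N; nats \<tau> i 0 = m;
        \<And>x. x \<notin> insert i (nvars p) \<Longrightarrow> nats \<tau> x = nats \<sigma> x;
        \<And>x. x \<notin> rvars p \<Longrightarrow> reals \<tau> x = reals \<sigma> x; I m \<tau>\<rbrakk>
      \<Longrightarrow> I (Suc m) (nwrite i 0 (Suc m) (sem p \<tau>))"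
  shows "I N (sem (PFor i b p) \<sigma>)"
proof -
  let ?f = "\<lambda>\<tau>. nwrite i 0 (Suc (nats (sem p \<tau>) i 0)) (sem p \<tau>)"
  let ?S = "\<lambda>m. (?f ^^ m) (nwrite i 0 0 \<sigma>)"
  have n: "nats (?S m) x = nats \<sigma> x" if "x \<notin> insert i (nvars p)" for m x
    using that by (induction m) (auto simp: nats_nwrite_other nats_sem)
  have r: "reals (?S m) x = reals \<sigma> x" if "x \<notin> rvars p" for m x
    using that by (induction m) (auto simp: reals_sem)
  have "I m (?S m)" if "m \<le> N" for m
    using that
  proof (induction m)
    case 0 then show ?case using assms by simp
  next
    case (Suc m)
    have i: "nats (?S m) i 0 = m" using for_funpow[OF assms(1)] .
    have "nats (sem p (?S m)) i 0 = m" using i nats_sem[OF assms(1)] by simp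
    moreover have "I (Suc m) (nwrite i 0 (Suc m) (sem p (?S m)))"
      using Suc by (intro step n r i) auto
    ultimately show ?case by simp
  qed
  then show ?thesis using N by simp
qed

text \<open>\<open>sem\<close> reads the number of iterations once, on entry, while the compiled
  loop compares counter and bound before every iteration. The two agree because the body writes
  neither of them; the same condition keeps every bound below \<open>N\<close> when inner programs
  start.\<close>

lemma exec_compile:
  assumes "fresh_counters p" "bounds p \<inter> nvars p = {}" "\<And>x. x \<in> bounds p \<Longrightarrow> nats \<sigma> x 0 \<le> N"
  shows "\<exists>t. exec (compile p) \<sigma> t (sem p \<sigma>) \<and> t \<le> time_bound p N"
  using assms
proof (induction p arbitrary: \<sigma>)
  case PSkip
  then show ?case using exec.Skip by auto
next
  case (PN x a b)
  then show ?case using exec.NWrite by (metis compile.simps(2) order_refl sem.simps(2) time_bound.simps(2))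
next
  case (PR x a r)
  then show ?case using exec.RWrite by (metis compile.simps(3) order_refl sem.simps(3) time_bound.simps(3))
next
  case (PSeq p q)
  have "nats (sem p \<sigma>) x 0 \<le> N" if "x \<in> bounds q" for x
  proof -
    have "x \<notin> nvars p" using that PSeq.prems(2) by auto
    then show ?thesis using that PSeq.prems(3)[of x] by (simp add: nats_sem)
  qed
  then have "\<exists>t. exec (compile q) (sem p \<sigma>) t (sem q (sem p \<sigma>)) \<and> t \<le> time_bound q N"
    using PSeq.prems by (intro PSeq.IH) auto
  moreover have "\<exists>t. exec (compile p) \<sigma> t (sem p \<sigma>) \<and> t \<le> time_bound p N"
    using PSeq.prems by (intro PSeq.IH) auto
  ultimately obtain t u where "exec (compile p) \<sigma> t (sem p \<sigma>)" "t \<le> time_bound p N"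
    "exec (compile q) (sem p \<sigma>) u (sem q (sem p \<sigma>))" "u \<le> time_bound q N" by auto
  then show ?case using exec.Seq by (intro exI[of _ "t + u"]) auto
next
  case (PIf b p q)
  have "\<exists>t. exec (compile q) \<sigma> t (sem q \<sigma>) \<and> t \<le> time_bound q N"
    using PIf.prems by (intro PIf.IH) auto
  moreover have "\<exists>t. exec (compile p) \<sigma> t (sem p \<sigma>) \<and> t \<le> time_bound p N"
    using PIf.prems by (intro PIf.IH) auto
  ultimately obtain t u where "exec (compile p) \<sigma> t (sem p \<sigma>)" "t \<le> time_bound p N"
    "exec (compile q) \<sigma> u (sem q \<sigma>)" "u \<le> time_bound q N" by auto
  then show ?case
    using exec.CondTrue[of b \<sigma> "compile p" t] exec.CondFalse[of b \<sigma> "compile q" u]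
    by (cases "bval b \<sigma>") fastforce+
next
  case (PFor i b p)
  let ?f = "\<lambda>\<tau>. nwrite i 0 (Suc (nats (sem p \<tau>) i 0)) (sem p \<tau>)"
  let ?b = "NLess (NVar i) (NVar b)"
  let ?c = "Seq (compile p) (NWrite i (NConst 0) (NAdd (NVar i) (NConst 1)))"
  \<comment> \<open>\<open>m\<close> counts the iterations still to run. The failing last test costs
    6; an iteration costs 12 besides its body, within the 20 allowed.\<close>
  have loop: "\<exists>t. exec (While ?b ?c) \<tau> t ((?f ^^ m) \<tau>) \<and> t \<le> 6 + m * (20 + time_bound p N)"
    if "nats \<tau> i 0 + m = nats \<tau> b 0" "\<And>x. x \<in> insert b (bounds p) \<Longrightarrow> nats \<tau> x 0 = nats \<sigma> x 0" for m \<tau>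
    using that
  proof (induction m arbitrary: \<tau>)
    case 0
    then show ?case using exec.WhileFalse[of ?b \<tau> ?c] by auto
  next
    case (Suc m)
    have "\<exists>t. exec (compile p) \<tau> t (sem p \<tau>) \<and> t \<le> time_bound p N"
      using PFor.prems Suc.prems by (intro PFor.IH) auto
    then obtain t where t: "exec (compile p) \<tau> t (sem p \<tau>)" "t \<le> time_bound p N" by auto
    have "exec ?c \<tau> (t + 6) (?f \<tau>)"
      using exec.Seq[OF t(1) exec.NWrite[of i "NConst 0" "NAdd (NVar i) (NConst 1)"]]
      by (simp add: numeral_eq_Suc)
    moreover have "\<exists>t. exec (While ?b ?c) (?f \<tau>) t ((?f ^^ m) (?f \<tau>)) \<and> t \<le> 6 + m * (20 + time_bound p N)"
    proof (rule Suc.IH)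
      show "nats (?f \<tau>) i 0 + m = nats (?f \<tau>) b 0"
        using Suc.prems PFor.prems by (auto simp: nats_sem)
      show "nats (?f \<tau>) x 0 = nats \<sigma> x 0" if "x \<in> insert b (bounds p)" for x
      proof -
        have "x \<notin> nvars p" "i \<noteq> x" using that PFor.prems(2) by auto
        then show ?thesis using that Suc.prems(2)[of x] by (simp add: nats_nwrite_other nats_sem)
      qed
    qed
    moreover have "bval ?b \<tau>" using Suc.prems by auto
    ultimately obtain u where "exec (While ?b ?c) \<tau> (1 + bcost ?b + (t + 6) + u) ((?f ^^ m) (?f \<tau>))"
      and "u \<le> 6 + m * (20 + time_bound p N)"
      using exec.WhileTrue by blast
    then have "exec (While ?b ?c) \<tau> (12 + t + u) ((?f ^^ Suc m) \<tau>)"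
      by (simp only: funpow_Suc_right o_def) (simp add: add_ac)
    moreover have "12 + t + u \<le> 6 + Suc m * (20 + time_bound p N)"
      using t(2) \<open>u \<le> _\<close> by simp
    ultimately show ?case by blast
  qed
  have "\<exists>t. exec (While ?b ?c) (nwrite i 0 0 \<sigma>) t ((?f ^^ nats \<sigma> b 0) (nwrite i 0 0 \<sigma>))
      \<and> t \<le> 6 + nats \<sigma> b 0 * (20 + time_bound p N)"
    using PFor.prems by (intro loop) auto
  then obtain t where "exec (While ?b ?c) (nwrite i 0 0 \<sigma>) t (sem (PFor i b p) \<sigma>)"
      "t \<le> 6 + nats \<sigma> b 0 * (20 + time_bound p N)" by auto
  moreover have "exec (NWrite i (NConst 0) (NConst 0)) \<sigma> 3 (nwrite i 0 0 \<sigma>)"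
    using exec.NWrite[of i "NConst 0" "NConst 0" \<sigma>] by (simp add: numeral_eq_Suc)
  ultimately have "exec (compile (PFor i b p)) \<sigma> (3 + t) (sem (PFor i b p) \<sigma>)"
    unfolding compile.simps by (intro exec.Seq)
  moreover have "nats \<sigma> b 0 * (20 + time_bound p N) \<le> N * (20 + time_bound p N)"
    using PFor.prems(3)[of b] by (intro mult_le_mono1) simp
  then have "3 + t \<le> time_bound (PFor i b p) N"
    using \<open>t \<le> _\<close> unfolding time_bound.simps by linarith
  ultimately show ?case by blast
qed

text \<open>The exponent depends only on the syntax: a loop raises it by one, and composition adds
  exponents, which is cruder than the maximum but equally constant.\<close>

lemma time_bound_poly: "\<exists>K d. \<forall>N\<ge>1. time_bound p N \<le> K * N ^ d"
proof (induction p)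
  case (PSeq p q)
  then obtain K d K' d' where b: "\<And>N. N \<ge> 1 \<Longrightarrow> time_bound p N \<le> K * N ^ d"
    "\<And>N. N \<ge> 1 \<Longrightarrow> time_bound q N \<le> K' * N ^ d'" by metis
  have "time_bound (p ;; q) N \<le> (K + K') * N ^ (d + d')" if "N \<ge> 1" for N
  proof -
    have "N ^ d \<le> N ^ (d + d')" "N ^ d' \<le> N ^ (d + d')"
      using that by (auto intro: power_increasing)
    then have "K * N ^ d \<le> K * N ^ (d + d')" "K' * N ^ d' \<le> K' * N ^ (d + d')" by auto
    then show ?thesis using b[OF that] unfolding time_bound.simps add_mult_distrib by linarith
  qed
  then show ?case by blast
next
  case (PIf c p q)
  then obtain K d K' d' where b: "\<And>N. N \<ge> 1 \<Longrightarrow> time_bound p N \<le> K * N ^ d"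
    "\<And>N. N \<ge> 1 \<Longrightarrow> time_bound q N \<le> K' * N ^ d'" by metis
  have "time_bound (PIf c p q) N \<le> (1 + bcost c + K + K') * N ^ (d + d')" if "N \<ge> 1" for N
  proof -
    have "N ^ d \<le> N ^ (d + d')" "N ^ d' \<le> N ^ (d + d')" "1 \<le> N ^ (d + d')"
      using that by (auto intro: power_increasing)
    then have "K * N ^ d \<le> K * N ^ (d + d')" "K' * N ^ d' \<le> K' * N ^ (d + d')"
      "(1 + bcost c) * 1 \<le> (1 + bcost c) * N ^ (d + d')" by (auto intro: mult_le_mono simp del: mult_Suc)
    then show ?thesis using b[OF that] unfolding time_bound.simps add_mult_distrib by linarith
  qed
  then show ?case by blast
next
  case (PFor i b p)
  then obtain K d where b: "\<And>N. N \<ge> 1 \<Longrightarrow> time_bound p N \<le> K * N ^ d" by metis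
  have "time_bound (PFor i b p) N \<le> (40 + K) * N ^ (Suc d)" if "N \<ge> 1" for N
  proof -
    have "N \<le> N ^ Suc d" "1 \<le> N ^ Suc d" using that by auto
    moreover have "N * time_bound p N \<le> N * (K * N ^ d)" using b[OF that] by (rule mult_le_mono2)
    moreover have "(40 + K) * N ^ Suc d = 40 * N ^ Suc d + K * N ^ Suc d" by (rule add_mult_distrib)
    moreover have "K * N ^ Suc d = N * (K * N ^ d)" by simp
    moreover have "time_bound (PFor i b p) N = 20 + (N * 20 + N * time_bound p N)"
      by (simp only: time_bound.simps add_mult_distrib2)
    ultimately show ?thesis by linarith
  qed
  then show ?case by blast
next
  case PSkip then show ?case by (intro exI[of _ 1] exI[of _ 0]) auto
next
  case (PN x a b) then show ?case by (intro exI[of _ "1 + ncost a + ncost b"] exI[of _ 0]) auto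
next
  case (PR x a b) then show ?case by (intro exI[of _ "1 + ncost a + rcost b"] exI[of _ 0]) auto
qed

section \<open>The game and its approximate solution\<close>

definition pos :: "nat set \<Rightarrow> nat \<Rightarrow> nat" where
  "pos Y j = card (Y \<inter> {..<j})"

text \<open>The profit of an item depends on its position, counted behind \<open>c\<close> items
  chosen earlier. The type is left open because both the real profits and their rounded natural
  numbers are summed this way.\<close>

definition psum :: "(nat \<Rightarrow> nat \<Rightarrow> 'a::comm_monoid_add) \<Rightarrow> nat \<Rightarrow> nat set \<Rightarrow> 'a" where
  "psum f c Y = (\<Sum>j\<in>Y. f j (c + pos Y j))"

definition top_sum :: "(nat \<Rightarrow> real) \<Rightarrow> nat \<Rightarrow> nat set \<Rightarrow> real" where
  "top_sum w k Y = (\<Sum>j | j \<in> Y \<and> pos Y j < k. w j)"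

lemma pos_less:
  assumes "finite Y" "x \<in> Y" "x < y" shows "pos Y x < pos Y y"
  unfolding pos_def using assms by (intro psubset_card_mono) auto

lemma pos_inj: "finite Y \<Longrightarrow> inj_on (pos Y) Y"
  by (intro inj_onI) (metis linorder_neqE_nat nat_neq_iff pos_less)

lemma pos_less_card: "finite Y \<Longrightarrow> x \<in> Y \<Longrightarrow> pos Y x < card Y"
  unfolding pos_def by (intro psubset_card_mono) auto

lemma pos_image: "finite Y \<Longrightarrow> pos Y ` Y = {..<card Y}"
  using pos_less_card[of Y] pos_inj[of Y] by (intro card_subset_eq) (auto simp: card_image)

text \<open>Exchange argument: an element of \<open>X\<close> is sent to the element of
  \<open>Y\<close> at the same position. Since \<open>X\<close> is part of \<open>Y\<close>, that
  element comes no later, so it is at least as valuable, and it lies among the first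
  \<open>k\<close> of \<open>Y\<close>. Positions are distinct, hence the map is injective.\<close>

lemma v_le_eq_top_sum:
  assumes fin: "finite Y" and anti: "\<And>i j. i \<in> Y \<Longrightarrow> j \<in> Y \<Longrightarrow> i \<le> j \<Longrightarrow> w j \<le> w i"
    and nn: "\<And>i. i \<in> Y \<Longrightarrow> 0 \<le> w i"
  shows "v_le w k Y = top_sum w k Y"
  unfolding v_le_def
proof (rule Max_eqI)
  show "finite {sum w X' |X'. X' \<subseteq> Y \<and> card X' \<le> k}"
    by (rule finite_subset[of _ "sum w ` Pow Y"]) (auto simp: fin)
next
  let ?T = "{j. j \<in> Y \<and> pos Y j < k}"
  have "card ?T = card (pos Y ` ?T)"
    using pos_inj[OF fin] by (intro card_image[symmetric]) (auto simp: inj_on_def)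
  also have "\<dots> \<le> card {..<k}" by (intro card_mono) auto
  finally show "top_sum w k Y \<in> {sum w X' |X'. X' \<subseteq> Y \<and> card X' \<le> k}"
    unfolding top_sum_def by (intro CollectI exI[of _ ?T]) auto
next
  let ?T = "{j. j \<in> Y \<and> pos Y j < k}"
  fix z assume "z \<in> {sum w X' |X'. X' \<subseteq> Y \<and> card X' \<le> k}"
  then obtain X where X: "z = sum w X" "X \<subseteq> Y" "card X \<le> k" by auto
  have finX: "finite X" using X fin finite_subset by blast
  have "\<exists>y\<in>Y. pos Y y = pos X x" if "x \<in> X" for x
  proof -
    have "pos X x < card Y"
      using pos_less_card[OF finX that] card_mono[OF fin X(2)] by simp
    then show ?thesis using pos_image[OF fin] by (metis imageE lessThan_iff)
  qed
  then obtain g where g: "\<And>x. x \<in> X \<Longrightarrow> g x \<in> Y" "\<And>x. x \<in> X \<Longrightarrow> pos Y (g x) = pos X x"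
    by metis
  have le: "g x \<le> x" if "x \<in> X" for x
  proof (rule ccontr)
    assume "\<not> g x \<le> x"
    then have "pos Y x < pos Y (g x)" using that X by (intro pos_less[OF fin]) auto
    moreover have "pos X x \<le> pos Y x" unfolding pos_def using X(2) by (intro card_mono) auto
    ultimately show False using g that by auto
  qed
  have "inj_on g X" using pos_inj[OF finX] g(2) by (metis inj_on_def)
  have "sum w X \<le> (\<Sum>x\<in>X. w (g x))"
    using le g X by (intro sum_mono anti) auto
  also have "\<dots> = sum w (g ` X)" using \<open>inj_on g X\<close> by (simp add: sum.reindex)
  also have "\<dots> \<le> sum w ?T"
  proof (rule sum_mono2)
    show "g ` X \<subseteq> ?T" using g pos_less_card[OF finX] X(3) by fastforce
  qed (use fin nn in auto)
  finally show "z \<le> top_sum w k Y" using X(1) by (simp add: top_sum_def)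
qed

lemma v_le_image:
  assumes "inj_on \<pi> Y" shows "v_le v k (\<pi> ` Y) = v_le (\<lambda>j. v (\<pi> j)) k Y"
proof -
  have "{sum v X' |X'. X' \<subseteq> \<pi> ` Y \<and> card X' \<le> k} =
    {(\<Sum>e\<in>X'. v (\<pi> e)) |X'. X' \<subseteq> Y \<and> card X' \<le> k}" (is "?A = ?B")
  proof (intro subset_antisym subsetI)
    fix z assume "z \<in> ?A"
    then obtain X where X: "z = sum v X" "X \<subseteq> \<pi> ` Y" "card X \<le> k" by auto
    obtain Z where Z: "Z \<subseteq> Y" "X = \<pi> ` Z" using X(2) by (meson subset_imageE)
    have "inj_on \<pi> Z" using assms Z(1) inj_on_subset by blast
    then show "z \<in> ?B" using X Z by (intro CollectI exI[of _ Z]) (auto simp: sum.reindex card_image)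
  next
    fix z assume "z \<in> ?B"
    then obtain Z where Z: "z = (\<Sum>e\<in>Z. v (\<pi> e))" "Z \<subseteq> Y" "card Z \<le> k" by auto
    have "inj_on \<pi> Z" using assms Z(2) inj_on_subset by blast
    then show "z \<in> ?A" using Z by (intro CollectI exI[of _ "\<pi> ` Z"]) (auto simp: sum.reindex card_image)
  qed
  then show ?thesis unfolding v_le_def by simp
qed

text \<open>Swapping the sums: an item at position \<open>c\<close> counts for every index
  \<open>k >= c\<close>. Indices start at 0, so \<open>y k\<close> is the weight of the cardinality
  \<open>k + 1\<close>. This makes the adversary's payoff a position-dependent profit that a dynamic
  program can handle.\<close>

lemma weighted_top_sum:
  assumes "finite Y"
  shows "(\<Sum>k<n. y k * top_sum w (Suc k) Y) = psum (\<lambda>j c. w j * (\<Sum>k\<in>{c..<n}. y k)) 0 Y"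
proof -
  have "(\<Sum>k<n. y k * top_sum w (Suc k) Y) = (\<Sum>k<n. \<Sum>j\<in>Y. if pos Y j \<le> k then y k * w j else 0)"
  proof (rule sum.cong[OF refl])
    fix k
    have "top_sum w (Suc k) Y = (\<Sum>j\<in>Y. if pos Y j \<le> k then w j else 0)"
      unfolding top_sum_def using assms by (simp add: sum.inter_filter less_Suc_eq_le)
    then show "y k * top_sum w (Suc k) Y = (\<Sum>j\<in>Y. if pos Y j \<le> k then y k * w j else 0)"
      by (simp add: sum_distrib_left if_distrib cong: if_cong)
  qed
  also have "\<dots> = (\<Sum>j\<in>Y. \<Sum>k<n. if pos Y j \<le> k then y k * w j else 0)" by (rule sum.swap)
  also have "\<dots> = (\<Sum>j\<in>Y. w j * (\<Sum>k\<in>{pos Y j..<n}. y k))"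
  proof (rule sum.cong[OF refl])
    fix j
    have "(\<Sum>k<n. if pos Y j \<le> k then y k * w j else 0) = (\<Sum>k | k \<in> {..<n} \<and> pos Y j \<le> k. y k * w j)"
      by (rule sum.inter_filter[symmetric]) simp
    also have "{k. k \<in> {..<n} \<and> pos Y j \<le> k} = {pos Y j..<n}" by auto
    finally show "(\<Sum>k<n. if pos Y j \<le> k then y k * w j else 0) = w j * (\<Sum>k\<in>{pos Y j..<n}. y k)"
      by (simp add: sum_distrib_left mult.commute)
  qed
  finally show ?thesis by (simp add: psum_def)
qed

lemma psum_mono:
  assumes "\<And>j. j \<in> Y \<Longrightarrow> f j (c + pos Y j) \<le> (g j (c + pos Y j) :: 'a :: ordered_comm_monoid_add)"
  shows "psum f c Y \<le> psum g c Y"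
  unfolding psum_def using assms by (rule sum_mono)

text \<open>An item put in front shifts all others by one position, which is the step of the
  recurrence for least sizes. The companion for the greatest element leaves positions alone and
  serves the reconstruction of the set, which proceeds from the front.\<close>

lemma psum_insert_least:
  assumes "finite Y" "\<And>y. y \<in> Y \<Longrightarrow> j < y"
  shows "psum f c (insert j Y) = f j c + psum f (Suc c) Y"
proof -
  have j: "j \<notin> Y" using assms by auto
  have "pos (insert j Y) j = 0" using assms(2) by (force simp: pos_def)
  moreover have "pos (insert j Y) y = Suc (pos Y y)" if "y \<in> Y" for y
  proof -
    have "insert j Y \<inter> {..<y} = insert j (Y \<inter> {..<y})" using assms(2) that by auto
    then show ?thesis using j assms by (simp add: pos_def)
  qed
  ultimately show ?thesis using assms j by (simp add: psum_def)
qed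

lemma psum_insert_greatest:
  assumes "finite Y" "\<And>y. y \<in> Y \<Longrightarrow> y < j"
  shows "psum f c (insert j Y) = psum f c Y + f j (c + card Y)"
proof -
  have j: "j \<notin> Y" using assms by auto
  have "insert j Y \<inter> {..<j} = Y" using assms by auto
  then have "pos (insert j Y) j = card Y" by (simp add: pos_def)
  moreover have "pos (insert j Y) y = pos Y y" if "y \<in> Y" for y
  proof -
    have "insert j Y \<inter> {..<y} = Y \<inter> {..<y}" using assms(2) that by force
    then show ?thesis by (simp add: pos_def)
  qed
  ultimately show ?thesis using assms j by (simp add: psum_def add.commute)
qed

text \<open>\<open>min_size n z b C r c q\<close>: least size of a set of items from \<open>{n - r..<n}\<close> which, put
  behind \<open>c\<close> chosen items, has profit at least \<open>q\<close>. The value \<open>C + 1\<close> stands for infinity, and the subtraction on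
  \<open>q\<close> is meant to be truncated.\<close>

primrec min_size :: "nat \<Rightarrow> (nat \<Rightarrow> real) \<Rightarrow> (nat \<Rightarrow> nat \<Rightarrow> nat) \<Rightarrow> real \<Rightarrow> nat \<Rightarrow> nat \<Rightarrow> nat \<Rightarrow> real" where
  "min_size n z b C 0 c q = (if q = 0 then 0 else C + 1)"
| "min_size n z b C (Suc r) c q =
     min (min_size n z b C r c q)
         (z (n - Suc r) + min_size n z b C r (Suc c) (q - b (n - Suc r) c))"

text \<open>One half of the meaning of the table: no set is smaller than its entry. The other half,
  that an entry within the capacity is achieved by a set, comes out of
  \<open>backtrack_spec\<close>.\<close>

lemma min_size_le:
  assumes "r \<le> n" "Y \<subseteq> {n - r..<n}" "q \<le> psum b c Y"
  shows "min_size n z b C r c q \<le> (\<Sum>j\<in>Y. z j)"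
  using assms
proof (induction r arbitrary: Y c q)
  case 0
  then show ?case by (auto simp: psum_def)
next
  case (Suc r)
  let ?j = "n - Suc r"
  show ?case
  proof (cases "?j \<in> Y")
    case False
    have "Y \<subseteq> {n - r..<n}"
    proof
      fix y assume "y \<in> Y"
      then have "y \<in> {?j..<n}" "y \<noteq> ?j" using Suc.prems False by auto
      then show "y \<in> {n - r..<n}" by auto
    qed
    then show ?thesis using Suc.IH[of Y q c] Suc.prems by auto
  next
    case True
    let ?Y = "Y - {?j}"
    have sub: "?Y \<subseteq> {n - r..<n}"
    proof
      fix y assume "y \<in> ?Y"
      then have "y \<in> {?j..<n}" "y \<noteq> ?j" using Suc.prems by auto
      then show "y \<in> {n - r..<n}" by auto
    qed
    have fin: "finite ?Y" using sub finite_subset by blast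
    have ins: "insert ?j ?Y = Y" using True by auto
    have "psum b c (insert ?j ?Y) = b ?j c + psum b (Suc c) ?Y"
    proof (rule psum_insert_least[OF fin])
      fix y assume "y \<in> ?Y" then have "y \<in> {n - r..<n}" using sub by blast
      then show "?j < y" using Suc.prems(1) by auto
    qed
    then have "q - b ?j c \<le> psum b (Suc c) ?Y" using Suc.prems ins by simp
    then have "min_size n z b C r (Suc c) (q - b ?j c) \<le> sum z ?Y"
      using Suc.IH[of ?Y] sub Suc.prems by simp
    moreover have "sum z Y = z ?j + sum z ?Y"
      using True fin by (metis finite_insert ins sum.remove)
    ultimately show ?thesis by (simp add: min_le_iff_disj)
  qed
qed

text \<open>Rounding down to multiples of \<open>M / L\<close>.\<close>

lemma rounding_error:
  fixes f :: "nat \<Rightarrow> nat \<Rightarrow> real"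
  assumes "finite Y" "card Y \<le> n" "0 < L" "0 \<le> M"
    and "\<And>j. j \<in> Y \<Longrightarrow> f j (pos Y j) * L < (real (b j (pos Y j)) + 1) * M"
  shows "psum f 0 Y * L \<le> real (psum b 0 Y) * M + n * M"
proof -
  have "psum f 0 Y * L \<le> (\<Sum>j\<in>Y. real (b j (pos Y j)) * M + M)"
    unfolding psum_def sum_distrib_right
  proof (rule sum_mono)
    fix j assume "j \<in> Y"
    then show "f j (0 + pos Y j) * L \<le> real (b j (pos Y j)) * M + M"
      using assms(5)[of j] by (simp add: algebra_simps)
  qed
  also have "\<dots> = real (psum b 0 Y) * M + card Y * M"
    by (simp add: psum_def sum.distrib sum_distrib_right)
  also have "\<dots> \<le> real (psum b 0 Y) * M + n * M" using assms by (auto intro!: mult_right_mono)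
  finally show ?thesis .
qed

lemma rounding_below:
  fixes f :: "nat \<Rightarrow> nat \<Rightarrow> real"
  assumes "\<And>j. j \<in> Y \<Longrightarrow> real (b j (pos Y j)) * M \<le> f j (pos Y j) * L"
  shows "real (psum b 0 Y) * M \<le> psum f 0 Y * L"
  unfolding psum_def using assms by (simp add: sum_distrib_right sum_mono)

text \<open>Potential argument for regret matching. As \<open>u\<close> is the mean of
  \<open>a\<close> under \<open>y\<close>, and \<open>y\<close> equals the positive part of the
  regrets, the increments are orthogonal to that part and the mixed terms cancel; only squares of
  numbers of size at most 2 remain. If no regret is positive, the mixed terms vanish for any
  weights.\<close>

lemma regret_step:
  fixes R a :: "nat \<Rightarrow> real"
  assumes S: "S = (\<Sum>k<n. y k)" "0 < S" and y: "\<And>k. k < n \<Longrightarrow> 0 \<le> y k"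
    and a: "\<And>k. k < n \<Longrightarrow> 0 \<le> a k \<and> a k \<le> 2"
    and u: "u = (\<Sum>k<n. y k * a k) / S"
    and R: "(\<forall>k<n. y k = max (R k) 0) \<or> (\<forall>k<n. R k \<le> 0)"
  shows "(\<Sum>k<n. (max (R k + (u - a k)) 0)\<^sup>2) \<le> (\<Sum>k<n. (max (R k) 0)\<^sup>2) + 4 * n"
proof -
  have "0 \<le> u" unfolding u using y a S by (auto intro!: divide_nonneg_nonneg sum_nonneg mult_nonneg_nonneg)
  have "(\<Sum>k<n. y k * a k) \<le> (\<Sum>k<n. y k * 2)" using y a by (intro sum_mono mult_left_mono) auto
  also have "\<dots> = 2 * S" using S by (simp add: sum_distrib_left[symmetric] sum_distrib_right[symmetric])
  finally have "u \<le> 2" unfolding u using S by (simp add: field_simps)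
  have sq: "(max (R k + (u - a k)) 0)\<^sup>2 \<le> (max (R k) 0)\<^sup>2 + 2 * (max (R k) 0 * (u - a k)) + 4"
    if "k < n" for k
  proof -
    have d: "\<bar>u - a k\<bar> \<le> 2" using a[OF that] \<open>0 \<le> u\<close> \<open>u \<le> 2\<close> by auto
    have "\<bar>max (R k + (u - a k)) 0\<bar> \<le> \<bar>max (R k) 0 + (u - a k)\<bar>" by auto
    then have "(max (R k + (u - a k)) 0)\<^sup>2 \<le> (max (R k) 0 + (u - a k))\<^sup>2"
      by (metis abs_le_square_iff)
    also have "\<dots> = (max (R k) 0)\<^sup>2 + 2 * (max (R k) 0 * (u - a k)) + (u - a k)\<^sup>2"
      by (simp add: power2_sum)
    also have "(u - a k)\<^sup>2 \<le> 4" using power_mono[OF d, of 2] by simp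
    finally show ?thesis by simp
  qed
  have "(\<Sum>k<n. max (R k) 0 * (u - a k)) = 0"
  proof (cases "\<forall>k<n. R k \<le> 0")
    case True
    then show ?thesis by (intro sum.neutral) (auto simp: max_def)
  next
    case False
    then have "(\<Sum>k<n. max (R k) 0 * (u - a k)) = (\<Sum>k<n. y k * (u - a k))" using R by auto
    also have "\<dots> = S * u - (\<Sum>k<n. y k * a k)"
      by (simp add: S(1) right_diff_distrib sum_subtractf sum_distrib_right)
    also have "\<dots> = 0" using S u by simp
    finally show ?thesis .
  qed
  then have "(\<Sum>k<n. (max (R k) 0)\<^sup>2 + 2 * (max (R k) 0 * (u - a k)) + 4)
      = (\<Sum>k<n. (max (R k) 0)\<^sup>2) + 4 * n"
    by (simp add: sum.distrib sum_distrib_left[symmetric])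
  moreover have "(\<Sum>k<n. (max (R k + (u - a k)) 0)\<^sup>2) \<le> (\<Sum>k<n. (max (R k) 0)\<^sup>2 + 2 * (max (R k) 0 * (u - a k)) + 4)"
    using sq by (intro sum_mono) auto
  ultimately show ?thesis by simp
qed

section \<open>Optima, the value of the game and weak duality\<close>

lemma v_le_ge:
  assumes "finite X" "X' \<subseteq> X" "card X' \<le> k" shows "sum v X' \<le> v_le v k X"
  unfolding v_le_def
proof (rule Max_ge)
  show "finite {sum v X' |X'. X' \<subseteq> X \<and> card X' \<le> k}"
    by (rule finite_subset[of _ "sum v ` Pow X"]) (auto simp: assms)
qed (use assms in auto)

lemma v_le_le:
  assumes "finite X" "\<And>X'. X' \<subseteq> X \<Longrightarrow> card X' \<le> k \<Longrightarrow> sum v X' \<le> B" shows "v_le v k X \<le> B"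
proof -
  have "finite {sum v X' |X'. X' \<subseteq> X \<and> card X' \<le> k}"
    by (rule finite_subset[of _ "sum v ` Pow X"]) (auto simp: assms)
  moreover have "sum v {} \<in> {sum v X' |X'. X' \<subseteq> X \<and> card X' \<le> k}"
    by (intro CollectI exI[of _ "{}"]) auto
  ultimately show ?thesis unfolding v_le_def using assms(2) by (intro Max.boundedI) auto
qed

lemma v_le_nonneg: "finite X \<Longrightarrow> 0 \<le> v_le v k X"
  using v_le_ge[of X "{}" k v] by simp

lemma v_le_le_opt:
  assumes "knapsack_instance n s v C" "X \<in> feasible n s C"
  shows "v_le v k X \<le> v_le v k (X_opt n s v C k)"
  using X_opt_is_arg_max[OF assms(1), of k] assms(2) by (simp add: is_arg_max_linorder)

lemma X_opt_feasible: "knapsack_instance n s v C \<Longrightarrow> X_opt n s v C k \<in> feasible n s C"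
  using X_opt_is_arg_max[of n s v C k] by (simp add: is_arg_max_linorder)

lemma singleton_feasible:
  "knapsack_instance n s v C \<Longrightarrow> e \<in> {1..n} \<Longrightarrow> {e} \<in> feasible n s C"
  by (auto simp: feasible_def knapsack_instance_def)

lemma finite_of_feasible: "X \<in> feasible n s C \<Longrightarrow> finite X"
  using finite_subset[of X "{1..n}"] by (auto simp: feasible_def)

lemma opt_pos:
  assumes "knapsack_instance n s v C" "1 \<le> k" shows "0 < v_le v k (X_opt n s v C k)"
proof -
  have n: "1 \<in> {1..n}" "0 < v 1" using assms(1) by (auto simp: knapsack_instance_def)
  have "v 1 \<le> v_le v k {1}" using v_le_ge[of "{1}" "{1}" k v] assms(2) by simp
  then show ?thesis using v_le_le_opt[OF assms(1) singleton_feasible[OF assms(1) n(1)], of k] n by simp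
qed

text \<open>The most valuable item alone is worth at least \<open>1 / n\<close> of any set of at
  most \<open>n\<close> items, for every cardinality. This bound later turns the additive regret
  into a relative error.\<close>

lemma max_robustness_ge:
  assumes "knapsack_instance n s v C" shows "1 / n \<le> max_robustness n s v C"
proof -
  have n: "1 \<le> n" using assms by (simp add: knapsack_instance_def)
  obtain e where e: "e \<in> {1..n}" "\<And>i. i \<in> {1..n} \<Longrightarrow> v i \<le> v e"
    using finite_has_maximal[of "v ` {1..n}"] n Max_ge[of "v ` {1..n}"] Max_in[of "v ` {1..n}"]
    by (auto simp: image_iff) (metis Max_ge Max_in atLeastAtMost_iff empty_iff finite_atLeastAtMost finite_imageI image_eqI image_iff order_refl)
  have ve: "0 < v e" using assms e by (auto simp: knapsack_instance_def)
  let ?p = "return_pmf {e}"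
  have "?p \<in> distributions n s C"
    using singleton_feasible[OF assms e(1)] by (simp add: distributions_def)
  moreover have "1 / n \<le> robustness n s v C ?p"
    unfolding robustness_def
  proof (rule Min.boundedI, goal_cases)
    case (3 z)
    then obtain k where k: "k \<in> {1..n}" and z: "z = (\<Sum>X\<in>feasible n s C. pmf ?p X * v_le v k X / v_le v k (X_opt n s v C k))"
      by auto
    let ?o = "v_le v k (X_opt n s v C k)"
    have "z = (\<Sum>X\<in>feasible n s C. if X = {e} then v_le v k {e} / ?o else 0)"
      unfolding z by (intro sum.cong) (auto simp: indicator_def)
    also have "\<dots> = v_le v k {e} / ?o"
      using singleton_feasible[OF assms e(1)] by (simp add: finite_feasible)
    finally have z: "z = v_le v k {e} / ?o" .
    have ek: "v e \<le> v_le v k {e}" using v_le_ge[of "{e}" "{e}" k v] k by simp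
    have "?o \<le> n * v e"
    proof (rule v_le_le)
      show "finite (X_opt n s v C k)" using X_opt_feasible[OF assms] finite_of_feasible by blast
      fix X' assume X': "X' \<subseteq> X_opt n s v C k" "card X' \<le> k"
      have "X' \<subseteq> {1..n}" using X' X_opt_feasible[OF assms, of k] by (auto simp: feasible_def)
      then have "sum v X' \<le> of_nat (card X') * v e" using e by (intro sum_bounded_above) auto
      also have "\<dots> \<le> n * v e" using X' k ve by (intro mult_right_mono) auto
      finally show "sum v X' \<le> n * v e" .
    qed
    also have "\<dots> \<le> n * v_le v k {e}" using ek by (intro mult_left_mono) auto
    finally have "?o \<le> n * v_le v k {e}" .
    then show ?case unfolding z using opt_pos[OF assms, of k] k n by (simp add: field_simps)
  qed (use n in auto)
  ultimately show ?thesis unfolding max_robustness_def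
    by (intro cSUP_upper2[where x="?p"] robustness_bdd_above[OF assms])
qed

text \<open>Weak duality: the weights \<open>y\<close> are a mixed strategy of the adversary.\<close>

lemma max_robustness_le:
  assumes inst: "knapsack_instance n s v C" and y: "\<And>k. k < n \<Longrightarrow> 0 \<le> y k"
    and pos: "0 < (\<Sum>k<n. y k)"
    and B: "\<And>X. X \<in> feasible n s C \<Longrightarrow>
      (\<Sum>k<n. y k * (v_le v (Suc k) X / v_le v (Suc k) (X_opt n s v C (Suc k)))) \<le> B"
  shows "max_robustness n s v C * (\<Sum>k<n. y k) \<le> B"
proof -
  let ?o = "\<lambda>k. v_le v k (X_opt n s v C k)"
  let ?F = "feasible n s C"
  have "robustness n s v C p \<le> B / (\<Sum>k<n. y k)" if p: "p \<in> distributions n s C" for p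
  proof -
    have le: "robustness n s v C p \<le> (\<Sum>X\<in>?F. pmf p X * v_le v (Suc k) X / ?o (Suc k))" if "k < n" for k
      unfolding robustness_def using that by (intro Min_le) auto
    have "robustness n s v C p * (\<Sum>k<n. y k) = (\<Sum>k<n. y k * robustness n s v C p)"
      by (simp add: sum_distrib_right mult.commute)
    also have "\<dots> \<le> (\<Sum>k<n. y k * (\<Sum>X\<in>?F. pmf p X * v_le v (Suc k) X / ?o (Suc k)))"
      using y le by (intro sum_mono mult_left_mono) auto
    also have "\<dots> = (\<Sum>k<n. \<Sum>X\<in>?F. pmf p X * (y k * (v_le v (Suc k) X / ?o (Suc k))))"
      by (simp add: sum_distrib_left mult_ac)
    also have "\<dots> = (\<Sum>X\<in>?F. \<Sum>k<n. pmf p X * (y k * (v_le v (Suc k) X / ?o (Suc k))))"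
      by (rule sum.swap)
    also have "\<dots> = (\<Sum>X\<in>?F. pmf p X * (\<Sum>k<n. y k * (v_le v (Suc k) X / ?o (Suc k))))"
      by (simp add: sum_distrib_left)
    also have "\<dots> \<le> (\<Sum>X\<in>?F. pmf p X * B)" using B by (intro sum_mono mult_left_mono) auto
    also have "\<dots> = B"
    proof -
      have "(\<Sum>X\<in>?F. pmf p X) = 1"
        using p by (intro sum_pmf_eq_1) (auto simp: finite_feasible distributions_def)
      then show ?thesis by (simp add: sum_distrib_right[symmetric])
    qed
    finally show ?thesis using pos by (simp add: field_simps)
  qed
  then have "max_robustness n s v C \<le> B / (\<Sum>k<n. y k)"
    unfolding max_robustness_def by (intro cSUP_least distributions_nonempty[OF inst])
  then show ?thesis using pos by (simp add: field_simps)
qed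

text \<open>The right-hand side has the form demanded by \<open>outputs\<close>: a set played in
  several rounds collects \<open>1 / T\<close> from each.\<close>

lemma pmf_uniform_family:
  assumes "0 < T"
  shows "pmf (map_pmf Y (pmf_of_set {..<T::nat})) X = (\<Sum>t | t < T \<and> Y t = X. 1 / real T)"
proof -
  have "pmf (map_pmf Y (pmf_of_set {..<T})) X = card ({..<T} \<inter> Y -` {X}) / T"
    using assms by (simp add: pmf_map measure_pmf_of_set lessThan_empty_iff)
  also have "{..<T} \<inter> Y -` {X} = {t. t < T \<and> Y t = X}" by auto
  finally show ?thesis by simp
qed

text \<open>Under this distribution the expected ratio for a cardinality is the mean over the
  rounds, so the robustness is controlled by cumulative payoffs, which is what a regret bound
  supplies.\<close>

lemma robustness_uniform_family:
  assumes inst: "knapsack_instance n s v C" and T: "0 < (T::nat)"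
    and Y: "\<And>t. t < T \<Longrightarrow> Y t \<in> feasible n s C"
    and r: "\<And>k. k < n \<Longrightarrow>
      r * T \<le> (\<Sum>t<T. v_le v (Suc k) (Y t) / v_le v (Suc k) (X_opt n s v C (Suc k)))"
  shows "r \<le> robustness n s v C (map_pmf Y (pmf_of_set {..<T}))"
  unfolding robustness_def
proof (rule Min.boundedI, goal_cases)
  case (3 z)
  then obtain k where "k \<in> {1..n}"
    "z = (\<Sum>X\<in>feasible n s C. pmf (map_pmf Y (pmf_of_set {..<T})) X * v_le v k X / v_le v k (X_opt n s v C k))"
    by auto
  then obtain k where k: "k < n" and z:
    "z = (\<Sum>X\<in>feasible n s C. pmf (map_pmf Y (pmf_of_set {..<T})) X * v_le v (Suc k) X / v_le v (Suc k) (X_opt n s v C (Suc k)))"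
    by (metis Suc_le_D Suc_le_eq One_nat_def atLeastAtMost_iff)
  let ?g = "\<lambda>X. v_le v (Suc k) X / v_le v (Suc k) (X_opt n s v C (Suc k))"
  have "z = (\<Sum>X\<in>feasible n s C. \<Sum>t<T. if Y t = X then 1 / T * ?g (Y t) else 0)"
    unfolding z
  proof (rule sum.cong[OF refl])
    fix X
    have "(\<Sum>t<T. if Y t = X then 1 / T * ?g (Y t) else 0) = (\<Sum>t | t \<in> {..<T} \<and> Y t = X. 1 / T * ?g (Y t))"
      by (rule sum.inter_filter[symmetric]) simp
    also have "\<dots> = (\<Sum>t | t < T \<and> Y t = X. 1 / T) * ?g X"
      by (simp add: sum_distrib_right)
    finally show "pmf (map_pmf Y (pmf_of_set {..<T})) X * v_le v (Suc k) X / v_le v (Suc k) (X_opt n s v C (Suc k))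
      = (\<Sum>t<T. if Y t = X then 1 / T * ?g (Y t) else 0)"
      using pmf_uniform_family[OF T, of Y X] by simp
  qed
  also have "\<dots> = (\<Sum>t<T. \<Sum>X\<in>feasible n s C. if Y t = X then 1 / T * ?g (Y t) else 0)"
    by (rule sum.swap)
  also have "\<dots> = (\<Sum>t<T. 1 / T * ?g (Y t))"
    using Y by (intro sum.cong) (auto simp: finite_feasible)
  also have "\<dots> = (\<Sum>t<T. ?g (Y t)) / T" by (simp add: sum_divide_distrib mult.commute)
  finally have "z = (\<Sum>t<T. ?g (Y t)) / T" .
  moreover have "r \<le> (\<Sum>t<T. ?g (Y t)) / T" using r[OF k] T by (simp add: pos_le_divide_eq)
  ultimately show ?case by simp
qed (use inst in \<open>auto simp: knapsack_instance_def\<close>)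

section \<open>An approximate best response\<close>

text \<open>
  Sorted items are numbered from 0, and \<open>pm\<close> holds the original index of each. The language has no
  multiplication of naturals, so \<open>mn\<close> and \<open>mq\<close> are tables of multiples of \<open>n + 1\<close> and \<open>n L + 1\<close> that
  serve to address the table \<open>bt\<close> of rounded profits (by item and position) and the table \<open>G\<close> of
  least sizes (by remaining items, chosen items and profit). The chosen set is left in \<open>x\<close>.
\<close>

declare sem.simps(6) [simp del]
declare nats_sem [simp] reals_sem [simp]

abbreviation item_value :: "nexp \<Rightarrow> rexp" where "item_value a \<equiv> RCell ''v'' (NCell ''pm'' a)"
abbreviation item_size :: "nexp \<Rightarrow> rexp" where "item_size a \<equiv> RCell ''s'' (NCell ''pm'' a)"
abbreviation at2 :: "nexp \<Rightarrow> nexp \<Rightarrow> nexp" where "at2 j c \<equiv> NAdd (NCell ''mn'' j) c"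
abbreviation at3 :: "nexp \<Rightarrow> nexp \<Rightarrow> nexp \<Rightarrow> nexp" where "at3 r c q \<equiv> NAdd (NCell ''mq'' (at2 r c)) q"
abbreviation nset :: "string \<Rightarrow> nexp \<Rightarrow> prog" where "nset x a \<equiv> PN x (NConst 0) a"
abbreviation rset :: "string \<Rightarrow> rexp \<Rightarrow> prog" where "rset x a \<equiv> PR x (NConst 0) a"

text \<open>There is no floor on reals, so the rounded quotient is counted up, in parallel as a
  natural \<open>b\<close> for addressing and as a real \<open>rb\<close> for comparing. No profit
  exceeds \<open>M\<close>, therefore \<open>L\<close> attempts are enough.\<close>

definition round_count :: prog where
  "round_count = nset ''b'' (NConst 0) ;; rset ''rb'' (RConst 0) ;;
     PFor ''i'' ''L''
       (PIf (RLess (RMul (RVar ''pr'') (RVar ''rL'')) (RMul (RAdd (RVar ''rb'') (RConst 1)) (RVar ''M'')))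
         PSkip
         (nset ''b'' (NAdd (NVar ''b'') (NConst 1)) ;; rset ''rb'' (RAdd (RVar ''rb'') (RConst 1))))"

definition profit_row :: prog where
  "profit_row = PFor ''c'' ''n''
     (rset ''pr'' (RMul (item_value (NVar ''j'')) (RCell ''W'' (NVar ''c''))) ;;
      round_count ;; PN ''bt'' (at2 (NVar ''j'') (NVar ''c'')) (NVar ''b''))"

definition profit_table :: prog where
  "profit_table = PFor ''j'' ''n'' profit_row"

definition dp_base_row :: prog where
  "dp_base_row = PFor ''q'' ''Q1''
     (PR ''G'' (at3 (NConst 0) (NVar ''c'') (NVar ''q'')) (RAdd (RVar ''C'') (RConst 1)))"

definition dp_base :: prog where
  "dp_base = PFor ''c'' ''n1''
     (dp_base_row ;;
      PR ''G'' (at3 (NConst 0) (NVar ''c'') (NConst 0)) (RConst 0))"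

abbreviation cur_item :: nexp where "cur_item \<equiv> NSub (NVar ''n'') (NAdd (NVar ''r'') (NConst 1))"

definition dp_row :: prog where
  "dp_row = PFor ''q'' ''Q1''
     (rset ''g1'' (RCell ''G'' (at3 (NVar ''r'') (NVar ''c'') (NVar ''q''))) ;;
      rset ''g2'' (RAdd (item_size cur_item)
        (RCell ''G'' (at3 (NVar ''r'') (NAdd (NVar ''c'') (NConst 1))
          (NSub (NVar ''q'') (NCell ''bt'' (at2 cur_item (NVar ''c'')))))) ) ;;
      PIf (RLess (RVar ''g2'') (RVar ''g1''))
        (PR ''G'' (at3 (NAdd (NVar ''r'') (NConst 1)) (NVar ''c'') (NVar ''q'')) (RVar ''g2''))
        (PR ''G'' (at3 (NAdd (NVar ''r'') (NConst 1)) (NVar ''c'') (NVar ''q'')) (RVar ''g1'')))"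

definition dp_level :: prog where
  "dp_level = PFor ''c'' ''n'' dp_row"

definition dp :: prog where
  "dp = PFor ''r'' ''n'' dp_level"

text \<open>The scan goes upwards and overwrites \<open>qs\<close>, so the largest profit attainable
  within the capacity remains.\<close>

definition find_target :: prog where
  "find_target = nset ''qs'' (NConst 0) ;;
     PFor ''q'' ''Q1''
       (PIf (RLess (RVar ''C'') (RCell ''G'' (at3 (NVar ''n'') (NConst 0) (NVar ''q'')))) PSkip
         (nset ''qs'' (NVar ''q'')))"

text \<open>A strict decrease of the table entry shows that the minimum was reached by taking the
  item; \<open>cc\<close> and \<open>qs\<close> then move to the entry from which that minimum was
  formed.\<close>

definition backtrack :: prog where
  "backtrack = nset ''cc'' (NConst 0) ;;
     PFor ''j'' ''n''
       (PIf (RLess (RCell ''G'' (at3 (NSub (NVar ''n'') (NVar ''j'')) (NVar ''cc'') (NVar ''qs'')))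
                   (RCell ''G'' (at3 (NSub (NVar ''n'') (NAdd (NVar ''j'') (NConst 1))) (NVar ''cc'') (NVar ''qs''))))
         (PN ''x'' (NVar ''j'') (NConst 1) ;;
          nset ''qs'' (NSub (NVar ''qs'') (NCell ''bt'' (at2 (NVar ''j'') (NVar ''cc'')))) ;;
          nset ''cc'' (NAdd (NVar ''cc'') (NConst 1)))
         (PN ''x'' (NVar ''j'') (NConst 0)))"

definition best_response :: prog where
  "best_response = rset ''M'' (RMul (item_value (NConst 0)) (RCell ''W'' (NConst 0))) ;;
     profit_table ;; dp_base ;; dp ;; find_target ;; backtrack"

text \<open>Makes the addresses of the flattened tables free of collisions, so that writing one
  entry preserves the others.\<close>

lemma mixed_radix:
  fixes q q' K :: nat
  assumes "q < K" "q' < K" shows "a * K + q = a' * K + q' \<longleftrightarrow> a = a' \<and> q = q'"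
proof
  assume e: "a * K + q = a' * K + q'"
  have "a = (a * K + q) div K" "a' = (a' * K + q') div K" using assms by auto
  then have "a = a'" using e by simp
  then show "a = a' \<and> q = q'" using e by simp
qed auto

lemma round_count_vars [simp]: "nvars round_count = {''b'', ''i''}" "rvars round_count = {''rb''}"
  by (auto simp: round_count_def)

lemma profit_row_vars [simp]:
  "nvars profit_row = {''b'', ''i'', ''c'', ''bt''}" "rvars profit_row = {''rb'', ''pr''}"
  by (auto simp: profit_row_def)

lemma profit_table_vars [simp]:
  "nvars profit_table = {''b'', ''i'', ''c'', ''bt'', ''j''}" "rvars profit_table = {''rb'', ''pr''}"
  by (auto simp: profit_table_def)

lemma dp_base_row_vars [simp]: "nvars dp_base_row = {''q''}" "rvars dp_base_row = {''G''}"
  by (auto simp: dp_base_row_def)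

lemma dp_base_vars [simp]: "nvars dp_base = {''q'', ''c''}" "rvars dp_base = {''G''}"
  by (auto simp: dp_base_def)

lemma dp_row_vars [simp]: "nvars dp_row = {''q''}" "rvars dp_row = {''G'', ''g1'', ''g2''}"
  by (auto simp: dp_row_def)

lemma dp_level_vars [simp]: "nvars dp_level = {''q'', ''c''}" "rvars dp_level = {''G'', ''g1'', ''g2''}"
  by (auto simp: dp_level_def)

lemma dp_vars [simp]: "nvars dp = {''q'', ''c'', ''r''}" "rvars dp = {''G'', ''g1'', ''g2''}"
  by (auto simp: dp_def)

lemma find_target_vars [simp]: "nvars find_target = {''q'', ''qs''}" "rvars find_target = {}"
  by (auto simp: find_target_def)

lemma backtrack_vars [simp]: "nvars backtrack = {''cc'', ''qs'', ''x'', ''j''}" "rvars backtrack = {}"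
  by (auto simp: backtrack_def)

lemma best_response_vars [simp]:
  "nvars best_response = {''b'', ''i'', ''c'', ''bt'', ''j'', ''q'', ''r'', ''qs'', ''cc'', ''x''}"
  "rvars best_response = {''M'', ''rb'', ''pr'', ''G'', ''g1'', ''g2''}"
  by (auto simp: best_response_def)

lemma round_count_spec:
  assumes "reals \<sigma> ''rL'' 0 = real (nats \<sigma> ''L'' 0)" "0 < reals \<sigma> ''M'' 0"
    "0 \<le> reals \<sigma> ''pr'' 0" "reals \<sigma> ''pr'' 0 \<le> reals \<sigma> ''M'' 0"
  defines "b \<equiv> nats (sem round_count \<sigma>) ''b'' 0"
  shows "b \<le> nats \<sigma> ''L'' 0 \<and> real b * reals \<sigma> ''M'' 0 \<le> reals \<sigma> ''pr'' 0 * nats \<sigma> ''L'' 0 \<and>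
    reals \<sigma> ''pr'' 0 * nats \<sigma> ''L'' 0 < (real b + 1) * reals \<sigma> ''M'' 0"
proof -
  let ?L = "nats \<sigma> ''L'' 0" and ?M = "reals \<sigma> ''M'' 0" and ?p = "reals \<sigma> ''pr'' 0"
  define I where "I m \<tau> \<longleftrightarrow> reals \<tau> ''rb'' 0 = real (nats \<tau> ''b'' 0) \<and> nats \<tau> ''b'' 0 \<le> m \<and>
    real (nats \<tau> ''b'' 0) * ?M \<le> ?p * ?L \<and>
    (nats \<tau> ''b'' 0 = m \<or> ?p * ?L < (real (nats \<tau> ''b'' 0) + 1) * ?M)" for m and \<tau> :: state
  have "I ?L (sem round_count \<sigma>)"
    unfolding round_count_def sem.simps(1-5)
  proof (rule sem_for, goal_cases)
    case (4 m \<tau>)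
    then show ?case using assms(1) by (auto simp: I_def algebra_simps)
  qed (use assms in \<open>auto simp: I_def\<close>)
  \<comment> \<open>Covers the run in which all \<open>L\<close> attempts succeed: then
    \<open>b\<close> is \<open>L\<close>, and the upper estimate follows from the profit being at
    most \<open>M\<close>.\<close>
  moreover have "?p * ?L < (real ?L + 1) * ?M"
  proof -
    have "?p * ?L \<le> ?M * ?L" using assms by (intro mult_right_mono) auto
    also have "\<dots> < (real ?L + 1) * ?M" using assms by (simp add: algebra_simps)
    finally show ?thesis .
  qed
  ultimately show ?thesis by (auto simp: I_def b_def)
qed

locale sorted_knapsack =
  fixes n L :: nat and w z :: "nat \<Rightarrow> real" and C :: real
  assumes n_pos: "1 \<le> n" and L_pos: "1 \<le> L"
    and w_pos: "j < n \<Longrightarrow> 0 < w j" and z_pos: "j < n \<Longrightarrow> 0 < z j" and z_le: "j < n \<Longrightarrow> z j \<le> C"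
    and w_antimono: "i \<le> j \<Longrightarrow> j < n \<Longrightarrow> w j \<le> w i"
begin

definition adr2 :: "nat \<Rightarrow> nat \<Rightarrow> nat" where
  "adr2 j c = j * Suc n + c"

definition adr3 :: "nat \<Rightarrow> nat \<Rightarrow> nat \<Rightarrow> nat" where
  "adr3 r c q = adr2 r c * Suc (n * L) + q"

text \<open>Collects what the set-up establishes and the later programs only read, so it passes
  through them by the frame properties. \<open>mq\<close> has to be correct below
  \<open>(n + 1) * (n + 1)\<close>, the range of \<open>adr2 r c\<close> for \<open>r\<close> and
  \<open>c\<close> up to \<open>n\<close>.\<close>

definition ready :: "state \<Rightarrow> bool" where
  "ready \<sigma> \<longleftrightarrow> nats \<sigma> ''n'' 0 = n \<and> nats \<sigma> ''n1'' 0 = Suc n \<and> nats \<sigma> ''L'' 0 = L \<and>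
     nats \<sigma> ''Q1'' 0 = Suc (n * L) \<and> reals \<sigma> ''rL'' 0 = real L \<and> reals \<sigma> ''C'' 0 = C \<and>
     (\<forall>j\<le>n. nats \<sigma> ''mn'' j = j * Suc n) \<and>
     (\<forall>j<Suc n * Suc n. nats \<sigma> ''mq'' j = j * Suc (n * L)) \<and>
     (\<forall>j<n. reals \<sigma> ''v'' (nats \<sigma> ''pm'' j) = w j \<and> reals \<sigma> ''s'' (nats \<sigma> ''pm'' j) = z j)"

definition feas :: "nat set \<Rightarrow> bool" where
  "feas Y \<longleftrightarrow> Y \<subseteq> {..<n} \<and> sum z Y \<le> C"

lemma adr2_simps [simp]: "Suc (adr2 j c) = adr2 j (Suc c)" "adr2 j a + c = adr2 j (a + c)"
  by (auto simp: adr2_def)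

lemma adr3_simps [simp]: "adr3 r c a + q = adr3 r c (a + q)"
  by (simp add: adr3_def del: adr2_simps)

lemma adr2_eq [simp]: "c \<le> n \<Longrightarrow> c' \<le> n \<Longrightarrow> adr2 j c = adr2 j' c' \<longleftrightarrow> j = j' \<and> c = c'"
  unfolding adr2_def by (rule mixed_radix) auto

lemma adr3_eq [simp]:
  "\<lbrakk>c \<le> n; c' \<le> n; q \<le> n * L; q' \<le> n * L\<rbrakk> \<Longrightarrow>
    adr3 r c q = adr3 r' c' q' \<longleftrightarrow> r = r' \<and> c = c' \<and> q = q'"
  unfolding adr3_def by (subst mixed_radix) auto

lemma readyD:
  assumes "ready \<sigma>"
  shows "nats \<sigma> ''n'' 0 = n" "nats \<sigma> ''n1'' 0 = Suc n" "nats \<sigma> ''L'' 0 = L"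
    "nats \<sigma> ''Q1'' 0 = Suc (n * L)" "reals \<sigma> ''rL'' 0 = real L" "reals \<sigma> ''C'' 0 = C"
    "j \<le> n \<Longrightarrow> nats \<sigma> ''mn'' j = adr2 j 0"
    "r \<le> n \<Longrightarrow> c \<le> n \<Longrightarrow> nats \<sigma> ''mq'' (adr2 r c) = adr3 r c 0"
    "j < n \<Longrightarrow> reals \<sigma> ''v'' (nats \<sigma> ''pm'' j) = w j"
    "j < n \<Longrightarrow> reals \<sigma> ''s'' (nats \<sigma> ''pm'' j) = z j"
proof -
  assume "r \<le> n" "c \<le> n"
  then have "r * Suc n + c < Suc (n * Suc n + n)" using mult_le_mono1[of r n "Suc n"] by linarith
  then have "adr2 r c < Suc n * Suc n" by (simp add: adr2_def)
  then show "nats \<sigma> ''mq'' (adr2 r c) = adr3 r c 0"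
    using assms unfolding ready_def adr3_def by simp
qed (use assms in \<open>auto simp: ready_def adr2_def\<close>)

lemma ready_frame:
  assumes "ready \<sigma>"
    and "\<And>x. x \<in> {''n'', ''n1'', ''L'', ''Q1'', ''mn'', ''mq'', ''pm''} \<Longrightarrow> nats \<tau> x = nats \<sigma> x"
    and "\<And>x. x \<in> {''rL'', ''C'', ''v'', ''s''} \<Longrightarrow> reals \<tau> x = reals \<sigma> x"
  shows "ready \<tau>"
  using assms(1) unfolding ready_def by (simp only: assms(2,3) insert_iff simp_thms) blast

lemma ready_rwrite [simp]:
  "x \<notin> {''rL'', ''C'', ''v'', ''s''} \<Longrightarrow> ready (rwrite x i c \<sigma>) = ready \<sigma>"
  unfolding ready_def by (auto simp: reals_rwrite_other simp del: reals_rwrite)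

lemma ready_sem:
  assumes "ready \<sigma>" "nvars p \<inter> {''n'', ''n1'', ''L'', ''Q1'', ''mn'', ''mq'', ''pm''} = {}"
    "rvars p \<inter> {''rL'', ''C'', ''v'', ''s''} = {}"
  shows "ready (sem p \<sigma>)"
  using assms(1) by (rule ready_frame) (use assms(2,3) in \<open>auto intro!: nats_sem reals_sem\<close>)

end

text \<open>Two kinds of weights are used: indicators of the positions up to \<open>k\<close>, and
  tail sums of the adversary's scaled weights. In both the first position has the largest weight, so
  the first item at position 0 has the largest profit of all.\<close>

locale weighted_knapsack = sorted_knapsack +
  fixes W :: "nat \<Rightarrow> real"
  assumes W_nonneg: "c < n \<Longrightarrow> 0 \<le> W c" and W_le: "c < n \<Longrightarrow> W c \<le> W 0" and W0_pos: "0 < W 0"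
begin

text \<open>The profit of the set consisting of the first item. It bounds every single profit from
  above and the best response from below; this double role makes the rounding error
  relative.\<close>

definition M :: real where "M = w 0 * W 0"

lemma M_pos: "0 < M" using W0_pos w_pos n_pos by (simp add: M_def)

definition rounds :: "nat \<Rightarrow> nat \<Rightarrow> nat \<Rightarrow> bool" where
  "rounds j c b \<longleftrightarrow> b \<le> L \<and> real b * M \<le> w j * W c * L \<and> w j * W c * L < (real b + 1) * M"

definition readyW :: "state \<Rightarrow> bool" where
  "readyW \<sigma> \<longleftrightarrow> ready \<sigma> \<and> (\<forall>c<n. reals \<sigma> ''W'' c = W c) \<and> reals \<sigma> ''M'' 0 = M"

lemma readyW_frame:
  assumes "readyW \<sigma>"
    and "\<And>x. x \<in> {''n'', ''n1'', ''L'', ''Q1'', ''mn'', ''mq'', ''pm''} \<Longrightarrow> nats \<tau> x = nats \<sigma> x"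
    and "\<And>x. x \<in> {''rL'', ''C'', ''v'', ''s'', ''W'', ''M''} \<Longrightarrow> reals \<tau> x = reals \<sigma> x"
  shows "readyW \<tau>"
proof -
  have "ready \<tau>" using assms unfolding readyW_def by (intro ready_frame[of \<sigma> \<tau>]) auto
  then show ?thesis using assms(1) by (simp add: readyW_def assms(3))
qed

lemma readyWD: "readyW \<sigma> \<Longrightarrow> c < n \<Longrightarrow> reals \<sigma> ''W'' c = W c" "readyW \<sigma> \<Longrightarrow> reals \<sigma> ''M'' 0 = M"
  "readyW \<sigma> \<Longrightarrow> ready \<sigma>"
  by (auto simp: readyW_def)

lemma profit_row_spec:
  assumes "readyW \<sigma>" "nats \<sigma> ''j'' 0 = j" "j < n"
  shows "(\<forall>c<n. rounds j c (nats (sem profit_row \<sigma>) ''bt'' (adr2 j c))) \<and>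
    (\<forall>j' c. j' \<noteq> j \<longrightarrow> c \<le> n \<longrightarrow> nats (sem profit_row \<sigma>) ''bt'' (adr2 j' c) = nats \<sigma> ''bt'' (adr2 j' c))"
proof -
  define I where "I m \<tau> \<longleftrightarrow> (\<forall>c<m. rounds j c (nats \<tau> ''bt'' (adr2 j c))) \<and>
    (\<forall>j' c. j' \<noteq> j \<longrightarrow> c \<le> n \<longrightarrow> nats \<tau> ''bt'' (adr2 j' c) = nats \<sigma> ''bt'' (adr2 j' c))"
    for m and \<tau> :: state
  have "I n (sem profit_row \<sigma>)"
    unfolding profit_row_def sem.simps(1-5)
  proof (rule sem_for, goal_cases)
    case (4 m \<tau>)
    note [simp] = 4(2,3,4) readyD[OF readyWD(3)[OF assms(1)]] readyWD(1,2)[OF assms(1)] assms(2,3)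
      less_imp_le[OF assms(3)]
    let ?s = "rwrite ''pr'' 0 (w j * W m) \<tau>"
    have "w j * W m \<le> w 0 * W 0"
      using assms(3) 4(1) by (intro mult_mono w_antimono W_le W_nonneg) (use w_pos[of 0] n_pos in auto)
    moreover have "0 \<le> w j * W m" using w_pos[OF assms(3)] W_nonneg[OF 4(1)] by simp
    ultimately have "rounds j m (nats (sem round_count ?s) ''b'' 0)"
      using round_count_spec[of ?s] M_pos by (simp add: rounds_def M_def)
    moreover have "sem (rset ''pr'' (RMul (item_value (NVar ''j'')) (RCell ''W'' (NVar ''c''))) ;;
      round_count ;; PN ''bt'' (at2 (NVar ''j'') (NVar ''c'')) (NVar ''b'')) \<tau> =
      nwrite ''bt'' (adr2 j m) (nats (sem round_count ?s) ''b'' 0) (sem round_count ?s)"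
      using 4(1) by simp
    ultimately show ?case using 4(1,5) by (auto simp: I_def less_Suc_eq simp del: sem.simps)
  qed (use assms readyD(1)[OF readyWD(3)] in \<open>auto simp: I_def\<close>)
  then show ?thesis by (simp add: I_def)
qed


lemma profit_table_spec:
  assumes "readyW \<sigma>"
  shows "\<forall>j<n. \<forall>c<n. rounds j c (nats (sem profit_table \<sigma>) ''bt'' (adr2 j c))"
proof -
  define I where "I m \<tau> \<longleftrightarrow> (\<forall>j<m. \<forall>c<n. rounds j c (nats \<tau> ''bt'' (adr2 j c)))"
    for m and \<tau> :: state
  have "I n (sem profit_table \<sigma>)"
    unfolding profit_table_def sem.simps(1-5)
  proof (rule sem_for, goal_cases)
    case (4 m \<tau>)
    have R: "readyW \<tau>" by (rule readyW_frame[OF assms(1)]) (auto simp: 4)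
    show ?case using profit_row_spec[OF R 4(2,1)] 4(1,5)
      by (auto simp: I_def less_Suc_eq simp del: sem.simps)
  qed (use assms readyD(1)[OF readyWD(3)] in \<open>auto simp: I_def\<close>)
  then show ?thesis by (simp add: I_def)
qed

end

section \<open>Correctness of the dynamic program and of the reconstruction\<close>

context sorted_knapsack
begin

lemma dp_base_row_spec:
  assumes "ready \<sigma>" "nats \<sigma> ''c'' 0 = c" "c \<le> n"
  shows "(\<forall>q\<le>n * L. reals (sem dp_base_row \<sigma>) ''G'' (adr3 0 c q) = C + 1) \<and>
    (\<forall>c' q. c' \<noteq> c \<longrightarrow> c' \<le> n \<longrightarrow> q \<le> n * L \<longrightarrow>
      reals (sem dp_base_row \<sigma>) ''G'' (adr3 0 c' q) = reals \<sigma> ''G'' (adr3 0 c' q))"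
proof -
  define I where "I m \<tau> \<longleftrightarrow> (\<forall>q<m. reals \<tau> ''G'' (adr3 0 c q) = C + 1) \<and>
    (\<forall>c' q. c' \<noteq> c \<longrightarrow> c' \<le> n \<longrightarrow> q \<le> n * L \<longrightarrow> reals \<tau> ''G'' (adr3 0 c' q) = reals \<sigma> ''G'' (adr3 0 c' q))"
    for m and \<tau> :: state
  have "I (Suc (n * L)) (sem dp_base_row \<sigma>)"
    unfolding dp_base_row_def sem.simps(1-5)
  proof (rule sem_for, goal_cases)
    case (4 m \<tau>)
    note [simp] = 4(2,3,4) readyD[OF assms(1)] assms(2,3)
    show ?case using 4(1,5) by (auto simp: I_def less_Suc_eq_le)
  qed (use assms readyD(4) in \<open>auto simp: I_def\<close>)
  then show ?thesis by (simp add: I_def less_Suc_eq_le)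
qed

lemma dp_base_spec:
  assumes "ready \<sigma>"
  shows "\<forall>c\<le>n. \<forall>q\<le>n * L. reals (sem dp_base \<sigma>) ''G'' (adr3 0 c q) = min_size n z b C 0 c q"
proof -
  define I where "I m \<tau> \<longleftrightarrow> (\<forall>c<m. \<forall>q\<le>n * L. reals \<tau> ''G'' (adr3 0 c q) = min_size n z b C 0 c q)"
    for m and \<tau> :: state
  have "I (Suc n) (sem dp_base \<sigma>)"
    unfolding dp_base_def sem.simps(1-5)
  proof (rule sem_for, goal_cases)
    case (4 m \<tau>)
    note [simp] = 4(2,3,4) readyD[OF assms(1)]
    have R: "ready \<tau>" by (rule ready_frame[OF assms(1)]) (auto simp: 4)
    have m: "m \<le> n" using 4(1) by simp
    note b = dp_base_row_spec[OF R 4(2) m]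
    have "reals (sem dp_base_row \<tau>) ''G'' (adr3 0 c q) = min_size n z b C 0 c q"
      if "c < m" "q \<le> n * L" for c q
      using b m 4(5) that by (auto simp: I_def)
    then show ?case using b m by (auto simp: I_def less_Suc_eq)
  qed (use assms readyD(2) in \<open>auto simp: I_def\<close>)
  then show ?thesis by (simp add: I_def less_Suc_eq_le)
qed

text \<open>Only level \<open>r + 1\<close> is written and only level \<open>r\<close> is read, so
  every entry can be expressed by the table as it was before the loop.\<close>

lemma dp_row_spec:
  assumes "ready \<sigma>" "nats \<sigma> ''r'' 0 = r" "r < n" "nats \<sigma> ''c'' 0 = c" "c < n"
  shows "\<forall>r' c' q'. c' \<le> n \<longrightarrow> q' \<le> n * L \<longrightarrow> reals (sem dp_row \<sigma>) ''G'' (adr3 r' c' q') =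
    (if r' = Suc r \<and> c' = c
     then min (reals \<sigma> ''G'' (adr3 r c q')) (z (n - Suc r) +
       reals \<sigma> ''G'' (adr3 r (Suc c) (q' - nats \<sigma> ''bt'' (adr2 (n - Suc r) c))))
     else reals \<sigma> ''G'' (adr3 r' c' q'))"
proof -
  define f where "f q' = min (reals \<sigma> ''G'' (adr3 r c q')) (z (n - Suc r) +
       reals \<sigma> ''G'' (adr3 r (Suc c) (q' - nats \<sigma> ''bt'' (adr2 (n - Suc r) c))))" for q'
  define I where "I m \<tau> \<longleftrightarrow> (\<forall>r' c' q'. c' \<le> n \<longrightarrow> q' \<le> n * L \<longrightarrow> reals \<tau> ''G'' (adr3 r' c' q') =
    (if r' = Suc r \<and> c' = c \<and> q' < m then f q' else reals \<sigma> ''G'' (adr3 r' c' q')))"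
    for m and \<tau> :: state
  have "I (Suc (n * L)) (sem dp_row \<sigma>)"
    unfolding dp_row_def sem.simps(4)
  proof (rule sem_for, goal_cases)
    case (4 m \<tau>)
    note [simp] = 4(2,3,4) readyD[OF assms(1)] assms(2-) less_imp_le[OF assms(3)] less_imp_le[OF assms(5)]
      Suc_le_eq
    have m: "m \<le> n * L" using 4(1) by simp
    have G: "reals \<tau> ''G'' (adr3 r c' q) = reals \<sigma> ''G'' (adr3 r c' q)" if "c' \<le> n" "q \<le> n * L" for c' q
      using 4(5) that by (simp add: I_def)
    let ?b = "nats \<sigma> ''bt'' (adr2 (n - Suc r) c)"
    have b: "m - ?b \<le> n * L" using m by simp
    have sz: "n - Suc r < n" using assms(3) by linarith
    note [simp] = G[of c m] G[of "Suc c" "m - ?b"] sz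
    have c: "c \<le> n" "Suc c \<le> n" using assms(5) by auto
    show ?case
      unfolding I_def
    proof (intro allI impI, goal_cases)
      case (1 r' c' q')
      have "reals \<tau> ''G'' (adr3 r' c' q') =
        (if r' = Suc r \<and> c' = c \<and> q' < m then f q' else reals \<sigma> ''G'' (adr3 r' c' q'))"
        using 4(5) 1 by (simp add: I_def)
      then show ?case using 1 m b c by (auto simp: f_def min_def)
    qed
  qed (use assms readyD(4) in \<open>auto simp: I_def\<close>)
  then show ?thesis by (simp add: I_def less_Suc_eq_le f_def)
qed

text \<open>When \<open>r\<close> items remain, at most \<open>n - r\<close> have been chosen, and
  the recurrence at \<open>(r + 1, c)\<close> looks at \<open>(r, c + 1)\<close>, which stays inside
  this triangle. The loop also fills entries outside it, about which nothing is claimed.\<close>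

lemma dp_level_spec:
  assumes "ready \<sigma>" "nats \<sigma> ''r'' 0 = r" "r < n"
    and b: "\<And>j c. j < n \<Longrightarrow> c < n \<Longrightarrow> nats \<sigma> ''bt'' (adr2 j c) = b j c"
    and lev: "\<And>c q. c \<le> n - r \<Longrightarrow> q \<le> n * L \<Longrightarrow> reals \<sigma> ''G'' (adr3 r c q) = min_size n z b C r c q"
  shows "(\<forall>c q. c \<le> n - Suc r \<longrightarrow> q \<le> n * L \<longrightarrow>
      reals (sem dp_level \<sigma>) ''G'' (adr3 (Suc r) c q) = min_size n z b C (Suc r) c q) \<and>
    (\<forall>r' c q. r' \<noteq> Suc r \<longrightarrow> c \<le> n \<longrightarrow> q \<le> n * L \<longrightarrow>
      reals (sem dp_level \<sigma>) ''G'' (adr3 r' c q) = reals \<sigma> ''G'' (adr3 r' c q))"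
proof -
  define I where "I m \<tau> \<longleftrightarrow> (\<forall>c q. c < m \<longrightarrow> c \<le> n - Suc r \<longrightarrow> q \<le> n * L \<longrightarrow>
      reals \<tau> ''G'' (adr3 (Suc r) c q) = min_size n z b C (Suc r) c q) \<and>
    (\<forall>r' c q. r' \<noteq> Suc r \<longrightarrow> c \<le> n \<longrightarrow> q \<le> n * L \<longrightarrow>
      reals \<tau> ''G'' (adr3 r' c q) = reals \<sigma> ''G'' (adr3 r' c q))"
    for m and \<tau> :: state
  have "I n (sem dp_level \<sigma>)"
    unfolding dp_level_def
  proof (rule sem_for, goal_cases)
    case (4 m \<tau>)
    have R: "ready \<tau>" by (rule ready_frame[OF assms(1)]) (auto simp: 4)
    have r: "nats \<tau> ''r'' 0 = r" using assms(2) 4(3) by simp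
    have bt: "nats \<tau> ''bt'' = nats \<sigma> ''bt''" using 4(3) by simp
    note row = dp_row_spec[OF R r assms(3) 4(2,1), rule_format, unfolded bt]
    have j: "n - Suc r < n" using assms(3) by linarith
    have new: "reals (sem dp_row \<tau>) ''G'' (adr3 (Suc r) m q) = min_size n z b C (Suc r) m q"
      if "m \<le> n - Suc r" "q \<le> n * L" for q
    proof -
      have "m \<le> n - r" "Suc m \<le> n - r" using that assms(3) by auto
      then have "reals \<tau> ''G'' (adr3 r m q) = min_size n z b C r m q"
        "reals \<tau> ''G'' (adr3 r (Suc m) (q - b (n - Suc r) m)) = min_size n z b C r (Suc m) (q - b (n - Suc r) m)"
        using 4(5) that lev by (auto simp: I_def)
      then show ?thesis using row[of m q "Suc r"] that 4(1) b[OF j 4(1)] by simp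
    qed
    have old: "reals (sem dp_row \<tau>) ''G'' (adr3 r' c q) = reals \<tau> ''G'' (adr3 r' c q)"
      if "r' \<noteq> Suc r \<or> c \<noteq> m" "c \<le> n" "q \<le> n * L" for r' c q
      using row[of c q r'] that by auto
    show ?case using 4(5) new old by (auto simp: I_def less_Suc_eq simp del: min_size.simps)
  qed (use assms readyD(1) in \<open>auto simp: I_def\<close>)
  moreover have "c < n" if "c \<le> n - Suc r" for c using that assms(3) by linarith
  ultimately show ?thesis unfolding I_def by blast
qed

lemma dp_spec:
  assumes "ready \<sigma>"
    and b: "\<And>j c. j < n \<Longrightarrow> c < n \<Longrightarrow> nats \<sigma> ''bt'' (adr2 j c) = b j c"
    and base: "\<And>c q. c \<le> n \<Longrightarrow> q \<le> n * L \<Longrightarrow> reals \<sigma> ''G'' (adr3 0 c q) = min_size n z b C 0 c q"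
  shows "\<forall>r c q. r \<le> n \<longrightarrow> c \<le> n - r \<longrightarrow> q \<le> n * L \<longrightarrow>
      reals (sem dp \<sigma>) ''G'' (adr3 r c q) = min_size n z b C r c q"
proof -
  define I where "I m \<tau> \<longleftrightarrow> (\<forall>r c q. r \<le> m \<longrightarrow> c \<le> n - r \<longrightarrow> q \<le> n * L \<longrightarrow>
      reals \<tau> ''G'' (adr3 r c q) = min_size n z b C r c q)"
    for m and \<tau> :: state
  have "I n (sem dp \<sigma>)"
    unfolding dp_def
  proof (rule sem_for, goal_cases)
    case (4 m \<tau>)
    have R: "ready \<tau>" by (rule ready_frame[OF assms(1)]) (auto simp: 4)
    have b': "nats \<tau> ''bt'' (adr2 j c) = b j c" if "j < n" "c < n" for j c
      using b that 4(3) by simp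
    have lev: "reals \<tau> ''G'' (adr3 r c q) = min_size n z b C r c q"
      if "r \<le> m" "c \<le> n - r" "q \<le> n * L" for r c q
      using 4(5) that by (simp add: I_def del: min_size.simps)
    note level = dp_level_spec[OF R 4(2,1) b' lev]
    have "reals (sem dp_level \<tau>) ''G'' (adr3 r c q) = min_size n z b C r c q"
      if "r \<le> Suc m" "c \<le> n - r" "q \<le> n * L" for r c q
    proof (cases "r = Suc m")
      case True
      then show ?thesis using level that by blast
    next
      case False
      then show ?thesis using level lev[of r c q] that by simp
    qed
    then show ?case by (auto simp: I_def simp del: min_size.simps)
  qed (use assms readyD(1) in \<open>auto simp: I_def\<close>)
  then show ?thesis by (simp add: I_def)
qed

lemma find_target_spec:
  assumes "ready \<sigma>" "reals \<sigma> ''G'' (adr3 n 0 0) \<le> C"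
  defines "q0 \<equiv> nats (sem find_target \<sigma>) ''qs'' 0"
  shows "q0 \<le> n * L \<and> reals \<sigma> ''G'' (adr3 n 0 q0) \<le> C \<and>
    (\<forall>q\<le>n * L. reals \<sigma> ''G'' (adr3 n 0 q) \<le> C \<longrightarrow> q \<le> q0)"
proof -
  define I where "I m \<tau> \<longleftrightarrow> nats \<tau> ''qs'' 0 \<le> n * L \<and>
    reals \<sigma> ''G'' (adr3 n 0 (nats \<tau> ''qs'' 0)) \<le> C \<and>
    (\<forall>q<m. reals \<sigma> ''G'' (adr3 n 0 q) \<le> C \<longrightarrow> q \<le> nats \<tau> ''qs'' 0)"
    for m and \<tau> :: state
  have "I (Suc (n * L)) (sem find_target \<sigma>)"
    unfolding find_target_def sem.simps(1-4)
  proof (rule sem_for, goal_cases)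
    case (4 m \<tau>)
    note [simp] = 4(2,3,4) readyD[OF assms(1)]
    have m: "m \<le> n * L" using 4(1) by simp
    have "reals \<sigma> ''G'' (adr3 n 0 m) > C \<Longrightarrow> I (Suc m) (nwrite ''q'' 0 (Suc m) \<tau>)"
      using 4(5) by (auto simp: I_def less_Suc_eq)
    moreover have "\<not> C < reals \<sigma> ''G'' (adr3 n 0 m) \<Longrightarrow>
        I (Suc m) (nwrite ''q'' 0 (Suc m) (nwrite ''qs'' 0 m \<tau>))"
      using m by (auto simp: I_def)
    ultimately show ?case by simp
  qed (use assms readyD(4) in \<open>auto simp: I_def\<close>)
  then show ?thesis by (simp add: I_def q0_def less_Suc_eq_le)
qed

lemma sum_z_nonneg: "Y \<subseteq> {..<n} \<Longrightarrow> 0 \<le> sum z Y"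
  by (intro sum_nonneg) (auto intro: less_imp_le z_pos)

text \<open>The invariant keeps two balances: the size chosen so far plus the least size of the rest
  fits into \<open>C\<close>, and the profit so far plus the profit still requested reaches
  \<open>q0\<close>. Truncated subtraction of profits preserves the second, because a surplus only
  helps.\<close>

lemma backtrack_spec:
  assumes "ready \<sigma>"
    and b: "\<And>j c. j < n \<Longrightarrow> c < n \<Longrightarrow> nats \<sigma> ''bt'' (adr2 j c) = b j c"
    and G: "\<And>r c q. r \<le> n \<Longrightarrow> c \<le> n - r \<Longrightarrow> q \<le> n * L \<Longrightarrow>
      reals \<sigma> ''G'' (adr3 r c q) = min_size n z b C r c q"
    and q0: "nats \<sigma> ''qs'' 0 = q0" "q0 \<le> n * L" "min_size n z b C n 0 q0 \<le> C"
  shows "\<exists>Y. feas Y \<and> q0 \<le> psum b 0 Y \<and>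
    (\<forall>j<n. nats (sem backtrack \<sigma>) ''x'' j = (if j \<in> Y then 1 else 0))"
proof -
  define I where "I m \<tau> \<longleftrightarrow> nats \<tau> ''qs'' 0 \<le> n * L \<and> (\<exists>Y\<subseteq>{..<m}. nats \<tau> ''cc'' 0 = card Y \<and>
    sum z Y + min_size n z b C (n - m) (card Y) (nats \<tau> ''qs'' 0) \<le> C \<and>
    q0 \<le> psum b 0 Y + nats \<tau> ''qs'' 0 \<and>
    (\<forall>j<m. nats \<tau> ''x'' j = (if j \<in> Y then 1 else 0)))"
    for m and \<tau> :: state
  have "I n (sem backtrack \<sigma>)"
    unfolding backtrack_def sem.simps(1-4)
  proof (rule sem_for, goal_cases)
    case (4 m \<tau>)
    define q where "q = nats \<tau> ''qs'' 0"
    obtain Y where Y: "q \<le> n * L" "Y \<subseteq> {..<m}" "nats \<tau> ''cc'' 0 = card Y"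
      "sum z Y + min_size n z b C (n - m) (card Y) q \<le> C" "q0 \<le> psum b 0 Y + q"
      "\<And>j. j < m \<Longrightarrow> nats \<tau> ''x'' j = (if j \<in> Y then 1 else 0)"
      using 4(5) unfolding I_def q_def by blast
    have fin: "finite Y" using Y(2) finite_subset by blast
    have c: "card Y \<le> m" using card_mono[OF _ Y(2)] by simp
    define r where "r = n - Suc m"
    have r: "n - m = Suc r" "n - Suc r = m" "r < n" using 4(1) by (auto simp: r_def)
    have g: "reals \<sigma> ''G'' (adr3 (Suc r) (card Y) q) = min_size n z b C (Suc r) (card Y) q"
      "reals \<sigma> ''G'' (adr3 r (card Y) q) = min_size n z b C r (card Y) q"
      using r 4(1) c Y(1) by (intro G; simp)+
    note [simp] = 4(2,3,4) readyD[OF assms(1)]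
    let ?test = "min_size n z b C (Suc r) (card Y) q < min_size n z b C r (card Y) q"
    let ?yes = "nwrite ''cc'' 0 (Suc (card Y)) (nwrite ''qs'' 0 (q - b m (card Y)) (nwrite ''x'' m 1 \<tau>))"
    let ?no = "nwrite ''x'' m 0 \<tau>"
    have cn: "card Y < n" "card Y \<le> n" "m \<le> n" "r \<le> n" "Suc r \<le> n" using c 4(1) r by auto
    have yes: "I (Suc m) (nwrite ''j'' 0 (Suc m) ?yes)" if ?test
    proof -
      have "m \<notin> Y" using Y(2) by auto
      have "min_size n z b C (Suc r) (card Y) q = z m + min_size n z b C r (Suc (card Y)) (q - b m (card Y))"
        using that r(2) by (auto simp: min_def split: if_splits)
      then have "sum z (insert m Y) + min_size n z b C r (card (insert m Y)) (q - b m (card Y)) \<le> C"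
        using Y(4) r(1) fin \<open>m \<notin> Y\<close> by simp
      moreover have "psum b 0 (insert m Y) = psum b 0 Y + b m (card Y)"
        using psum_insert_greatest[OF fin, of m b 0] Y(2) by auto
      moreover have "nats ?yes ''x'' j = (if j \<in> insert m Y then 1 else 0)" if "j < Suc m" for j
        using that Y(6)[of j] by (auto simp: less_Suc_eq)
      ultimately show ?thesis
        unfolding I_def using Y fin \<open>m \<notin> Y\<close>
        by (intro conjI exI[of _ "insert m Y"]) (auto simp: r_def)
    qed
    have no: "I (Suc m) (nwrite ''j'' 0 (Suc m) ?no)" if "\<not> ?test"
    proof -
      have "min_size n z b C (Suc r) (card Y) q = min_size n z b C r (card Y) q"
        using that by (auto simp: min_def split: if_splits)
      then have "sum z Y + min_size n z b C r (card Y) q \<le> C" using Y(4) r(1) by simp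
      moreover have "nats ?no ''x'' j = (if j \<in> Y then 1 else 0)" if "j < Suc m" for j
        using that Y(2) Y(6)[of j] by (auto simp: less_Suc_eq)
      ultimately show ?thesis
        unfolding I_def using Y fin
        by (intro conjI exI[of _ Y]) (auto simp: r_def q_def)
    qed
    show ?case
      using yes no 4(1) r(1) r_def[symmetric] q_def[symmetric] Y(3) g cn b[of m "card Y"]
      by (simp del: min_size.simps)
  qed (use assms readyD(1) in \<open>auto simp: I_def psum_def\<close>)
  then obtain Y where Y: "Y \<subseteq> {..<n}" "q0 \<le> psum b 0 Y + nats (sem backtrack \<sigma>) ''qs'' 0"
    "sum z Y + min_size n z b C 0 (card Y) (nats (sem backtrack \<sigma>) ''qs'' 0) \<le> C"
    "\<forall>j<n. nats (sem backtrack \<sigma>) ''x'' j = (if j \<in> Y then 1 else 0)"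
    unfolding I_def by (metis diff_self_eq_0)
  \<comment> \<open>A positive remaining request would put the infinite entry \<open>C + 1\<close>
    into the balance, which exceeds the capacity since sizes are nonnegative.\<close>
  have "nats (sem backtrack \<sigma>) ''qs'' 0 = 0"
    using Y(3) sum_z_nonneg[OF Y(1)] by (auto split: if_splits)
  then show ?thesis using Y by (intro exI[of _ Y]) (auto simp: feas_def)
qed

end

section \<open>The approximation guarantee of the best response\<close>

context weighted_knapsack
begin

text \<open>The program maximises the rounded profit exactly. Rounding loses less than
  \<open>M / L\<close> per item, hence at most \<open>n * M / L\<close> in all, and this is compared
  with the optimum through the feasible set \<open>{0}\<close> of profit \<open>M\<close>.\<close>

lemma best_response_spec:
  assumes "ready \<sigma>" "\<And>c. c < n \<Longrightarrow> reals \<sigma> ''W'' c = W c"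
  shows "\<exists>Y. feas Y \<and> (\<forall>j<n. nats (sem best_response \<sigma>) ''x'' j = (if j \<in> Y then 1 else 0)) \<and>
    (\<forall>Y'. feas Y' \<longrightarrow> (1 - n / L) * psum (\<lambda>j c. w j * W c) 0 Y' \<le> psum (\<lambda>j c. w j * W c) 0 Y)"
proof -
  let ?f = "\<lambda>j c. w j * W c"
  define \<sigma>1 where "\<sigma>1 = rwrite ''M'' 0 M \<sigma>"
  define \<sigma>2 where "\<sigma>2 = sem profit_table \<sigma>1"
  define \<sigma>3 where "\<sigma>3 = sem dp_base \<sigma>2"
  define \<sigma>4 where "\<sigma>4 = sem dp \<sigma>3"
  define \<sigma>5 where "\<sigma>5 = sem find_target \<sigma>4"
  have run: "sem best_response \<sigma> = sem backtrack \<sigma>5"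
    using assms n_pos by (simp add: best_response_def \<sigma>1_def \<sigma>2_def \<sigma>3_def \<sigma>4_def \<sigma>5_def readyD M_def)
  have R1: "ready \<sigma>1" using assms(1) by (simp add: \<sigma>1_def)
  have RW: "readyW \<sigma>1" using assms R1 by (simp add: readyW_def \<sigma>1_def)
  have R2: "ready \<sigma>2" unfolding \<sigma>2_def using R1 by (rule ready_sem) auto
  have R3: "ready \<sigma>3" unfolding \<sigma>3_def using R2 by (rule ready_sem) auto
  have R4: "ready \<sigma>4" unfolding \<sigma>4_def using R3 by (rule ready_sem) auto
  have R5: "ready \<sigma>5" unfolding \<sigma>5_def using R4 by (rule ready_sem) auto
  define b where "b j c = nats \<sigma>2 ''bt'' (adr2 j c)" for j c
  have rb: "rounds j c (b j c)" if "j < n" "c < n" for j c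
    using profit_table_spec[OF RW] that by (simp add: b_def \<sigma>2_def)
  have b3: "nats \<sigma>3 ''bt'' (adr2 j c) = b j c" for j c by (simp add: \<sigma>3_def b_def)
  have b5: "nats \<sigma>5 ''bt'' (adr2 j c) = b j c" for j c by (simp add: \<sigma>5_def \<sigma>4_def b3)
  have G4: "reals \<sigma>4 ''G'' (adr3 r c q) = min_size n z b C r c q"
    if "r \<le> n" "c \<le> n - r" "q \<le> n * L" for r c q
    unfolding \<sigma>4_def
    by (rule dp_spec[OF R3 b3, rule_format]) (use dp_base_spec[OF R2] that in \<open>auto simp: \<sigma>3_def simp del: min_size.simps\<close>)
  have G5: "reals \<sigma>5 ''G'' (adr3 r c q) = min_size n z b C r c q"
    if "r \<le> n" "c \<le> n - r" "q \<le> n * L" for r c q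
    using G4[OF that] by (simp add: \<sigma>5_def)
  have C0: "0 < C" using z_pos[of 0] z_le[of 0] n_pos by simp
  \<comment> \<open>The empty set attains profit 0, so the search for a target starts from an
    admissible value.\<close>
  have "min_size n z b C n 0 0 \<le> sum z {}" by (rule min_size_le) auto
  then have "reals \<sigma>4 ''G'' (adr3 n 0 0) \<le> C" using G4[of n 0 0] C0 by simp
  from find_target_spec[OF R4 this] obtain q0 where q0: "nats \<sigma>5 ''qs'' 0 = q0" "q0 \<le> n * L"
    "min_size n z b C n 0 q0 \<le> C" "\<And>q. q \<le> n * L \<Longrightarrow> min_size n z b C n 0 q \<le> C \<Longrightarrow> q \<le> q0"
    using G4[of n 0] unfolding \<sigma>5_def by auto
  obtain Y where Y: "feas Y" "q0 \<le> psum b 0 Y"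
    "\<forall>j<n. nats (sem best_response \<sigma>) ''x'' j = (if j \<in> Y then 1 else 0)"
    using backtrack_spec[OF R5 b5 G5 q0(1-3)] run by auto
  have pos_n: "pos Y' j < n" if "feas Y'" "j \<in> Y'" for Y' j
  proof -
    have "pos Y' j \<le> card {..<j}" unfolding pos_def by (intro card_mono) auto
    then show ?thesis using that by (auto simp: feas_def)
  qed
  have feas_fin: "finite Y'" "card Y' \<le> n" if "feas Y'" for Y'
    using that finite_subset[of Y' "{..<n}"] card_mono[of "{..<n}" Y'] by (auto simp: feas_def)
  have key: "psum ?f 0 Y' * L \<le> psum ?f 0 Y * L + n * M" if "feas Y'" for Y'
  proof -
    have rb': "rounds j (pos Y' j) (b j (pos Y' j))" if "j \<in> Y'" for j
      using rb pos_n[OF \<open>feas Y'\<close> that] that \<open>feas Y'\<close> by (auto simp: feas_def)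
    have "psum b 0 Y' \<le> psum (\<lambda>_ _. L) 0 Y'" using rb' by (intro psum_mono) (auto simp: rounds_def)
    also have "\<dots> \<le> n * L" using feas_fin[OF that] by (simp add: psum_def)
    finally have "psum b 0 Y' \<le> n * L" .
    moreover have "min_size n z b C n 0 (psum b 0 Y') \<le> C"
      using min_size_le[of n n Y' "psum b 0 Y'" b 0 z C] that
      by (auto simp: feas_def atLeast0LessThan)
    ultimately have "psum b 0 Y' \<le> psum b 0 Y" using q0(4) Y(2) by fastforce
    then have "real (psum b 0 Y') * M \<le> real (psum b 0 Y) * M" using M_pos by (intro mult_right_mono) auto
    moreover have "psum ?f 0 Y' * L \<le> real (psum b 0 Y') * M + n * M"
      using rb' L_pos M_pos feas_fin[OF that] by (intro rounding_error) (auto simp: rounds_def)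
    moreover have "real (psum b 0 Y) * M \<le> psum ?f 0 Y * L"
    proof (rule rounding_below)
      fix j assume "j \<in> Y"
      then have "rounds j (pos Y j) (b j (pos Y j))"
        using rb pos_n[OF Y(1)] Y(1) by (auto simp: feas_def)
      then show "real (b j (pos Y j)) * M \<le> ?f j (pos Y j) * L" by (simp add: rounds_def)
    qed
    ultimately show ?thesis by simp
  qed
  have "(1 - n / L) * psum ?f 0 Y' \<le> psum ?f 0 Y" if "feas Y'" for Y'
  proof -
    have single: "feas {0}" using z_le[of 0] n_pos by (auto simp: feas_def)
    have M: "psum ?f 0 {0} = M" by (simp add: psum_def pos_def M_def)
    have L: "0 < real L" using L_pos by simp
    \<comment> \<open>If \<open>Y'\<close> has profit at least \<open>M\<close>, the error is at
      most the fraction \<open>n / L\<close> of it. Otherwise \<open>{0}\<close> is the better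
      competitor and takes its place; when \<open>n > L\<close> the factor is negative and
      nonnegativity of profits suffices.\<close>
    show ?thesis
    proof (cases "M \<le> psum ?f 0 Y'")
      case True
      have "psum ?f 0 Y' * L \<le> psum ?f 0 Y * L + n * psum ?f 0 Y'"
        using key[OF that] True mult_left_mono[of M "psum ?f 0 Y'" n] by linarith
      then show ?thesis using L by (simp add: field_simps)
    next
      case False
      have nn: "0 \<le> psum ?f 0 X" if "feas X" for X
        unfolding psum_def using that pos_n[OF that]
        by (auto intro!: sum_nonneg mult_nonneg_nonneg W_nonneg less_imp_le[OF w_pos] simp: feas_def)
      show ?thesis
      proof (cases "real n \<le> L")
        case True
        have "(1 - n / L) * psum ?f 0 Y' \<le> (1 - n / L) * M"
          using False True L by (intro mult_left_mono) auto
        also have "\<dots> \<le> psum ?f 0 Y" using key[OF single] M L by (simp add: field_simps)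
        finally show ?thesis .
      next
        case False
        then have "(1 - n / L) * psum ?f 0 Y' \<le> 0" using nn[OF that] L
          by (intro mult_nonpos_nonneg) auto
        then show ?thesis using nn[OF Y(1)] by linarith
      qed
    qed
  qed
  then show ?thesis using Y by blast
qed

end

section \<open>Playing the game\<close>

text \<open>Cell \<open>k\<close> of \<open>A\<close>, and likewise of \<open>O\<close>,
  \<open>y\<close> and \<open>R\<close>, belongs to the cardinality \<open>k + 1\<close>. The
  counter \<open>cc\<close> is the position of the current item, so an item counts when
  \<open>cc <= k\<close>.\<close>

definition evaluate_row :: prog where
  "evaluate_row = PR ''A'' (NVar ''k'') (RConst 0) ;; nset ''cc'' (NConst 0) ;;
     PFor ''j'' ''n''
       (PIf (NLess (NConst 0) (NCell ''x'' (NVar ''j'')))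
         (PIf (NLess (NVar ''k'') (NVar ''cc'')) PSkip
            (PR ''A'' (NVar ''k'') (RAdd (RCell ''A'' (NVar ''k'')) (item_value (NVar ''j'')))) ;;
          nset ''cc'' (NAdd (NVar ''cc'') (NConst 1)))
         PSkip)"

definition evaluate :: prog where
  "evaluate = PFor ''k'' ''n'' evaluate_row"

definition opt_weights :: prog where
  "opt_weights = PFor ''c'' ''n''
     (PIf (NLess (NVar ''k1'') (NVar ''c'')) (PR ''W'' (NVar ''c'') (RConst 0)) (PR ''W'' (NVar ''c'') (RConst 1)))"

definition optima :: prog where
  "optima = PFor ''k1'' ''n''
     (opt_weights ;; best_response ;; evaluate ;; PR ''O'' (NVar ''k1'') (RCell ''A'' (NVar ''k1'')))"

definition regret_weights :: prog where
  "regret_weights = rset ''S'' (RConst 0) ;;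
     PFor ''k'' ''n''
       (PIf (RLess (RConst 0) (RCell ''R'' (NVar ''k'')))
         (PR ''y'' (NVar ''k'') (RCell ''R'' (NVar ''k'')) ;;
          rset ''S'' (RAdd (RVar ''S'') (RCell ''R'' (NVar ''k''))))
         (PR ''y'' (NVar ''k'') (RConst 0)))"

text \<open>If no regret is positive, any weights keep the potential under control; uniform ones are
  taken so that the division by \<open>S\<close> is meaningful.\<close>

definition default_weights :: prog where
  "default_weights = PIf (RLess (RConst 0) (RVar ''S'')) PSkip
     (rset ''S'' (RConst 0) ;;
      PFor ''k'' ''n'' (PR ''y'' (NVar ''k'') (RConst 1) ;; rset ''S'' (RAdd (RVar ''S'') (RConst 1))))"

definition tail_row :: prog where
  "tail_row = PR ''W'' (NVar ''c'') (RConst 0) ;;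
     PFor ''k'' ''n'' (PIf (NLess (NVar ''k'') (NVar ''c'')) PSkip
       (PR ''W'' (NVar ''c'') (RAdd (RCell ''W'' (NVar ''c''))
          (RDiv (RCell ''y'' (NVar ''k'')) (RCell ''O'' (NVar ''k''))))))"

definition tails :: prog where
  "tails = PFor ''c'' ''n'' tail_row"

abbreviation ratio :: rexp where
  "ratio \<equiv> RDiv (RCell ''A'' (NVar ''k'')) (RCell ''O'' (NVar ''k''))"

definition payoff :: prog where
  "payoff = rset ''u'' (RConst 0) ;;
     PFor ''k'' ''n'' (rset ''u'' (RAdd (RVar ''u'') (RMul (RCell ''y'' (NVar ''k'')) ratio)))"

definition update_regrets :: prog where
  "update_regrets =
     PFor ''k'' ''n'' (PR ''R'' (NVar ''k'') (RAdd (RCell ''R'' (NVar ''k'')) (RSub (RDiv (RVar ''u'') (RVar ''S'')) ratio)))"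

text \<open>\<open>xb\<close> is the round number times \<open>n\<close>, maintained by addition.
  Items are numbered from 1, so a row occupies the addresses \<open>xb + 1\<close> to
  \<open>xb + n\<close>, as \<open>output_set\<close> expects.\<close>

definition write_row :: prog where
  "write_row = PFor ''j'' ''n''
     (PN ''X'' (NAdd (NVar ''xb'') (NCell ''pm'' (NVar ''j''))) (NCell ''x'' (NVar ''j'')))"

definition game_round :: prog where
  "game_round = regret_weights ;; default_weights ;; tails ;; best_response ;; evaluate ;; payoff ;;
     update_regrets"

definition game :: prog where
  "game = PFor ''t'' ''T'' (game_round ;; write_row ;; nset ''xb'' (NAdd (NVar ''xb'') (NVar ''n'')) ;;
     PR ''p'' (NVar ''t'') (RDiv (RConst 1) (RVar ''rT'')))"

lemma evaluate_row_vars [simp]: "nvars evaluate_row = {''cc'', ''j''}" "rvars evaluate_row = {''A''}"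
  by (auto simp: evaluate_row_def)

lemma evaluate_vars [simp]: "nvars evaluate = {''cc'', ''j'', ''k''}" "rvars evaluate = {''A''}"
  by (auto simp: evaluate_def)

lemma opt_weights_vars [simp]: "nvars opt_weights = {''c''}" "rvars opt_weights = {''W''}"
  by (auto simp: opt_weights_def)

lemma regret_weights_vars [simp]: "nvars regret_weights = {''k''}" "rvars regret_weights = {''S'', ''y''}"
  by (auto simp: regret_weights_def)

lemma default_weights_vars [simp]: "nvars default_weights = {''k''}" "rvars default_weights = {''S'', ''y''}"
  by (auto simp: default_weights_def)

lemma tail_row_vars [simp]: "nvars tail_row = {''k''}" "rvars tail_row = {''W''}"
  by (auto simp: tail_row_def)

lemma tails_vars [simp]: "nvars tails = {''k'', ''c''}" "rvars tails = {''W''}"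
  by (auto simp: tails_def)

lemma payoff_vars [simp]: "nvars payoff = {''k''}" "rvars payoff = {''u''}"
  by (auto simp: payoff_def)

lemma update_regrets_vars [simp]: "nvars update_regrets = {''k''}" "rvars update_regrets = {''R''}"
  by (auto simp: update_regrets_def)

lemma write_row_vars [simp]: "nvars write_row = {''j'', ''X''}" "rvars write_row = {}"
  by (auto simp: write_row_def)

lemma game_round_vars [simp]:
  "nvars game_round = {''b'', ''i'', ''c'', ''bt'', ''j'', ''q'', ''r'', ''qs'', ''cc'', ''x'', ''k''}"
  "rvars game_round = {''M'', ''rb'', ''pr'', ''G'', ''g1'', ''g2'', ''S'', ''y'', ''W'', ''A'', ''u'', ''R''}"
  by (auto simp: game_round_def)

lemma pos_Suc: "pos Y (Suc m) = pos Y m + (if m \<in> Y then 1 else 0)"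
  by (simp add: pos_def lessThan_Suc)

lemma top_sum_eq: "Y \<subseteq> {..<n} \<Longrightarrow> top_sum w (Suc k) Y = (\<Sum>j<n. if j \<in> Y \<and> pos Y j \<le> k then w j else 0)"
  unfolding top_sum_def
  by (subst sum.inter_filter[symmetric]) (auto intro!: sum.cong simp: less_Suc_eq_le)

text \<open>The case of an adversary who plays a single cardinality: a best response to it is an
  optimum for that cardinality, so one program serves both purposes.\<close>

lemma psum_indicator: "finite Y \<Longrightarrow> psum (\<lambda>j c. w j * (if k < c then 0 else 1)) 0 Y = top_sum w (Suc k) Y"
  unfolding psum_def top_sum_def
  by (simp add: sum.inter_filter less_Suc_eq_le) (auto intro!: sum.cong)

section \<open>Correctness of a round and of the whole play\<close>

context sorted_knapsack
begin

lemma evaluate_row_spec: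
  assumes "ready \<sigma>" "nats \<sigma> ''k'' 0 = k" "Y \<subseteq> {..<n}"
    and x: "\<And>j. j < n \<Longrightarrow> nats \<sigma> ''x'' j = (if j \<in> Y then 1 else 0)"
  shows "reals (sem evaluate_row \<sigma>) ''A'' k = top_sum w (Suc k) Y \<and>
    (\<forall>k'. k' \<noteq> k \<longrightarrow> reals (sem evaluate_row \<sigma>) ''A'' k' = reals \<sigma> ''A'' k')"
proof -
  define I where "I m \<tau> \<longleftrightarrow> nats \<tau> ''cc'' 0 = pos Y m \<and>
    reals \<tau> ''A'' k = (\<Sum>j<m. if j \<in> Y \<and> pos Y j \<le> k then w j else 0) \<and>
    (\<forall>k'. k' \<noteq> k \<longrightarrow> reals \<tau> ''A'' k' = reals \<sigma> ''A'' k')"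
    for m and \<tau> :: state
  have "I n (sem evaluate_row \<sigma>)"
    unfolding evaluate_row_def sem.simps(1-4)
  proof (rule sem_for, goal_cases)
    case (4 m \<tau>)
    note [simp] = 4(2,3,4) readyD[OF assms(1)] assms(2) x
    show ?case using 4(1,5) by (auto simp: I_def pos_Suc)
  qed (use assms readyD(1) in \<open>auto simp: I_def pos_def\<close>)
  then show ?thesis using top_sum_eq[OF assms(3)] by (simp add: I_def)
qed

lemma evaluate_spec:
  assumes "ready \<sigma>" "Y \<subseteq> {..<n}"
    and x: "\<And>j. j < n \<Longrightarrow> nats \<sigma> ''x'' j = (if j \<in> Y then 1 else 0)"
  shows "\<forall>k<n. reals (sem evaluate \<sigma>) ''A'' k = top_sum w (Suc k) Y"
proof -
  define I where "I m \<tau> \<longleftrightarrow> (\<forall>k<m. reals \<tau> ''A'' k = top_sum w (Suc k) Y)"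
    for m and \<tau> :: state
  have "I n (sem evaluate \<sigma>)"
    unfolding evaluate_def
  proof (rule sem_for, goal_cases)
    case (4 m \<tau>)
    have R: "ready \<tau>" by (rule ready_frame[OF assms(1)]) (auto simp: 4)
    have x': "nats \<tau> ''x'' j = (if j \<in> Y then 1 else 0)" if "j < n" for j
      using x[OF that] 4(3) by simp
    show ?case using evaluate_row_spec[OF R 4(2) assms(2) x'] 4(5)
      by (auto simp: I_def less_Suc_eq)
  qed (use assms readyD(1) in \<open>auto simp: I_def\<close>)
  then show ?thesis by (simp add: I_def)
qed

lemma opt_weights_spec:
  assumes "ready \<sigma>" "nats \<sigma> ''k1'' 0 = k"
  shows "\<forall>c<n. reals (sem opt_weights \<sigma>) ''W'' c = (if k < c then 0 else 1)"
proof -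
  define I where "I m \<tau> \<longleftrightarrow> (\<forall>c<m. reals \<tau> ''W'' c = (if k < c then 0 else 1))"
    for m and \<tau> :: state
  have "I n (sem opt_weights \<sigma>)"
    unfolding opt_weights_def
  proof (rule sem_for, goal_cases)
    case (4 m \<tau>)
    note [simp] = 4(2,3,4) assms(2)
    show ?case using 4(5) by (auto simp: I_def less_Suc_eq)
  qed (use assms readyD(1) in \<open>auto simp: I_def\<close>)
  then show ?thesis by (simp add: I_def)
qed

text \<open>Being attained by a feasible set keeps the number below the true optimum. The optimum
  itself is avoided here because the locale knows only sorted positions;
  \<open>near_opt_bounds\<close> makes the connection.\<close>

definition near_opt :: "nat \<Rightarrow> real \<Rightarrow> bool" where
  "near_opt k o' \<longleftrightarrow> (\<exists>Y. feas Y \<and> o' = top_sum w (Suc k) Y) \<and>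
     (\<forall>Y. feas Y \<longrightarrow> (1 - n / L) * top_sum w (Suc k) Y \<le> o')"

lemma feas_finite: "feas Y \<Longrightarrow> finite Y"
  using finite_subset[of Y "{..<n}"] by (auto simp: feas_def)

lemma optima_spec:
  assumes "ready \<sigma>"
  shows "\<forall>k<n. near_opt k (reals (sem optima \<sigma>) ''O'' k)"
proof -
  define I where "I m \<tau> \<longleftrightarrow> (\<forall>k<m. near_opt k (reals \<tau> ''O'' k))"
    for m and \<tau> :: state
  have "I n (sem optima \<sigma>)"
    unfolding optima_def
  proof (rule sem_for, goal_cases)
    case (4 m \<tau>)
    have R: "ready \<tau>" by (rule ready_frame[OF assms(1)]) (auto simp: 4)
    define W where "W c = (if m < c then 0 else 1 :: real)" for c :: nat
    interpret weighted_knapsack n L w z C W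
      by unfold_locales (auto simp: W_def)
    define \<tau>1 where "\<tau>1 = sem opt_weights \<tau>"
    define \<tau>2 where "\<tau>2 = sem best_response \<tau>1"
    define \<tau>3 where "\<tau>3 = sem evaluate \<tau>2"
    have R1: "ready \<tau>1" unfolding \<tau>1_def using R by (rule ready_sem) auto
    have W: "reals \<tau>1 ''W'' c = W c" if "c < n" for c
      using opt_weights_spec[OF R 4(2)] that by (simp add: \<tau>1_def W_def)
    obtain Y where Y: "feas Y" "\<forall>j<n. nats \<tau>2 ''x'' j = (if j \<in> Y then 1 else 0)"
      "\<And>Y'. feas Y' \<Longrightarrow> (1 - n / L) * psum (\<lambda>j c. w j * W c) 0 Y' \<le> psum (\<lambda>j c. w j * W c) 0 Y"
      using best_response_spec[OF R1 W] unfolding \<tau>2_def by blast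
    have R2: "ready \<tau>2" unfolding \<tau>2_def using R1 by (rule ready_sem) auto
    have "reals \<tau>3 ''A'' m = top_sum w (Suc m) Y"
      using evaluate_spec[OF R2, of Y] Y(1,2) 4(1) unfolding \<tau>3_def by (auto simp: feas_def)
    moreover have "near_opt m (top_sum w (Suc m) Y)"
      using Y(1,3) feas_finite by (auto simp: near_opt_def W_def psum_indicator)
    moreover have "nats \<tau>3 ''k1'' 0 = m" "reals \<tau>3 ''O'' = reals \<tau> ''O''"
      using 4(2) by (simp_all add: \<tau>3_def \<tau>2_def \<tau>1_def)
    moreover have "sem (opt_weights ;; best_response ;; evaluate ;;
        PR ''O'' (NVar ''k1'') (RCell ''A'' (NVar ''k1''))) \<tau> = rwrite ''O'' m (reals \<tau>3 ''A'' m) \<tau>3"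
      using 4(2) by (simp add: \<tau>3_def \<tau>2_def \<tau>1_def)
    ultimately show ?case using 4(5) by (auto simp: I_def less_Suc_eq simp del: sem.simps)
  qed (use assms readyD(1) in \<open>auto simp: I_def\<close>)
  then show ?thesis by (simp add: I_def)
qed

text \<open>Packages what \<open>regret_step\<close> asks of the weights; the final disjunction
  separates regret matching from the default weights.\<close>

definition valid_weights :: "(nat \<Rightarrow> real) \<Rightarrow> (nat \<Rightarrow> real) \<Rightarrow> real \<Rightarrow> bool" where
  "valid_weights R y S \<longleftrightarrow> S = (\<Sum>k<n. y k) \<and> 0 < S \<and> (\<forall>k<n. 0 \<le> y k) \<and>
     ((\<forall>k<n. y k = max (R k) 0) \<or> (\<forall>k<n. R k \<le> 0))"

lemma weights_spec:
  assumes "nats \<sigma> ''n'' 0 = n"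
  defines "\<tau> \<equiv> sem default_weights (sem regret_weights \<sigma>)"
  shows "valid_weights (reals \<sigma> ''R'') (reals \<tau> ''y'') (reals \<tau> ''S'' 0)"
proof -
  let ?R = "reals \<sigma> ''R''"
  define \<sigma>1 where "\<sigma>1 = sem regret_weights \<sigma>"
  define I where "I m \<rho> \<longleftrightarrow> (\<forall>k<m. reals \<rho> ''y'' k = max (?R k) 0) \<and>
    reals \<rho> ''S'' 0 = (\<Sum>k<m. max (?R k) 0)" for m and \<rho> :: state
  have 1: "I n \<sigma>1"
    unfolding \<sigma>1_def regret_weights_def sem.simps(1-4)
  proof (rule sem_for, goal_cases)
    case (4 m \<rho>)
    note [simp] = 4(2,3,4)
    show ?case using 4(5) by (auto simp: I_def less_Suc_eq)
  qed (use assms in \<open>auto simp: I_def\<close>)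
  show ?thesis
  proof (cases "0 < reals \<sigma>1 ''S'' 0")
    case True
    then have "\<tau> = \<sigma>1" by (simp add: \<tau>_def \<sigma>1_def default_weights_def)
    then show ?thesis using 1 True by (simp add: I_def valid_weights_def)
  next
    case False
    then have "(\<Sum>k<n. max (?R k) 0) = 0"
      using 1 sum_nonneg[of "{..<n}" "\<lambda>k. max (?R k) 0"] by (simp add: I_def)
    then have "\<forall>k\<in>{..<n}. max (?R k) 0 = 0"
      by (subst (asm) sum_nonneg_eq_0_iff) auto
    then have R: "\<forall>k<n. ?R k \<le> 0" by (metis lessThan_iff max.cobounded1)
    define J where "J m \<rho> \<longleftrightarrow> (\<forall>k<m. reals \<rho> ''y'' k = 1) \<and> reals \<rho> ''S'' 0 = real m"
      for m and \<rho> :: state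
    have \<tau>: "\<tau> = sem (rset ''S'' (RConst 0) ;;
      PFor ''k'' ''n'' (PR ''y'' (NVar ''k'') (RConst 1) ;; rset ''S'' (RAdd (RVar ''S'') (RConst 1)))) \<sigma>1"
      using False by (simp add: \<tau>_def \<sigma>1_def default_weights_def)
    have "J n \<tau>"
      unfolding \<tau> sem.simps(4)
    proof (rule sem_for, goal_cases)
      case (4 m \<rho>)
      note [simp] = 4(2,3,4)
      show ?case using 4(5) by (auto simp: J_def less_Suc_eq)
    qed (use assms in \<open>auto simp: J_def \<sigma>1_def\<close>)
    then show ?thesis using R n_pos by (simp add: J_def valid_weights_def)
  qed
qed

lemma tail_row_spec:
  assumes "nats \<sigma> ''n'' 0 = n" "nats \<sigma> ''c'' 0 = c"
  shows "reals (sem tail_row \<sigma>) ''W'' c = (\<Sum>k\<in>{c..<n}. reals \<sigma> ''y'' k / reals \<sigma> ''O'' k) \<and>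
    (\<forall>c'. c' \<noteq> c \<longrightarrow> reals (sem tail_row \<sigma>) ''W'' c' = reals \<sigma> ''W'' c')"
proof -
  define I where "I m \<tau> \<longleftrightarrow> reals \<tau> ''W'' c = (\<Sum>k\<in>{c..<m}. reals \<sigma> ''y'' k / reals \<sigma> ''O'' k) \<and>
    (\<forall>c'. c' \<noteq> c \<longrightarrow> reals \<tau> ''W'' c' = reals \<sigma> ''W'' c')" for m and \<tau> :: state
  have "I n (sem tail_row \<sigma>)"
    unfolding tail_row_def sem.simps(1-4)
  proof (rule sem_for, goal_cases)
    case (4 m \<tau>)
    note [simp] = 4(2,3,4) assms
    show ?case using 4(5) by (auto simp: I_def)
  qed (use assms in \<open>auto simp: I_def\<close>)
  then show ?thesis by (simp add: I_def)
qed

lemma tails_spec: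
  assumes "nats \<sigma> ''n'' 0 = n"
  shows "\<forall>c<n. reals (sem tails \<sigma>) ''W'' c = (\<Sum>k\<in>{c..<n}. reals \<sigma> ''y'' k / reals \<sigma> ''O'' k)"
proof -
  define I where "I m \<tau> \<longleftrightarrow> (\<forall>c<m. reals \<tau> ''W'' c = (\<Sum>k\<in>{c..<n}. reals \<sigma> ''y'' k / reals \<sigma> ''O'' k))"
    for m and \<tau> :: state
  have "I n (sem tails \<sigma>)"
    unfolding tails_def
  proof (rule sem_for, goal_cases)
    case (4 m \<tau>)
    have n: "nats \<tau> ''n'' 0 = n" using assms 4(3) by simp
    have yO: "reals \<tau> ''y'' = reals \<sigma> ''y''" "reals \<tau> ''O'' = reals \<sigma> ''O''" using 4(4) by simp_all
    show ?case using tail_row_spec[OF n 4(2)] 4(5)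
      by (auto simp: I_def less_Suc_eq yO)
  qed (use assms in \<open>auto simp: I_def\<close>)
  then show ?thesis by (simp add: I_def)
qed

lemma payoff_spec:
  assumes "nats \<sigma> ''n'' 0 = n"
  shows "reals (sem payoff \<sigma>) ''u'' 0 = (\<Sum>k<n. reals \<sigma> ''y'' k * (reals \<sigma> ''A'' k / reals \<sigma> ''O'' k))"
proof -
  define I where "I m \<tau> \<longleftrightarrow> reals \<tau> ''u'' 0 =
    (\<Sum>k<m. reals \<sigma> ''y'' k * (reals \<sigma> ''A'' k / reals \<sigma> ''O'' k))" for m and \<tau> :: state
  have "I n (sem payoff \<sigma>)"
    unfolding payoff_def sem.simps(1-4)
  proof (rule sem_for, goal_cases)
    case (4 m \<tau>)
    note [simp] = 4(2,3,4) assms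
    show ?case using 4(5) by (auto simp: I_def)
  qed (use assms in \<open>auto simp: I_def\<close>)
  then show ?thesis by (simp add: I_def)
qed

lemma update_regrets_spec:
  assumes "nats \<sigma> ''n'' 0 = n"
  shows "\<forall>k<n. reals (sem update_regrets \<sigma>) ''R'' k =
    reals \<sigma> ''R'' k + (reals \<sigma> ''u'' 0 / reals \<sigma> ''S'' 0 - reals \<sigma> ''A'' k / reals \<sigma> ''O'' k)"
proof -
  define I where "I m \<tau> \<longleftrightarrow> (\<forall>k. reals \<tau> ''R'' k = (if k < m then
    reals \<sigma> ''R'' k + (reals \<sigma> ''u'' 0 / reals \<sigma> ''S'' 0 - reals \<sigma> ''A'' k / reals \<sigma> ''O'' k)
    else reals \<sigma> ''R'' k))" for m and \<tau> :: state
  have "I n (sem update_regrets \<sigma>)"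
    unfolding update_regrets_def
  proof (rule sem_for, goal_cases)
    case (4 m \<tau>)
    note [simp] = 4(2,3,4) assms
    show ?case using 4(5) by (auto simp: I_def less_Suc_eq)
  qed (use assms in \<open>auto simp: I_def\<close>)
  then show ?thesis by (simp add: I_def)
qed

text \<open>The set \<open>{0}\<close> is worth \<open>w 0\<close> for every cardinality, and
  \<open>2 * n <= L\<close> keeps the approximation factor at least one half. Positivity is what the
  divisions by \<open>O\<close> rely on.\<close>

lemma near_opt_pos:
  assumes "near_opt k o'" "2 * n \<le> L" shows "0 < o'"
proof -
  have "feas {0}" using z_le[of 0] n_pos by (auto simp: feas_def)
  then have "(1 - n / L) * top_sum w (Suc k) {0} \<le> o'" using assms by (simp add: near_opt_def)
  moreover have "{j. j = 0 \<and> pos {0} j < Suc k} = {0}" by (auto simp: pos_def)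
  then have "top_sum w (Suc k) {0} = w 0" by (simp add: top_sum_def)
  moreover have "0 < 1 - n / L" using assms(2) L_pos by (simp add: field_simps)
  then have "0 < (1 - n / L) * w 0" using w_pos[of 0] n_pos by (intro mult_pos_pos) auto
  ultimately show ?thesis by simp
qed

text \<open>The source of the payoff bound 2 in \<open>regret_step\<close>: a denominator may fall
  short of the true optimum by a factor of at most two.\<close>

lemma near_opt_ratio:
  assumes "near_opt k o'" "2 * n \<le> L" "feas Y"
  shows "0 \<le> top_sum w (Suc k) Y / o'" "top_sum w (Suc k) Y / o' \<le> 2"
proof -
  have o: "0 < o'" using near_opt_pos[OF assms(1,2)] .
  have t: "0 \<le> top_sum w (Suc k) Y"
    unfolding top_sum_def using assms(3) by (intro sum_nonneg) (auto simp: feas_def intro: less_imp_le[OF w_pos])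
  then show "0 \<le> top_sum w (Suc k) Y / o'" using o by simp
  have "1 / 2 \<le> 1 - n / L" using assms(2) L_pos by (simp add: field_simps)
  then have "1 / 2 * top_sum w (Suc k) Y \<le> (1 - n / L) * top_sum w (Suc k) Y"
    using t by (rule mult_right_mono)
  also have "\<dots> \<le> o'" using assms by (simp add: near_opt_def)
  finally show "top_sum w (Suc k) Y / o' \<le> 2" using o by (simp add: field_simps)
qed

text \<open>\<open>lam\<close> is a lower bound for the value of the game with payoffs scaled by \<open>opt\<close>.\<close>

definition game_value_ge :: "real \<Rightarrow> (nat \<Rightarrow> real) \<Rightarrow> bool" where
  "game_value_ge lam opt \<longleftrightarrow> (\<forall>y. (\<forall>k<n. 0 \<le> y k) \<longrightarrow> 0 < (\<Sum>k<n. y k) \<longrightarrow>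
     (\<exists>Y. feas Y \<and> lam * (\<Sum>k<n. y k) \<le> (\<Sum>k<n. y k * (top_sum w (Suc k) Y / opt k))))"

text \<open>\<open>u\<close> is the payoff of the response averaged over the adversary's weights.
  Some feasible set earns at least \<open>lam\<close> against these weights, and the approximate
  response loses only the factor \<open>1 - n / L\<close> against it.\<close>

lemma game_round_spec:
  assumes ready: "ready \<sigma>" and L2: "2 * n \<le> L"
    and opt: "\<And>k. k < n \<Longrightarrow> near_opt k (reals \<sigma> ''O'' k)"
    and lam: "game_value_ge lam (reals \<sigma> ''O'')"
  defines "\<tau> \<equiv> sem game_round \<sigma>"
  shows "\<exists>Y u. feas Y \<and> (\<forall>j<n. nats \<tau> ''x'' j = (if j \<in> Y then 1 else 0)) \<and>
    (\<forall>k<n. reals \<tau> ''R'' k = reals \<sigma> ''R'' k + (u - top_sum w (Suc k) Y / reals \<sigma> ''O'' k)) \<and>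
    (1 - n / L) * lam \<le> u \<and>
    (\<Sum>k<n. (max (reals \<tau> ''R'' k) 0)\<^sup>2) \<le> (\<Sum>k<n. (max (reals \<sigma> ''R'' k) 0)\<^sup>2) + 4 * n"
proof -
  let ?R = "reals \<sigma> ''R''" and ?O = "reals \<sigma> ''O''"
  define \<sigma>1 where "\<sigma>1 = sem default_weights (sem regret_weights \<sigma>)"
  define \<sigma>2 where "\<sigma>2 = sem tails \<sigma>1"
  define \<sigma>3 where "\<sigma>3 = sem best_response \<sigma>2"
  define \<sigma>4 where "\<sigma>4 = sem evaluate \<sigma>3"
  define \<sigma>5 where "\<sigma>5 = sem payoff \<sigma>4"
  have \<tau>: "\<tau> = sem update_regrets \<sigma>5"
    by (simp add: \<tau>_def game_round_def \<sigma>1_def \<sigma>2_def \<sigma>3_def \<sigma>4_def \<sigma>5_def)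
  have R1: "ready \<sigma>1" unfolding \<sigma>1_def using ready by (intro ready_sem) auto
  have R2: "ready \<sigma>2" unfolding \<sigma>2_def using R1 by (rule ready_sem) auto
  have R3: "ready \<sigma>3" unfolding \<sigma>3_def using R2 by (rule ready_sem) auto
  have R4: "ready \<sigma>4" unfolding \<sigma>4_def using R3 by (rule ready_sem) auto
  have R5: "ready \<sigma>5" unfolding \<sigma>5_def using R4 by (rule ready_sem) auto
  note n = readyD(1)[OF ready] readyD(1)[OF R1] readyD(1)[OF R4] readyD(1)[OF R5]
  define y where "y = reals \<sigma>1 ''y''"
  define S where "S = reals \<sigma>1 ''S'' 0"
  have vw: "valid_weights ?R y S"
    using weights_spec[OF n(1)] by (simp add: y_def S_def \<sigma>1_def)
  then have S: "S = (\<Sum>k<n. y k)" "0 < S" and y: "\<And>k. k < n \<Longrightarrow> 0 \<le> y k"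
    by (auto simp: valid_weights_def)
  have O: "0 < ?O k" if "k < n" for k using near_opt_pos[OF opt[OF that] L2] .
  define W where "W c = (\<Sum>k\<in>{c..<n}. y k / ?O k)" for c
  have yO: "0 \<le> y k / ?O k" if "k < n" for k using y[OF that] O[OF that] by simp
  \<comment> \<open>Some weight is positive, which makes \<open>W 0\<close>, and with it the
    rounding unit, positive.\<close>
  have "\<exists>k<n. 0 < y k"
  proof (rule ccontr)
    assume "\<not> ?thesis"
    then have "(\<Sum>k<n. y k) \<le> 0" by (intro sum_nonpos) (metis lessThan_iff not_less)
    then show False using S by simp
  qed
  then obtain k0 where k0: "k0 < n" "0 < y k0" by blast
  interpret weighted_knapsack n L w z C W
  proof
    fix c assume "c < n"
    show "0 \<le> W c" unfolding W_def using yO by (intro sum_nonneg) auto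
    show "W c \<le> W 0" unfolding W_def using yO by (intro sum_mono2) auto
  next
    show "0 < W 0" unfolding W_def
      by (rule sum_pos2[of _ k0]) (use k0 O yO in auto)
  qed
  have W: "reals \<sigma>2 ''W'' c = W c" if "c < n" for c
    using tails_spec[OF n(2)] that by (simp add: W_def y_def \<sigma>2_def) (simp add: \<sigma>1_def)
  have score: "psum (\<lambda>j c. w j * W c) 0 Y = (\<Sum>k<n. y k * (top_sum w (Suc k) Y / ?O k))" if "feas Y" for Y
    using weighted_top_sum[OF feas_finite[OF that], where y="\<lambda>k. y k / ?O k" and w=w and n=n]
    by (simp add: W_def)
  obtain Y where Y: "feas Y" "\<forall>j<n. nats \<sigma>3 ''x'' j = (if j \<in> Y then 1 else 0)"
    "\<And>Y'. feas Y' \<Longrightarrow> (1 - n / L) * psum (\<lambda>j c. w j * W c) 0 Y' \<le> psum (\<lambda>j c. w j * W c) 0 Y"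
    using best_response_spec[OF R2 W] unfolding \<sigma>3_def by blast
  let ?a = "\<lambda>k. top_sum w (Suc k) Y / ?O k"
  define u where "u = (\<Sum>k<n. y k * ?a k) / S"
  have A: "reals \<sigma>4 ''A'' k = top_sum w (Suc k) Y" if "k < n" for k
    using evaluate_spec[OF R3, of Y] Y(1,2) that unfolding \<sigma>4_def by (auto simp: feas_def)
  have unchanged: "reals \<sigma>4 ''O'' = ?O" "reals \<sigma>5 ''O'' = ?O" "reals \<sigma>4 ''y'' = y"
    "reals \<sigma>5 ''S'' 0 = S" "reals \<sigma>5 ''R'' = ?R" "reals \<sigma>5 ''A'' = reals \<sigma>4 ''A''"
    by (simp_all add: \<sigma>5_def \<sigma>4_def \<sigma>3_def \<sigma>2_def y_def S_def) (simp_all add: \<sigma>1_def)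
  have u5: "reals \<sigma>5 ''u'' 0 = (\<Sum>k<n. y k * ?a k)"
    using payoff_spec[OF n(3)] A by (simp add: \<sigma>5_def unchanged(1,3))
  have R': "reals \<tau> ''R'' k = ?R k + (u - ?a k)" if "k < n" for k
    using update_regrets_spec[OF n(4)] that A unfolding \<tau> by (simp add: unchanged u5 u_def)
  have "\<forall>j<n. nats \<tau> ''x'' j = (if j \<in> Y then 1 else 0)"
    using Y(2) by (simp add: \<tau> \<sigma>5_def \<sigma>4_def)
  moreover have "(1 - n / L) * lam \<le> u"
  proof -
    obtain Y' where Y': "feas Y'" "lam * S \<le> (\<Sum>k<n. y k * (top_sum w (Suc k) Y' / ?O k))"
      using lam y S unfolding game_value_ge_def by blast
    have "0 \<le> 1 - n / L" using L2 L_pos by (simp add: field_simps)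
    then have "(1 - n / L) * (lam * S) \<le> (1 - n / L) * (\<Sum>k<n. y k * (top_sum w (Suc k) Y' / ?O k))"
      using Y'(2) by (rule mult_left_mono[rotated])
    also have "\<dots> \<le> (\<Sum>k<n. y k * ?a k)" using Y(3)[OF Y'(1)] Y(1) Y'(1) by (simp add: score)
    also have "\<dots> = u * S" using S by (simp add: u_def)
    finally show ?thesis using S(2) by (simp add: mult.assoc[symmetric])
  qed
  moreover have "(\<Sum>k<n. (max (?R k + (u - ?a k)) 0)\<^sup>2) \<le> (\<Sum>k<n. (max (?R k) 0)\<^sup>2) + 4 * n"
    by (rule regret_step[OF S y _ u_def])
      (use near_opt_ratio[OF opt L2 Y(1)] vw in \<open>auto simp: valid_weights_def\<close>)
  ultimately show ?thesis using Y(1) R' by (intro exI[of _ Y] exI[of _ u]) simp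
qed

lemma write_row_spec:
  assumes "nats \<sigma> ''n'' 0 = n" "\<And>j. j < n \<Longrightarrow> nats \<sigma> ''pm'' j = \<pi> j" "inj_on \<pi> {..<n}" "nats \<sigma> ''xb'' 0 = B"
  shows "(\<forall>j<n. nats (sem write_row \<sigma>) ''X'' (B + \<pi> j) = nats \<sigma> ''x'' j) \<and>
    (\<forall>i. i \<notin> (\<lambda>j. B + \<pi> j) ` {..<n} \<longrightarrow> nats (sem write_row \<sigma>) ''X'' i = nats \<sigma> ''X'' i)"
proof -
  define I where "I m \<tau> \<longleftrightarrow> (\<forall>j<m. nats \<tau> ''X'' (B + \<pi> j) = nats \<sigma> ''x'' j) \<and>
    (\<forall>i. i \<notin> (\<lambda>j. B + \<pi> j) ` {..<n} \<longrightarrow> nats \<tau> ''X'' i = nats \<sigma> ''X'' i)" for m and \<tau> :: state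
  have "I n (sem write_row \<sigma>)"
    unfolding write_row_def
  proof (rule sem_for, goal_cases)
    case (4 m \<tau>)
    note [simp] = 4(2,3,4) assms(1,2,4)
    have "\<pi> m \<noteq> \<pi> j" if "j < m" for j
      using that 4(1) inj_onD[OF assms(3), of m j] by auto
    then show ?case using 4(1,5) by (auto simp: I_def less_Suc_eq)
  qed (use assms in \<open>auto simp: I_def\<close>)
  then show ?thesis by (simp add: I_def)
qed

text \<open>With \<open>U\<close> the sum of all \<open>u\<close>, the regret of \<open>k\<close> is
  \<open>U\<close> minus the cumulative payoff at \<open>k\<close>. Its positive part is at most the
  root of the potential, hence at most \<open>sqrt (4 * n * T)\<close>, while \<open>U\<close> grows
  by at least \<open>(1 - n / L) * lam\<close> per round.\<close>

lemma game_spec: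
  assumes ready: "ready \<sigma>" and L2: "2 * n \<le> L"
    and opt: "\<And>k. k < n \<Longrightarrow> near_opt k (reals \<sigma> ''O'' k)"
    and lam: "game_value_ge lam (reals \<sigma> ''O'')"
    and pm: "\<And>j. j < n \<Longrightarrow> nats \<sigma> ''pm'' j = \<pi> j" and bij: "bij_betw \<pi> {..<n} {1..n}"
    and init: "nats \<sigma> ''T'' 0 = T" "reals \<sigma> ''rT'' 0 = T" "nats \<sigma> ''xb'' 0 = 0"
      "\<And>k. k < n \<Longrightarrow> reals \<sigma> ''R'' k = 0"
  defines "\<tau> \<equiv> sem game \<sigma>"
  shows "\<exists>Y. (\<forall>t<T. feas (Y t)) \<and>
    (\<forall>t<T. \<forall>j<n. nats \<tau> ''X'' (t * n + \<pi> j) = (if j \<in> Y t then 1 else 0)) \<and>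
    (\<forall>t<T. reals \<tau> ''p'' t = 1 / T) \<and>
    (\<forall>k<n. T * ((1 - n / L) * lam) - sqrt (4 * n * T)
       \<le> (\<Sum>t<T. top_sum w (Suc k) (Y t) / reals \<sigma> ''O'' k))"
proof -
  let ?O = "reals \<sigma> ''O''"
  define P where "P m Y U \<rho> \<longleftrightarrow> (\<forall>t<m. feas (Y t)) \<and>
    (\<forall>t<m. \<forall>j<n. nats \<rho> ''X'' (t * n + \<pi> j) = (if j \<in> Y t then 1 else 0)) \<and>
    (\<forall>k<n. reals \<rho> ''R'' k = U - (\<Sum>t<m. top_sum w (Suc k) (Y t) / ?O k)) \<and>
    m * ((1 - n / L) * lam) \<le> U"
    for m and Y :: "nat \<Rightarrow> nat set" and U and \<rho> :: state
  define I where "I m \<rho> \<longleftrightarrow> (\<exists>Y U. P m Y U \<rho>) \<and> nats \<rho> ''xb'' 0 = m * n \<and>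
    (\<forall>t<m. reals \<rho> ''p'' t = 1 / T) \<and>
    (\<Sum>k<n. (max (reals \<rho> ''R'' k) 0)\<^sup>2) \<le> 4 * n * m" for m and \<rho> :: state
  have inj: "inj_on \<pi> {..<n}" using bij by (simp add: bij_betw_def)
  have range: "1 \<le> \<pi> j \<and> \<pi> j \<le> n" if "j < n" for j using bij that by (auto simp: bij_betw_def)
  have "I T \<tau>"
    unfolding \<tau>_def game_def
  proof (rule sem_for, goal_cases)
    case (4 m \<rho>)
    note frame = 4(3,4)
    have R: "ready \<rho>" by (rule ready_frame[OF ready]) (auto simp: frame)
    have O: "reals \<rho> ''O'' = ?O" by (simp add: frame)
    obtain Y U where P: "P m Y U \<rho>" using 4(5) by (auto simp: I_def)
    define \<rho>1 where "\<rho>1 = sem game_round \<rho>"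
    define \<rho>2 where "\<rho>2 = sem write_row \<rho>1"
    obtain X u where X: "feas X" "\<forall>j<n. nats \<rho>1 ''x'' j = (if j \<in> X then 1 else 0)"
      "\<forall>k<n. reals \<rho>1 ''R'' k = reals \<rho> ''R'' k + (u - top_sum w (Suc k) X / ?O k)"
      "(1 - n / L) * lam \<le> u"
      "(\<Sum>k<n. (max (reals \<rho>1 ''R'' k) 0)\<^sup>2) \<le> (\<Sum>k<n. (max (reals \<rho> ''R'' k) 0)\<^sup>2) + 4 * n"
      using game_round_spec[OF R L2, of lam] opt lam unfolding \<rho>1_def O by blast
    have R1: "ready \<rho>1" unfolding \<rho>1_def using R by (rule ready_sem) auto
    have xb: "nats \<rho>1 ''xb'' 0 = m * n" using 4(5) by (simp add: \<rho>1_def I_def)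
    have pm1: "nats \<rho>1 ''pm'' j = \<pi> j" if "j < n" for j using pm[OF that] by (simp add: \<rho>1_def frame)
    note row = write_row_spec[OF readyD(1)[OF R1] pm1 inj xb, folded \<rho>2_def]
    have old: "nats \<rho>2 ''X'' (t * n + \<pi> j) = nats \<rho> ''X'' (t * n + \<pi> j)" if "t < m" "j < n" for t j
    proof -
      \<comment> \<open>Earlier rows end at \<open>t * n + n <= m * n\<close>, and the new row
        starts at \<open>m * n + 1\<close> because \<pi> takes values from 1 on.\<close>
      have "t * n + n \<le> m * n" using that(1) mult_le_mono1[of "Suc t" m n] by simp
      then have "t * n + \<pi> j < m * n + \<pi> i" if "i < n" for i
        using range[OF \<open>j < n\<close>] range[OF that] by linarith
      then have "t * n + \<pi> j \<notin> (\<lambda>j. m * n + \<pi> j) ` {..<n}" by fastforce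
      then show ?thesis using row by (simp add: \<rho>1_def)
    qed
    let ?Y = "Y(m := X)"
    have "P (Suc m) ?Y (U + u) \<rho>2"
      unfolding P_def
    proof (intro conjI allI impI)
      show "feas (?Y t)" if "t < Suc m" for t using that P X(1) by (auto simp: P_def less_Suc_eq)
      show "nats \<rho>2 ''X'' (t * n + \<pi> j) = (if j \<in> ?Y t then 1 else 0)" if "t < Suc m" "j < n" for t j
      proof (cases "t = m")
        case True
        then show ?thesis using row X(2) that(2) by simp
      next
        case False
        then show ?thesis using old[of t j] P that by (simp add: P_def)
      qed
      show "reals \<rho>2 ''R'' k = U + u - (\<Sum>t<Suc m. top_sum w (Suc k) (?Y t) / ?O k)" if "k < n" for k
        using X(3) P that by (simp add: \<rho>2_def P_def)
      have "real (Suc m) * g = real m * g + g" for g by (simp add: algebra_simps)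
      then show "real (Suc m) * ((1 - n / L) * lam) \<le> U + u"
        using X(4) P unfolding P_def by (metis add_mono)
    qed
    then have "P (Suc m) ?Y (U + u) (nwrite ''t'' 0 (Suc m) (rwrite ''p'' m (1 / T) (nwrite ''xb'' 0 (Suc m * n) \<rho>2)))"
      by (simp add: P_def)
    moreover have "sem (game_round ;; write_row ;; nset ''xb'' (NAdd (NVar ''xb'') (NVar ''n'')) ;;
        PR ''p'' (NVar ''t'') (RDiv (RConst 1) (RVar ''rT''))) \<rho> =
        rwrite ''p'' m (1 / T) (nwrite ''xb'' 0 (Suc m * n) \<rho>2)"
      using xb 4(2) init readyD(1)[OF ready]
      by (simp add: \<rho>2_def \<rho>1_def frame add.commute)
    moreover have "reals \<rho>2 ''p'' = reals \<rho> ''p''" "reals \<rho>2 ''R'' = reals \<rho>1 ''R''"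
      by (simp_all add: \<rho>2_def) (simp add: \<rho>1_def)
    ultimately show ?case using 4(5) X(5)
      by (auto simp: I_def less_Suc_eq algebra_simps simp del: sem.simps)
  next
    case 3
    show ?case using init
      by (auto simp: I_def P_def intro!: exI[of _ "\<lambda>_. {}"] exI[of _ 0])
  qed (use init in auto)
  then obtain Y U where P: "P T Y U \<tau>" and p: "\<forall>t<T. reals \<tau> ''p'' t = 1 / T"
    and sq: "(\<Sum>k<n. (max (reals \<tau> ''R'' k) 0)\<^sup>2) \<le> 4 * n * T" by (auto simp: I_def)
  have "T * ((1 - n / L) * lam) - sqrt (4 * n * T) \<le> (\<Sum>t<T. top_sum w (Suc k) (Y t) / ?O k)"
    if "k < n" for k
  proof -
    have "(max (reals \<tau> ''R'' k) 0)\<^sup>2 \<le> (\<Sum>k<n. (max (reals \<tau> ''R'' k) 0)\<^sup>2)"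
      using that by (intro member_le_sum) auto
    then have "max (reals \<tau> ''R'' k) 0 \<le> sqrt (4 * n * T)" using sq by (intro real_le_rsqrt) linarith
    then have "reals \<tau> ''R'' k \<le> sqrt (4 * n * T)" by simp
    then show ?thesis using P that by (auto simp: P_def)
  qed
  then show ?thesis using P p by (intro exI[of _ Y]) (auto simp: P_def)
qed

end

section \<open>The complete program\<close>

definition before :: "(nat \<Rightarrow> real) \<Rightarrow> nat \<Rightarrow> nat \<Rightarrow> bool" where
  "before f i j \<longleftrightarrow> f j < f i \<or> (\<not> f i < f j \<and> i < j)"

text \<open>Sorting by counting predecessors costs quadratic time and needs no exchanges. Ties in
  \<open>before\<close> are broken by the index, so ranks are distinct and form a
  permutation.\<close>

definition item_rank :: "nat \<Rightarrow> (nat \<Rightarrow> real) \<Rightarrow> nat \<Rightarrow> nat" where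
  "item_rank n f j = card {i. i < n \<and> before f i j}"

lemma rank_less:
  assumes "before f i j" "i < n" shows "item_rank n f i < item_rank n f j"
  unfolding item_rank_def
proof (rule psubset_card_mono)
  have "{k. k < n \<and> before f k i} \<subseteq> {k. k < n \<and> before f k j}"
    using assms by (auto simp: before_def)
  moreover have "i \<in> {k. k < n \<and> before f k j}" "i \<notin> {k. k < n \<and> before f k i}"
    using assms by (auto simp: before_def)
  ultimately show "{k. k < n \<and> before f k i} \<subset> {k. k < n \<and> before f k j}" by blast
qed auto

lemma rank_bij: "bij_betw (item_rank n f) {..<n} {..<n}"
proof -
  have "inj_on (item_rank n f) {..<n}"
  proof (rule inj_onI)
    fix i j assume ij: "i \<in> {..<n}" "j \<in> {..<n}" "item_rank n f i = item_rank n f j"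
    have "i = j \<or> before f i j \<or> before f j i" by (auto simp: before_def)
    then show "i = j" using rank_less[of f i j n] rank_less[of f j i n] ij by auto
  qed
  moreover have "item_rank n f j < n" if "j < n" for j
  proof -
    have "item_rank n f j < card {..<n}"
      unfolding item_rank_def using that by (intro psubset_card_mono) (auto simp: before_def)
    then show ?thesis by simp
  qed
  ultimately show ?thesis
    by (intro bij_betw_imageI endo_inj_surj) auto
qed

lemma rank_antimono:
  assumes "i < n" "j < n" "item_rank n f i \<le> item_rank n f j" shows "f j \<le> f i"
proof (rule ccontr)
  assume "\<not> f j \<le> f i"
  then have "before f j i" by (simp add: before_def)
  then show False using rank_less[of f j i n] assms by simp
qed

abbreviation raw_value :: "string \<Rightarrow> rexp" where
  "raw_value i \<equiv> RCell ''v'' (NAdd (NVar i) (NConst 1))"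

definition compute_rank :: prog where
  "compute_rank = nset ''r'' (NConst 0) ;;
     PFor ''j'' ''n''
       (PIf (RLess (raw_value ''i'') (raw_value ''j''))
         (nset ''r'' (NAdd (NVar ''r'') (NConst 1)))
         (PIf (BAnd (BNot (RLess (raw_value ''j'') (raw_value ''i''))) (NLess (NVar ''j'') (NVar ''i'')))
           (nset ''r'' (NAdd (NVar ''r'') (NConst 1))) PSkip))"

definition sort_items :: prog where
  "sort_items = PFor ''i'' ''n''
     (compute_rank ;; PN ''pm'' (NVar ''r'') (NAdd (NVar ''i'') (NConst 1)))"

definition multiples :: "string \<Rightarrow> string \<Rightarrow> string \<Rightarrow> prog" where
  "multiples x b s = PN x (NConst 0) (NConst 0) ;;
     PFor ''i'' b (PN x (NAdd (NVar ''i'') (NConst 1)) (NAdd (NCell x (NVar ''i'')) (NVar s)))"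

lemma compute_rank_vars [simp]: "nvars compute_rank = {''r'', ''j''}" "rvars compute_rank = {}"
  by (auto simp: compute_rank_def)

lemma sort_items_vars [simp]: "nvars sort_items = {''r'', ''j'', ''i'', ''pm''}" "rvars sort_items = {}"
  by (auto simp: sort_items_def)

lemma multiples_vars [simp]: "nvars (multiples x b s) = {x, ''i''}" "rvars (multiples x b s) = {}"
  by (auto simp: multiples_def)

lemma compute_rank_spec:
  assumes "nats \<sigma> ''n'' 0 = n" "nats \<sigma> ''i'' 0 = i"
  shows "nats (sem compute_rank \<sigma>) ''r'' 0 = item_rank n (\<lambda>j. reals \<sigma> ''v'' (Suc j)) i"
proof -
  let ?f = "\<lambda>j. reals \<sigma> ''v'' (Suc j)"
  define I where "I m \<tau> \<longleftrightarrow> nats \<tau> ''r'' 0 = item_rank m ?f i" for m and \<tau> :: state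
  have rank_Suc: "item_rank (Suc m) ?f i = item_rank m ?f i + (if before ?f m i then 1 else 0)" for m
  proof -
    have "{k. k < Suc m \<and> before ?f k i} =
      (if before ?f m i then insert m {k. k < m \<and> before ?f k i} else {k. k < m \<and> before ?f k i})"
      by (auto simp: less_Suc_eq)
    then show ?thesis by (simp add: item_rank_def)
  qed
  have "I n (sem compute_rank \<sigma>)"
    unfolding compute_rank_def sem.simps(1-4)
  proof (rule sem_for, goal_cases)
    case (4 m \<tau>)
    note [simp] = 4(2,3,4) assms(2)
    show ?case using 4(5) by (simp add: I_def rank_Suc before_def)
  qed (use assms in \<open>auto simp: I_def item_rank_def\<close>)
  then show ?thesis by (simp add: I_def)
qed

lemma sort_items_spec:
  assumes "nats \<sigma> ''n'' 0 = n"
  shows "\<forall>i<n. nats (sem sort_items \<sigma>) ''pm'' (item_rank n (\<lambda>j. reals \<sigma> ''v'' (Suc j)) i) = Suc i"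
proof -
  let ?f = "\<lambda>j. reals \<sigma> ''v'' (Suc j)"
  define I where "I m \<tau> \<longleftrightarrow> (\<forall>i<m. nats \<tau> ''pm'' (item_rank n ?f i) = Suc i)" for m and \<tau> :: state
  have "I n (sem sort_items \<sigma>)"
    unfolding sort_items_def
  proof (rule sem_for, goal_cases)
    case (4 m \<tau>)
    note [simp] = 4(2,3,4)
    have r: "nats (sem compute_rank \<tau>) ''r'' 0 = item_rank n ?f m"
      using compute_rank_spec[of \<tau> n m] 4(2) assms by simp
    have "item_rank n ?f i \<noteq> item_rank n ?f m" if "i < m" for i
      using bij_betw_imp_inj_on[OF rank_bij[of n ?f], THEN inj_onD, of i m] that 4(1) by auto
    then show ?case using 4(5) by (fastforce simp: I_def less_Suc_eq r)
  qed (use assms in \<open>auto simp: I_def\<close>)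
  then show ?thesis by (simp add: I_def)
qed

lemma multiples_spec:
  assumes "x \<noteq> ''i''" "s \<noteq> ''i''" "b \<noteq> ''i''" "x \<noteq> s" "x \<noteq> b"
  shows "\<forall>j\<le>nats \<sigma> b 0. nats (sem (multiples x b s) \<sigma>) x j = j * nats \<sigma> s 0"
proof -
  define I where "I m \<tau> \<longleftrightarrow> (\<forall>j\<le>m. nats \<tau> x j = j * nats \<sigma> s 0)" for m and \<tau> :: state
  have "I (nats \<sigma> b 0) (sem (multiples x b s) \<sigma>)"
    unfolding multiples_def sem.simps(1-4)
  proof (rule sem_for, goal_cases)
    case (4 m \<tau>)
    have s: "nats \<tau> s 0 = nats \<sigma> s 0" using 4(3)[of s] assms by (auto simp: nats_nwrite_other)
    show ?case using 4(2,5) assms by (auto simp: I_def le_Suc_eq s)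
  qed (use assms in \<open>auto simp: I_def\<close>)
  then show ?thesis by (simp add: I_def)
qed

section \<open>Arithmetic by counting, the scale \<open>L\<close> and the sizes of the
  tables\<close>

definition count_up :: "string \<Rightarrow> string \<Rightarrow> prog" where
  "count_up x b = PFor ''i'' b (rset x (RAdd (RVar x) (RConst 1)))"

text \<open>Multiplication by repeated addition, just as \<open>count_up\<close> replaces the
  missing conversion of a natural into a real.\<close>

definition add_up :: "string \<Rightarrow> string \<Rightarrow> string \<Rightarrow> prog" where
  "add_up x b s = PFor ''i'' b (nset x (NAdd (NVar x) (NVar s)))"

lemma count_up_vars [simp]: "nvars (count_up x b) = {''i''}" "rvars (count_up x b) = {x}"
  by (auto simp: count_up_def)

lemma add_up_vars [simp]: "nvars (add_up x b s) = {x, ''i''}" "rvars (add_up x b s) = {}"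
  by (auto simp: add_up_def)

lemma count_up_spec:
  assumes "b \<noteq> ''i''" shows "reals (sem (count_up x b) \<sigma>) x 0 = reals \<sigma> x 0 + nats \<sigma> b 0"
  unfolding count_up_def
  by (rule sem_for[where I="\<lambda>m \<tau>. reals \<tau> x 0 = reals \<sigma> x 0 + m"]) (use assms in auto)

lemma add_up_spec:
  assumes "x \<noteq> ''i''" "s \<noteq> ''i''" "b \<noteq> ''i''" "x \<noteq> s" "x \<noteq> b"
  shows "nats (sem (add_up x b s) \<sigma>) x 0 = nats \<sigma> x 0 + nats \<sigma> b 0 * nats \<sigma> s 0"
  unfolding add_up_def
proof (rule sem_for[where I="\<lambda>m \<tau>. nats \<tau> x 0 = nats \<sigma> x 0 + m * nats \<sigma> s 0"], goal_cases)
  case (4 m \<tau>)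
  have "nats \<tau> s 0 = nats \<sigma> s 0" using 4(3)[of s] assms by auto
  then show ?case using 4(5) assms by simp
qed (use assms in auto)

text \<open>The accuracy is capped at 1, so that \<open>L\<close> is at least \<open>8 * n\<close>
  even when a large \<open>eps\<close> would permit a coarser scale.\<close>

definition prepare :: prog where
  "prepare = nset ''n1'' (NAdd (NVar ''n'') (NConst 1)) ;; count_up ''rn'' ''n'' ;;
     PIf (RLess (RVar ''eps'') (RConst 1)) (rset ''d'' (RVar ''eps'')) (rset ''d'' (RConst 1))"

text \<open>The one loop that is not a \<open>PFor\<close>: its length depends on a real number, and
  no variable holds a bound for it beforehand. \<open>L\<close> and its real copy \<open>rL\<close>
  advance together.\<close>

definition choose_scale :: com where
  "choose_scale = While (RLess (RMul (RVar ''rL'') (RVar ''d'')) (RMul (RConst 8) (RVar ''rn'')))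
     (Seq (NWrite ''L'' (NConst 0) (NAdd (NVar ''L'') (NConst 1)))
          (RWrite ''rL'' (NConst 0) (RAdd (RVar ''rL'') (RConst 1))))"

text \<open>The order matters: \<open>Q1\<close> is \<open>n * L\<close> while it serves to form
  \<open>T = n * L * L\<close>, and is increased to the table width only then. These variables bound
  loops of \<open>solve\<close>, which must not write its own bounds, so they are computed in a
  separate program.\<close>

definition dimensions :: prog where
  "dimensions = add_up ''Q1'' ''n'' ''L'' ;; add_up ''T'' ''L'' ''Q1'' ;;
     nset ''Q1'' (NAdd (NVar ''Q1'') (NConst 1)) ;; add_up ''P'' ''n1'' ''n1''"

definition tables :: prog where
  "tables = count_up ''rT'' ''T'' ;; multiples ''mn'' ''n1'' ''n1'' ;; multiples ''mq'' ''P'' ''Q1'' ;; sort_items"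

definition solve :: prog where
  "solve = tables ;; optima ;; game ;; nset ''m'' (NVar ''T'')"

definition fptas :: com where
  "fptas = Seq (compile prepare) (Seq choose_scale (Seq (compile dimensions) (compile solve)))"

text \<open>The final \<open>L\<close> is the least admissible one, so \<open>L - 1\<close> fails
  the condition; this failure is the upper bound on \<open>L\<close> from which the running time is
  estimated.\<close>

lemma choose_scale_exec:
  assumes "nats \<sigma> ''L'' 0 = 0" "reals \<sigma> ''rL'' 0 = 0" "reals \<sigma> ''rn'' 0 = real n" "reals \<sigma> ''d'' 0 = d" "0 < d"
    and "1 \<le> n"
  shows "\<exists>t L. exec choose_scale \<sigma> t (nwrite ''L'' 0 L (rwrite ''rL'' 0 (real L) \<sigma>)) \<and>
    t \<le> 11 + 23 * L \<and> 1 \<le> L \<and> 8 * n \<le> L * d \<and> (real L - 1) * d < 8 * n"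
proof -
  obtain L0 where "8 * n / d < real L0" using reals_Archimedean2 by blast
  then have "8 * n \<le> real L0 * d" using assms(5) by (simp add: field_simps)
  define L where "L = (LEAST L. 8 * n \<le> real L * d)"
  have L: "8 * n \<le> real L * d" unfolding L_def by (rule LeastI) fact
  have less: "real k * d < 8 * n" if "k < L" for k
    using not_less_Least[of k "\<lambda>L. 8 * n \<le> real L * d"] that unfolding L_def by simp
  let ?st = "\<lambda>k. nwrite ''L'' 0 k (rwrite ''rL'' 0 (real k) \<sigma>)"
  let ?b = "RLess (RMul (RVar ''rL'') (RVar ''d'')) (RMul (RConst 8) (RVar ''rn''))"
  let ?c = "Seq (NWrite ''L'' (NConst 0) (NAdd (NVar ''L'') (NConst 1)))
          (RWrite ''rL'' (NConst 0) (RAdd (RVar ''rL'') (RConst 1)))"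
  \<comment> \<open>Induction on the iterations still to run, backwards from the final state. A test
    costs 11 and the body 12.\<close>
  have "\<exists>t. exec choose_scale (?st (L - i)) t (?st L) \<and> t \<le> 11 + 23 * i" if "i \<le> L" for i
    using that
  proof (induction i)
    case 0
    have "\<not> bval ?b (?st L)" using L assms by simp
    then show ?case unfolding choose_scale_def using exec.WhileFalse[of ?b "?st L" ?c] by fastforce
  next
    case (Suc i)
    define k where "k = L - Suc i"
    have k: "L - i = Suc k" "k < L" using Suc.prems by (auto simp: k_def)
    have b: "bval ?b (?st k)" using less[OF k(2)] assms by simp
    have c: "exec ?c (?st k) 12 (?st (Suc k))"
    proof -
      have "rwrite ''rL'' 0 (real k + 1) (nwrite ''L'' 0 (Suc k) (?st k)) = ?st (Suc k)"
        by (simp add: nwrite_def rwrite_def fun_upd_def add.commute cong: if_cong)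
      note st = this
      show ?thesis
        using exec.Seq[OF exec.NWrite[of "''L''" "NConst 0" "NAdd (NVar ''L'') (NConst 1)" "?st k"]
          exec.RWrite[of "''rL''" "NConst 0" "RAdd (RVar ''rL'') (RConst 1)"]]
        by (simp add: st numeral_eq_Suc)
    qed
    obtain t where t: "exec choose_scale (?st (Suc k)) t (?st L)" "t \<le> 11 + 23 * i"
      using Suc.IH Suc.prems k(1) by auto
    have "exec choose_scale (?st k) (1 + bcost ?b + 12 + t) (?st L)"
      using exec.WhileTrue[OF b c t(1)[unfolded choose_scale_def]] by (simp only: choose_scale_def)
    then show ?case using t(2) unfolding k_def[symmetric]
      by (intro exI[of _ "1 + bcost ?b + 12 + t"]) simp
  qed
  from this[of L] obtain t where "exec choose_scale (?st 0) t (?st L)" "t \<le> 11 + 23 * L" by auto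
  moreover have "?st 0 = \<sigma>"
    using assms(1,2) by (simp add: nwrite_def rwrite_def fun_upd_idem)
  moreover have "1 \<le> L" using L assms(6) by (cases L) auto
  moreover have "(real L - 1) * d < 8 * n" using less[of "L - 1"] \<open>1 \<le> L\<close> by (simp add: of_nat_diff)
  ultimately show ?thesis using L by auto
qed

text \<open>The binomial theorem brings a power of \<open>(1 + x) * (1 + y)\<close> into coefficient
  form, so a time bound need only be a constant times such a power.\<close>

lemma poly2_binomial:
  "poly2 d (\<lambda>i j. c * real (d choose i) * real (d choose j)) x y = c * ((1 + x) * (1 + y)) ^ d"
proof -
  have "(1 + x) ^ d = (\<Sum>i\<le>d. real (d choose i) * x ^ i)" for x :: real
    using binomial_ring[of x 1 d] by (simp add: add.commute)
  then have "c * ((1 + x) * (1 + y)) ^ d =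
      c * ((\<Sum>i\<le>d. real (d choose i) * x ^ i) * (\<Sum>j\<le>d. real (d choose j) * y ^ j))"
    by (simp only: power_mult_distrib)
  also have "\<dots> = (\<Sum>i\<le>d. \<Sum>j\<le>d. c * (real (d choose i) * x ^ i * (real (d choose j) * y ^ j)))"
    unfolding sum_product by (simp only: sum_distrib_left)
  also have "\<dots> = (\<Sum>i\<le>d. \<Sum>j\<le>d. c * real (d choose i) * real (d choose j) * x ^ i * y ^ j)"
    by (intro sum.cong refl) (simp add: mult_ac)
  finally show ?thesis by (simp add: poly2_def)
qed

lemma optima_vars [simp]:
  "nvars optima = {''k1'', ''b'', ''i'', ''c'', ''bt'', ''j'', ''q'', ''r'', ''qs'', ''cc'', ''x'', ''k''}"
  "rvars optima = {''W'', ''M'', ''rb'', ''pr'', ''G'', ''g1'', ''g2'', ''A'', ''O''}"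
  by (auto simp: optima_def)

lemma game_vars [simp]:
  "nvars game = {''t'', ''b'', ''i'', ''c'', ''bt'', ''j'', ''q'', ''r'', ''qs'', ''cc'', ''x'', ''k'', ''X'', ''xb''}"
  "rvars game = {''M'', ''rb'', ''pr'', ''G'', ''g1'', ''g2'', ''S'', ''y'', ''W'', ''A'', ''u'', ''R'', ''p''}"
  by (auto simp: game_def)

lemma tables_vars [simp]: "nvars tables = {''i'', ''mn'', ''mq'', ''r'', ''j'', ''pm''}" "rvars tables = {''rT''}"
  by (auto simp: tables_def)

lemma prepare_vars [simp]: "nvars prepare = {''n1'', ''i''}" "rvars prepare = {''rn'', ''d''}"
  by (auto simp: prepare_def)

lemma dimensions_vars [simp]: "nvars dimensions = {''Q1'', ''T'', ''P'', ''i''}" "rvars dimensions = {}"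
  by (auto simp: dimensions_def)

lemma prepare_bounds: "fresh_counters prepare" "bounds prepare = {''n''}"
  by (auto simp: prepare_def count_up_def)

lemma dimensions_bounds: "fresh_counters dimensions" "bounds dimensions = {''n'', ''L'', ''n1''}"
  by (auto simp: dimensions_def add_up_def)

lemma solve_bounds: "fresh_counters solve" "bounds solve \<subseteq> {''n'', ''n1'', ''L'', ''Q1'', ''P'', ''T''}"
  by (auto simp: solve_def tables_def count_up_def multiples_def sort_items_def compute_rank_def
    optima_def opt_weights_def best_response_def profit_table_def profit_row_def round_count_def dp_base_def
    dp_base_row_def dp_def dp_level_def dp_row_def find_target_def backtrack_def evaluate_def evaluate_row_def
    game_def game_round_def regret_weights_def default_weights_def tails_def tail_row_def payoff_def
    update_regrets_def write_row_def)

lemma solve_nvars: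
  "nvars solve \<inter> {''n'', ''n1'', ''L'', ''Q1'', ''P'', ''T''} = {}"
  by (auto simp: solve_def)

lemma solve_disjoint: "bounds solve \<inter> nvars solve = {}"
proof -
  have "A \<inter> B = {}" if "A \<subseteq> S" "B \<inter> S = {}" for A B S :: "string set" using that by blast
  from this[OF solve_bounds(2) solve_nvars] show ?thesis .
qed

section \<open>From sorted positions back to the items of the instance\<close>

locale sorting = sorted_knapsack n L w z C
  for n L :: nat and w z :: "nat \<Rightarrow> real" and C :: real +
  fixes s v :: "nat \<Rightarrow> real" and \<pi> :: "nat \<Rightarrow> nat"
  assumes inst: "knapsack_instance n s v C"
    and bij: "bij_betw \<pi> {..<n} {1..n}"
    and w_eq: "w = (\<lambda>j. v (\<pi> j))" and z_eq: "z = (\<lambda>j. s (\<pi> j))"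
    and L2: "2 * n \<le> L"
begin

abbreviation opt :: "nat \<Rightarrow> real" where
  "opt k \<equiv> v_le v (Suc k) (X_opt n s v C (Suc k))"

lemma inj: "Y \<subseteq> {..<n} \<Longrightarrow> inj_on \<pi> Y"
  using bij inj_on_subset by (auto simp: bij_betw_def)

lemma sum_image: "Y \<subseteq> {..<n} \<Longrightarrow> sum s (\<pi> ` Y) = sum z Y"
  by (simp add: sum.reindex[OF inj] z_eq)

lemma feasible_image: "feas Y \<Longrightarrow> \<pi> ` Y \<in> feasible n s C"
  using bij image_mono[of Y "{..<n}" \<pi>] by (simp add: feas_def feasible_def sum_image bij_betw_def)

lemma feasible_preimage:
  assumes "X \<in> feasible n s C" obtains Y where "feas Y" "X = \<pi> ` Y"
proof -
  have "X \<subseteq> \<pi> ` {..<n}" using assms bij by (auto simp: feasible_def bij_betw_def)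
  then obtain Y where Y: "Y \<subseteq> {..<n}" "X = \<pi> ` Y" by (meson subset_imageE)
  then have "feas Y" using assms by (simp add: feas_def feasible_def sum_image)
  then show ?thesis using Y that by blast
qed

lemma v_le_top_sum: "feas Y \<Longrightarrow> v_le v k (\<pi> ` Y) = top_sum w k Y"
proof -
  assume Y: "feas Y"
  have "v_le v k (\<pi> ` Y) = v_le w k Y" using v_le_image[OF inj] Y by (simp add: feas_def w_eq)
  also have "\<dots> = top_sum w k Y"
    using Y feas_finite[OF Y] less_imp_le[OF w_pos] w_antimono
    by (intro v_le_eq_top_sum) (auto simp: feas_def)
  finally show ?thesis .
qed

lemma top_sum_le_opt: "feas Y \<Longrightarrow> top_sum w (Suc k) Y \<le> opt k"
  using v_le_le_opt[OF inst feasible_image, of Y "Suc k"] by (simp add: v_le_top_sum)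

lemma near_opt_bounds:
  assumes "near_opt k o'" shows "(1 - n / L) * opt k \<le> o'" "o' \<le> opt k"
proof -
  obtain Y where "feas Y" "X_opt n s v C (Suc k) = \<pi> ` Y"
    using X_opt_feasible[OF inst] feasible_preimage by metis
  then show "(1 - n / L) * opt k \<le> o'" using assms by (simp add: near_opt_def v_le_top_sum)
  show "o' \<le> opt k" using assms top_sum_le_opt by (auto simp: near_opt_def)
qed

text \<open>Against fixed weights some feasible set attains the maximal payoff, and by weak duality
  it earns at least the maximum robustness. Replacing the optima by the smaller \<open>f k\<close>
  only increases the payoffs.\<close>

lemma game_value:
  assumes "\<And>k. k < n \<Longrightarrow> near_opt k (f k)"
  shows "game_value_ge (max_robustness n s v C) f"
  unfolding game_value_ge_def
proof (intro allI impI)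
  fix y :: "nat \<Rightarrow> real" assume y: "\<forall>k<n. 0 \<le> y k" "0 < (\<Sum>k<n. y k)"
  define g where "g X = (\<Sum>k<n. y k * (v_le v (Suc k) X / opt k))" for X
  have "finite (g ` feasible n s C)" "g ` feasible n s C \<noteq> {}"
    using finite_feasible empty_feasible[OF inst] by auto
  then obtain X where X: "X \<in> feasible n s C" "g X = Max (g ` feasible n s C)"
    by (metis (no_types, lifting) Max_in imageE)
  obtain Y where Y: "feas Y" "X = \<pi> ` Y" using feasible_preimage[OF X(1)] .
  have "(\<Sum>k<n. y k * (v_le v (Suc k) X' / opt k)) \<le> g X" if "X' \<in> feasible n s C" for X'
  proof -
    have "g X' \<le> g X" unfolding X(2) using that finite_feasible by (intro Max_ge) auto
    then show ?thesis by (simp only: g_def)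
  qed
  then have "max_robustness n s v C * (\<Sum>k<n. y k) \<le> g X"
    using y by (intro max_robustness_le[OF inst]) auto
  also have "\<dots> \<le> (\<Sum>k<n. y k * (top_sum w (Suc k) Y / f k))"
    unfolding g_def
  proof (intro sum_mono mult_left_mono)
    fix k assume k: "k \<in> {..<n}"
    have "0 \<le> top_sum w (Suc k) Y"
      using v_le_nonneg[OF finite_of_feasible[OF X(1)], of v "Suc k"] Y by (simp add: v_le_top_sum)
    then show "v_le v (Suc k) X / opt k \<le> top_sum w (Suc k) Y / f k"
      using near_opt_bounds(2)[OF assms, of k] near_opt_pos[OF assms L2, of k] k Y
        divide_left_mono[of "f k" "opt k" "top_sum w (Suc k) Y"]
      by (simp add: v_le_top_sum)
  qed (use y in auto)
  finally show "\<exists>Y. feas Y \<and> max_robustness n s v C * (\<Sum>k<n. y k) \<le> (\<Sum>k<n. y k * (top_sum w (Suc k) Y / f k))"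
    using Y(1) by blast
qed

text \<open>The number of rounds \<open>T = n L\<^sup>2\<close> makes the regret \<open>sqrt (4 n T) = 2 n L\<close> at most
  \<open>2 T (n / L)\<close> times the value of the game, which is at least \<open>1 / n\<close>.\<close>

lemma robustness_of_play:
  assumes near: "\<And>k. k < n \<Longrightarrow> near_opt k (f k)" and T: "T = n * L * L"
    and Y: "\<And>t. t < T \<Longrightarrow> feas (Y t)"
    and play: "\<And>k. k < n \<Longrightarrow> T * ((1 - n / L) * max_robustness n s v C) - sqrt (4 * n * T)
       \<le> (\<Sum>t<T. top_sum w (Suc k) (Y t) / f k)"
  shows "(1 - 4 * (n / L)) * max_robustness n s v C
    \<le> robustness n s v C (map_pmf (\<lambda>t. \<pi> ` Y t) (pmf_of_set {..<T}))"
proof (rule robustness_uniform_family[OF inst])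
  show "0 < T" using T n_pos L_pos by simp
  show "\<pi> ` Y t \<in> feasible n s C" if "t < T" for t using feasible_image[OF Y[OF that]] .
  fix k assume k: "k < n"
  define lam where "lam = max_robustness n s v C"
  define \<delta> where "\<delta> = n / real L"
  have \<delta>: "0 \<le> \<delta>" "\<delta> \<le> 1 / 2" using L2 L_pos by (auto simp: \<delta>_def field_simps)
  have lam: "1 / n \<le> lam" using max_robustness_ge[OF inst] by (simp add: lam_def)
  have "sqrt (4 * n * T) = sqrt ((2 * real n * L)\<^sup>2)" by (simp add: T power2_eq_square mult_ac)
  also have "\<dots> = 2 * real n * L" by (simp only: real_sqrt_abs) simp
  also have "\<dots> = 2 * T * \<delta> * (1 / n)" using n_pos L_pos by (simp add: T \<delta>_def)
  also have "\<dots> \<le> 2 * T * \<delta> * lam" using lam \<delta>(1) by (intro mult_left_mono) auto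
  finally have regret: "sqrt (4 * n * T) \<le> 2 * T * \<delta> * lam" .
  have o: "0 < opt k" using opt_pos[OF inst] by simp
  \<comment> \<open>Payoffs were measured against \<open>f\<close>; measuring them against the true
    optima costs one factor \<open>1 - \<delta>\<close>.\<close>
  have each: "(1 - \<delta>) * (top_sum w (Suc k) (Y t) / f k) \<le> v_le v (Suc k) (\<pi> ` Y t) / opt k" if "t < T" for t
  proof -
    have "0 \<le> top_sum w (Suc k) (Y t)"
      using v_le_nonneg[OF finite_of_feasible[OF feasible_image[OF Y[OF that]]], of v "Suc k"] Y[OF that]
      by (simp add: v_le_top_sum)
    then have "(1 - \<delta>) * opt k * top_sum w (Suc k) (Y t) \<le> f k * top_sum w (Suc k) (Y t)"
      using near_opt_bounds(1)[OF near[OF k]] by (intro mult_right_mono) (auto simp: \<delta>_def)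
    then show ?thesis
      using near_opt_pos[OF near[OF k] L2] o Y[OF that] by (simp add: v_le_top_sum field_simps)
  qed
  have lam0: "0 \<le> T * lam" using lam n_pos by (intro mult_nonneg_nonneg) (auto intro: order_trans[rotated])
  \<comment> \<open>The budget: \<open>1 - 3 * \<delta>\<close> collects one \<delta> from the
    responses and two from the regret, and the remaining factor comes from the optima. The product
    exceeds \<open>1 - 4 * \<delta>\<close> by \<open>3 * \<delta> * \<delta>\<close>.\<close>
  have "(1 - 4 * \<delta>) * lam * T \<le> (1 - \<delta>) * (1 - 3 * \<delta>) * (T * lam)"
  proof -
    have "(1 - 4 * \<delta>) \<le> (1 - \<delta>) * (1 - 3 * \<delta>)" by (simp add: algebra_simps)
    from mult_right_mono[OF this lam0] show ?thesis by (simp add: mult_ac)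
  qed
  also have "\<dots> = (1 - \<delta>) * (T * ((1 - \<delta>) * lam) - 2 * T * \<delta> * lam)" by (simp add: algebra_simps)
  also have "\<dots> \<le> (1 - \<delta>) * (T * ((1 - \<delta>) * lam) - sqrt (4 * n * T))"
    using regret \<delta> by (intro mult_left_mono) auto
  also have "\<dots> \<le> (1 - \<delta>) * (\<Sum>t<T. top_sum w (Suc k) (Y t) / f k)"
    using play[OF k, folded lam_def \<delta>_def] \<delta> by (intro mult_left_mono) auto
  also have "\<dots> \<le> (\<Sum>t<T. v_le v (Suc k) (\<pi> ` Y t) / opt k)"
    unfolding sum_distrib_left using each by (intro sum_mono) auto
  finally show "(1 - 4 * (n / L)) * max_robustness n s v C * T \<le> \<dots>" by (simp add: lam_def \<delta>_def)
qed

end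

text \<open>The hypotheses describe memory as the input and the three preceding programs leave it;
  zero regrets and a zero row offset come from blank cells.\<close>

lemma solve_correct:
  assumes inst: "knapsack_instance n s v C" and L2: "2 * n \<le> L"
    and st: "nats \<sigma> ''n'' 0 = n" "nats \<sigma> ''n1'' 0 = Suc n" "nats \<sigma> ''L'' 0 = L" "nats \<sigma> ''Q1'' 0 = Suc (n * L)"
      "nats \<sigma> ''P'' 0 = Suc n * Suc n" "nats \<sigma> ''T'' 0 = n * L * L" "nats \<sigma> ''xb'' 0 = 0"
      "reals \<sigma> ''rL'' 0 = L" "reals \<sigma> ''C'' 0 = C" "reals \<sigma> ''rT'' 0 = 0"
      "\<And>i. i \<in> {1..n} \<Longrightarrow> reals \<sigma> ''s'' i = s i" "\<And>i. i \<in> {1..n} \<Longrightarrow> reals \<sigma> ''v'' i = v i"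
      "\<And>k. reals \<sigma> ''R'' k = 0"
  shows "\<exists>p. outputs n (sem solve \<sigma>) p \<and> p \<in> distributions n s C \<and> output_length (sem solve \<sigma>) = n * L * L \<and>
    (1 - 4 * (n / L)) * max_robustness n s v C \<le> robustness n s v C p"
proof -
  define T where "T = n * L * L"
  have n1: "1 \<le> n" using inst by (simp add: knapsack_instance_def)
  define f where "f j = reals \<sigma> ''v'' (Suc j)" for j
  have f: "f j = v (Suc j)" if "j < n" for j using st(12)[of "Suc j"] that by (simp add: f_def)
  \<comment> \<open>Inverting the rank gives the item at each sorted position, counted from 0; \<pi>
    adds one to reach the numbering of the instance.\<close>
  define \<rho> where "\<rho> = inv_into {..<n} (item_rank n f)"
  have bij\<rho>: "bij_betw \<rho> {..<n} {..<n}" unfolding \<rho>_def by (rule bij_betw_inv_into[OF rank_bij])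
  have \<rho>: "item_rank n f (\<rho> j) = j" "\<rho> j < n" if "j < n" for j
  proof -
    show "item_rank n f (\<rho> j) = j" unfolding \<rho>_def
      using that by (intro bij_betw_inv_into_right[OF rank_bij]) auto
    show "\<rho> j < n" using bij\<rho> that by (auto simp: bij_betw_def)
  qed
  define \<pi> where "\<pi> j = Suc (\<rho> j)" for j
  have bij: "bij_betw \<pi> {..<n} {1..n}"
  proof -
    have "bij_betw Suc {..<n} {1..n}" by (rule bij_betwI[of _ _ _ "\<lambda>i. i - 1"]) auto
    from bij_betw_trans[OF bij\<rho> this] show ?thesis by (simp add: \<pi>_def[abs_def] o_def)
  qed
  define w where "w j = v (\<pi> j)" for j
  define z where "z j = s (\<pi> j)" for j
  have \<pi>: "\<pi> j \<in> {1..n}" if "j < n" for j using bij that by (auto simp: bij_betw_def)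
  interpret sorting n L w z C s v \<pi>
  proof
    show "1 \<le> n" "1 \<le> L" using n1 L2 by auto
    show "0 < w j" "0 < z j" "z j \<le> C" if "j < n" for j
      using inst \<pi>[OF that] by (auto simp: w_def z_def knapsack_instance_def)
    show "w j \<le> w i" if "i \<le> j" "j < n" for i j
      using rank_antimono[of "\<rho> i" n "\<rho> j" f] \<rho> f that by (simp add: w_def \<pi>_def)
  qed (use inst bij L2 in \<open>auto simp: w_def[abs_def] z_def[abs_def]\<close>)
  define \<sigma>0 where "\<sigma>0 = sem (count_up ''rT'' ''T'') \<sigma>"
  define \<sigma>1 where "\<sigma>1 = sem (multiples ''mn'' ''n1'' ''n1'') \<sigma>0"
  define \<sigma>2 where "\<sigma>2 = sem (multiples ''mq'' ''P'' ''Q1'') \<sigma>1"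
  define \<sigma>3 where "\<sigma>3 = sem sort_items \<sigma>2"
  have \<sigma>3: "sem tables \<sigma> = \<sigma>3" by (simp add: tables_def \<sigma>0_def \<sigma>1_def \<sigma>2_def \<sigma>3_def)
  have rT: "reals \<sigma>3 ''rT'' 0 = T"
    using count_up_spec[of "''T''" "''rT''" \<sigma>] st by (simp add: \<sigma>3_def \<sigma>2_def \<sigma>1_def \<sigma>0_def T_def)
  have mn: "\<forall>j\<le>Suc n. nats \<sigma>1 ''mn'' j = j * Suc n"
    using multiples_spec[of "''mn''" "''n1''" "''n1''" \<sigma>0] st by (simp add: \<sigma>1_def \<sigma>0_def)
  have mq: "\<forall>j\<le>Suc n * Suc n. nats \<sigma>2 ''mq'' j = j * Suc (n * L)"
    using multiples_spec[of "''mq''" "''Q1''" "''P''" \<sigma>1] st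
    by (simp add: \<sigma>2_def \<sigma>1_def \<sigma>0_def del: mult_Suc mult_Suc_right)
  have pm: "nats \<sigma>3 ''pm'' j = \<pi> j" if "j < n" for j
  proof -
    have "reals \<sigma>2 ''v'' = reals \<sigma> ''v''" "nats \<sigma>2 ''n'' 0 = n"
      using st by (simp_all add: \<sigma>2_def \<sigma>1_def \<sigma>0_def)
    then have "nats \<sigma>3 ''pm'' (item_rank n f (\<rho> j)) = Suc (\<rho> j)"
      using sort_items_spec[of \<sigma>2 n] \<rho>(2)[OF that] by (simp add: \<sigma>3_def f_def[abs_def])
    then show ?thesis using \<rho>(1)[OF that] by (simp add: \<pi>_def)
  qed
  have R3: "ready \<sigma>3"
    unfolding ready_def
  proof (intro conjI allI impI)
    show "nats \<sigma>3 ''mn'' j = j * Suc n" if "j \<le> n" for j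
      using mn that by (simp add: \<sigma>3_def \<sigma>2_def del: mult_Suc_right)
    show "nats \<sigma>3 ''mq'' j = j * Suc (n * L)" if "j < Suc n * Suc n" for j
      using mq that by (simp add: \<sigma>3_def del: mult_Suc_right mult_Suc)
    show "reals \<sigma>3 ''v'' (nats \<sigma>3 ''pm'' j) = w j" "reals \<sigma>3 ''s'' (nats \<sigma>3 ''pm'' j) = z j" if "j < n" for j
      using st(11,12)[OF \<pi>[OF that]] pm[OF that]
      by (simp_all add: \<sigma>3_def \<sigma>2_def \<sigma>1_def \<sigma>0_def w_def z_def)
  qed (use st in \<open>simp_all add: \<sigma>3_def \<sigma>2_def \<sigma>1_def \<sigma>0_def\<close>)
  define \<sigma>4 where "\<sigma>4 = sem optima \<sigma>3"
  define \<sigma>5 where "\<sigma>5 = sem game \<sigma>4"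
  have R4: "ready \<sigma>4" unfolding \<sigma>4_def using R3 by (rule ready_sem) auto
  have near: "near_opt k (reals \<sigma>4 ''O'' k)" if "k < n" for k
    using optima_spec[OF R3] that by (simp add: \<sigma>4_def)
  have init: "nats \<sigma>4 ''T'' 0 = T" "reals \<sigma>4 ''rT'' 0 = T" "nats \<sigma>4 ''xb'' 0 = 0" "reals \<sigma>4 ''R'' k = 0" for k
    using st rT by (simp_all add: \<sigma>4_def \<sigma>3_def \<sigma>2_def \<sigma>1_def \<sigma>0_def T_def)
  have pm4: "nats \<sigma>4 ''pm'' j = \<pi> j" if "j < n" for j using pm[OF that] by (simp add: \<sigma>4_def)
  obtain Y where Y: "\<forall>t<T. feas (Y t)"
    "\<forall>t<T. \<forall>j<n. nats \<sigma>5 ''X'' (t * n + \<pi> j) = (if j \<in> Y t then 1 else 0)"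
    "\<forall>t<T. reals \<sigma>5 ''p'' t = 1 / T"
    "\<forall>k<n. T * ((1 - n / L) * max_robustness n s v C) - sqrt (4 * n * T)
       \<le> (\<Sum>t<T. top_sum w (Suc k) (Y t) / reals \<sigma>4 ''O'' k)"
    using game_spec[OF R4 L2 near game_value[OF near] pm4 bij init] unfolding \<sigma>5_def by blast
  define \<tau> where "\<tau> = nwrite ''m'' 0 T \<sigma>5"
  have \<tau>: "sem solve \<sigma> = \<tau>"
    using st(6)[folded T_def] \<sigma>3 by (simp add: solve_def \<tau>_def \<sigma>5_def \<sigma>4_def)
  have len: "output_length \<tau> = T" by (simp add: output_length_def \<tau>_def)
  have set: "output_set n \<tau> t = \<pi> ` Y t" if "t < T" for t
  proof -
    have Yn: "Y t \<subseteq> {..<n}" using Y(1) that by (simp add: feas_def)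
    have range: "{1..n} = \<pi> ` {..<n}" using bij by (simp add: bij_betw_def)
    have X: "nats \<tau> ''X'' (t * n + \<pi> j) = (if j \<in> Y t then 1 else 0)" if "j < n" for j
      using Y(2) \<open>t < T\<close> that by (simp add: \<tau>_def)
    show ?thesis unfolding output_set_def range using Yn by (auto simp: X split: if_splits)
  qed
  define p where "p = map_pmf (\<lambda>t. \<pi> ` Y t) (pmf_of_set {..<T})"
  have T0: "0 < T" using n1 L2 by (simp add: T_def)
  have "pmf p X = (\<Sum>j | j < T \<and> output_set n \<tau> j = X. output_prob \<tau> j)" for X
    unfolding p_def pmf_uniform_family[OF T0]
    using set Y(3) by (intro sum.cong) (auto simp: output_prob_def \<tau>_def)
  then have "outputs n \<tau> p" using Y(3) by (simp add: outputs_def len) (simp add: output_prob_def \<tau>_def)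
  moreover have "p \<in> distributions n s C"
    using Y(1) feasible_image T0 by (auto simp: p_def distributions_def set_pmf_of_set lessThan_empty_iff)
  moreover have "(1 - 4 * (n / L)) * max_robustness n s v C \<le> robustness n s v C p"
    unfolding p_def by (rule robustness_of_play[OF near T_def]) (use Y in auto)
  ultimately show ?thesis using len unfolding \<tau> T_def by blast
qed

section \<open>Running time and error in terms of \<open>n\<close> and
  \<open>1 / \<epsilon>\<close>\<close>

lemma size_bounds:
  fixes n L :: nat
  defines "N \<equiv> (Suc n)\<^sup>2 * (Suc L)\<^sup>2"
  shows "Suc n \<le> N" "Suc n + L \<le> N" "Suc (n * L) \<le> N" "Suc n * Suc n \<le> N" "n * L * L \<le> N"
proof -
  \<comment> \<open>Each quantity is compared with \<open>A\<close> or with a product of two numbers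
    below \<open>A\<close>; the common bound \<open>N\<close> is its square.\<close>
  define A where "A = Suc n * Suc L"
  have N: "N = A * A" by (simp only: N_def A_def power2_eq_square mult_ac)
  have A: "A = n * L + n + L + 1" by (simp add: A_def)
  have "A \<le> N" using A by (simp add: N)
  moreover have "Suc n \<le> A" "Suc n + L \<le> A" "Suc (n * L) \<le> A" using A by auto
  ultimately show "Suc n \<le> N" "Suc n + L \<le> N" "Suc (n * L) \<le> N" by (auto intro: order_trans)
  show "Suc n * Suc n \<le> N" unfolding N by (intro mult_le_mono) (use A in auto)
  show "n * L * L \<le> N" unfolding N by (intro mult_le_mono) (use A in auto)
qed

lemma fptas_correct:
  assumes inst: "knapsack_instance n s v C" and \<epsilon>: "0 < \<epsilon>"
  shows "\<exists>t \<tau> p L. exec fptas (input_state n s v C \<epsilon>) t \<tau> \<and>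
    t \<le> time_bound prepare n + (11 + 23 * L) + time_bound dimensions (Suc n + L)
      + time_bound solve ((Suc n)\<^sup>2 * (Suc L)\<^sup>2) \<and>
    output_length \<tau> = n * L * L \<and> real L + 1 \<le> 8 * (1 + real n) * (1 + 1 / \<epsilon>) \<and>
    outputs n \<tau> p \<and> p \<in> distributions n s C \<and>
    (1 - \<epsilon>) * max_robustness n s v C \<le> robustness n s v C p"
proof -
  let ?\<sigma> = "input_state n s v C \<epsilon>"
  have n1: "1 \<le> n" using inst by (simp add: knapsack_instance_def)
  define \<sigma>1 where "\<sigma>1 = sem prepare ?\<sigma>"
  define d where "d = min \<epsilon> 1"
  have d: "0 < d" "d \<le> \<epsilon>" "d \<le> 1" using \<epsilon> by (auto simp: d_def)
  have \<sigma>1: "nats \<sigma>1 ''n1'' 0 = Suc n" "reals \<sigma>1 ''rn'' 0 = real n" "reals \<sigma>1 ''d'' 0 = d"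
    "\<And>x. x \<notin> {''n1'', ''i''} \<Longrightarrow> nats \<sigma>1 x = nats ?\<sigma> x" "\<And>x. x \<notin> {''rn'', ''d''} \<Longrightarrow> reals \<sigma>1 x = reals ?\<sigma> x"
    using count_up_spec[of "''n''" "''rn''"]
    by (auto simp: \<sigma>1_def prepare_def input_state_def d_def nats_nwrite_other)
  have "\<exists>t. exec (compile prepare) ?\<sigma> t \<sigma>1 \<and> t \<le> time_bound prepare n"
    unfolding \<sigma>1_def by (rule exec_compile) (auto simp: prepare_bounds input_state_def)
  then obtain t1 where t1: "exec (compile prepare) ?\<sigma> t1 \<sigma>1" "t1 \<le> time_bound prepare n" by blast
  obtain t2 L where t2: "exec choose_scale \<sigma>1 t2 (nwrite ''L'' 0 L (rwrite ''rL'' 0 (real L) \<sigma>1))"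
    "t2 \<le> 11 + 23 * L" and L: "1 \<le> L" "8 * n \<le> L * d" "(real L - 1) * d < 8 * n"
    using choose_scale_exec[of \<sigma>1 n d] \<sigma>1 d(1) n1 by (auto simp: input_state_def)
  define \<sigma>2 where "\<sigma>2 = nwrite ''L'' 0 L (rwrite ''rL'' 0 (real L) \<sigma>1)"
  define \<sigma>3 where "\<sigma>3 = sem dimensions \<sigma>2"
  have "\<exists>t. exec (compile dimensions) \<sigma>2 t \<sigma>3 \<and> t \<le> time_bound dimensions (Suc n + L)"
    unfolding \<sigma>3_def
    by (rule exec_compile) (auto simp: dimensions_bounds \<sigma>2_def \<sigma>1 input_state_def)
  then obtain t3 where t3: "exec (compile dimensions) \<sigma>2 t3 \<sigma>3" "t3 \<le> time_bound dimensions (Suc n + L)"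
    by blast
  have \<sigma>2: "nats \<sigma>2 ''n'' 0 = n" "nats \<sigma>2 ''n1'' 0 = Suc n" "nats \<sigma>2 ''L'' 0 = L" "nats \<sigma>2 ''Q1'' 0 = 0"
    "nats \<sigma>2 ''T'' 0 = 0" "nats \<sigma>2 ''P'' 0 = 0"
    by (simp_all add: \<sigma>2_def \<sigma>1 input_state_def)
  have \<sigma>3: "nats \<sigma>3 ''n'' 0 = n" "nats \<sigma>3 ''n1'' 0 = Suc n" "nats \<sigma>3 ''L'' 0 = L"
    "nats \<sigma>3 ''Q1'' 0 = Suc (n * L)" "nats \<sigma>3 ''P'' 0 = Suc n * Suc n" "nats \<sigma>3 ''T'' 0 = n * L * L"
    by (simp_all add: \<sigma>3_def dimensions_def add_up_spec \<sigma>2 del: mult_Suc mult_Suc_right)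
  define N where "N = (Suc n)\<^sup>2 * (Suc L)\<^sup>2"
  have "\<exists>t. exec (compile solve) \<sigma>3 t (sem solve \<sigma>3) \<and> t \<le> time_bound solve N"
  proof (rule exec_compile)
    fix x assume "x \<in> bounds solve"
    then have "x \<in> {''n'', ''n1'', ''L'', ''Q1'', ''P'', ''T''}" by (rule subsetD[OF solve_bounds(2)])
    then have "x = ''n'' \<or> x = ''n1'' \<or> x = ''L'' \<or> x = ''Q1'' \<or> x = ''P'' \<or> x = ''T''"
      by (simp only: insert_iff empty_iff simp_thms)
    moreover note b = size_bounds[of n L, folded N_def]
    moreover have "n \<le> N" "L \<le> N" using b by auto
    ultimately show "nats \<sigma>3 x 0 \<le> N"
      by (elim disjE) (simp_all only: \<sigma>3)
  qed (fact solve_bounds(1) solve_disjoint)+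
  then obtain t4 where t4: "exec (compile solve) \<sigma>3 t4 (sem solve \<sigma>3)" "t4 \<le> time_bound solve N" by blast
  have run: "exec fptas ?\<sigma> (t1 + (t2 + (t3 + t4))) (sem solve \<sigma>3)"
    unfolding fptas_def using t1 t2 t3 t4 by (intro exec.Seq) (auto simp: \<sigma>2_def)
  \<comment> \<open>Here the cap \<open>d <= 1\<close> enters: it yields \<open>8 * n <= L\<close>
    for every \<epsilon>.\<close>
  have "real (8 * n) \<le> real L * 1" using L(2) d(3) mult_left_mono[of d 1 "real L"] by linarith
  then have L2: "2 * n \<le> L" by simp
  have input: "nats \<sigma>3 ''xb'' 0 = 0" "reals \<sigma>3 ''rL'' 0 = L" "reals \<sigma>3 ''C'' 0 = C" "reals \<sigma>3 ''rT'' 0 = 0"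
    "i \<in> {1..n} \<Longrightarrow> reals \<sigma>3 ''s'' i = s i" "i \<in> {1..n} \<Longrightarrow> reals \<sigma>3 ''v'' i = v i"
    "reals \<sigma>3 ''R'' k = 0" for i k
    by (simp_all add: \<sigma>3_def \<sigma>2_def \<sigma>1(4,5)) (simp_all add: input_state_def)
  obtain p where p: "outputs n (sem solve \<sigma>3) p" "p \<in> distributions n s C"
    "output_length (sem solve \<sigma>3) = n * L * L"
    "(1 - 4 * (n / L)) * max_robustness n s v C \<le> robustness n s v C p"
    using solve_correct[OF inst L2 \<sigma>3 input] by blast
  have lam: "0 \<le> max_robustness n s v C"
    using max_robustness_ge[OF inst] by (rule order_trans[rotated]) simp
  have "4 * (n / L) \<le> \<epsilon>"
  proof -
    have "8 * (n / L) \<le> d" using L(1,2) by (simp add: field_simps)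
    then show ?thesis using d by linarith
  qed
  then have "(1 - \<epsilon>) * max_robustness n s v C \<le> (1 - 4 * (n / L)) * max_robustness n s v C"
    using lam by (intro mult_right_mono) auto
  moreover have "real L + 1 \<le> 8 * (1 + real n) * (1 + 1 / \<epsilon>)"
  proof -
    \<comment> \<open>\<open>1 / d\<close> is the larger of \<open>1 / \<epsilon>\<close> and 1, so
      their sum covers both cases.\<close>
    have "1 / d \<le> 1 + 1 / \<epsilon>" using \<epsilon> by (auto simp: d_def min_def)
    then have "8 * n * (1 / d) \<le> 8 * n * (1 + 1 / \<epsilon>)" by (intro mult_left_mono) auto
    moreover have "real L - 1 \<le> 8 * n * (1 / d)" using L(3) d(1) by (simp add: field_simps)
    moreover have "8 * (1 + real n) * (1 + 1 / \<epsilon>) = 8 * n * (1 + 1 / \<epsilon>) + 8 + 8 / \<epsilon>"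
      by (simp add: algebra_simps)
    moreover have "0 \<le> 8 / \<epsilon>" using \<epsilon> by simp
    ultimately show ?thesis by linarith
  qed
  ultimately show ?thesis
    using run p t1(2) t2(2) t3(2) t4(2) unfolding N_def
    by (intro exI[of _ "t1 + (t2 + (t3 + t4))"] exI[of _ "sem solve \<sigma>3"] exI[of _ p] exI[of _ L]) auto
qed

theorem mainTheorem11:
  shows "\<exists>(algo :: com) (d :: nat) (a :: nat \<Rightarrow> nat \<Rightarrow> real).
    \<forall>(n :: nat) (s :: nat \<Rightarrow> real) (v :: nat \<Rightarrow> real) (C :: real) (\<epsilon> :: real).
      knapsack_instance n s v C \<and> \<epsilon> > 0 \<longrightarrow>
      (\<exists>t \<tau> p.
         exec algo (input_state n s v C \<epsilon>) t \<tau> \<and>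
         real (total_time n t \<tau>) \<le> poly2 d a (real n) (1 / \<epsilon>) \<and>
         outputs n \<tau> p \<and>
         p \<in> distributions n s C \<and>
         robustness n s v C p \<ge> (1 - \<epsilon>) * max_robustness n s v C)"
proof -
  obtain K1 d1 where 1: "\<And>N. 1 \<le> N \<Longrightarrow> time_bound prepare N \<le> K1 * N ^ d1"
    using time_bound_poly by metis
  obtain K2 d2 where 2: "\<And>N. 1 \<le> N \<Longrightarrow> time_bound dimensions N \<le> K2 * N ^ d2"
    using time_bound_poly by metis
  obtain K3 d3 where 3: "\<And>N. 1 \<le> N \<Longrightarrow> time_bound solve N \<le> K3 * N ^ d3"
    using time_bound_poly by metis
  \<comment> \<open>The 2 leaves room for the output, whose size is at most
    \<open>N * N\<close>.\<close>
  define D where "D = d1 + d2 + d3 + 2"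
  \<comment> \<open>35 is 34 for the search of \<open>L\<close>, from \<open>11 + 23 * L\<close>,
    plus 1 for the output.\<close>
  define K where "K = K1 + K2 + K3 + 35"
  \<comment> \<open>The base 64 is the square of the 8 in the bound on \<open>L + 1\<close>: it
    leads to \<open>N <= 64 * x ^ 4\<close> with \<open>x = (1 + n) * (1 + 1 / \<epsilon>)\<close>,
    whence also the degree \<open>4 * D\<close>.\<close>
  define c where "c = real K * 64 ^ D"
  show ?thesis
  proof (rule exI[of _ fptas], rule exI[of _ "4 * D"],
      rule exI[of _ "\<lambda>i j. c * real (4 * D choose i) * real (4 * D choose j)"], intro allI impI)
    fix n s v C and \<epsilon> :: real assume "knapsack_instance n s v C \<and> \<epsilon> > 0"
    then have inst: "knapsack_instance n s v C" and \<epsilon>: "0 < \<epsilon>" by auto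
    have n1: "1 \<le> n" using inst by (simp add: knapsack_instance_def)
    obtain t \<tau> p L where res: "exec fptas (input_state n s v C \<epsilon>) t \<tau>"
      "t \<le> time_bound prepare n + (11 + 23 * L) + time_bound dimensions (Suc n + L)
        + time_bound solve ((Suc n)\<^sup>2 * (Suc L)\<^sup>2)"
      "output_length \<tau> = n * L * L" "real L + 1 \<le> 8 * (1 + real n) * (1 + 1 / \<epsilon>)"
      "outputs n \<tau> p" "p \<in> distributions n s C"
      "(1 - \<epsilon>) * max_robustness n s v C \<le> robustness n s v C p"
      using fptas_correct[OF inst \<epsilon>] by blast
    define N where "N = (Suc n)\<^sup>2 * (Suc L)\<^sup>2"
    have le: "n \<le> N" "L \<le> N" "Suc n + L \<le> N" "n * L * L \<le> N" "n + 1 \<le> N" "1 \<le> N"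
      using size_bounds[of n L, folded N_def] by auto
    have pow: "x ^ e \<le> N ^ D" if "x \<le> N" "e \<le> D" for x e :: nat
      using power_mono[OF that(1), of e] power_increasing[OF that(2) le(6)] by simp
    have D: "d1 \<le> D" "d2 \<le> D" "d3 \<le> D" "1 \<le> D" "2 \<le> D" by (auto simp: D_def)
    have "time_bound prepare n \<le> K1 * N ^ D"
      by (rule order_trans[OF 1[OF n1] mult_le_mono2[OF pow[OF le(1) D(1)]]])
    moreover have "time_bound dimensions (Suc n + L) \<le> K2 * N ^ D"
      by (rule order_trans[OF 2 mult_le_mono2[OF pow[OF le(3) D(2)]]]) simp
    moreover have "time_bound solve N \<le> K3 * N ^ D"
      by (rule order_trans[OF 3[OF le(6)] mult_le_mono2[OF pow[OF order_refl D(3)]]])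
    moreover have "11 + 23 * L \<le> 34 * N ^ D"
    proof -
      have "L \<le> N ^ D" using pow[OF le(2) D(4)] by simp
      moreover have "1 \<le> N ^ D" using pow[OF le(6) D(4)] by simp
      ultimately show ?thesis by linarith
    qed
    moreover have "output_length \<tau> * (n + 1) \<le> N ^ D"
    proof -
      have "output_length \<tau> * (n + 1) \<le> N * N" unfolding res(3) by (rule mult_le_mono[OF le(4,5)])
      also have "\<dots> = N ^ 2" by (simp add: power2_eq_square)
      also have "\<dots> \<le> N ^ D" by (rule pow[OF order_refl D(5)])
      finally show ?thesis .
    qed
    moreover have "K * N ^ D = K1 * N ^ D + K2 * N ^ D + K3 * N ^ D + 34 * N ^ D + N ^ D"
      by (simp add: K_def algebra_simps)
    ultimately have "total_time n t \<tau> \<le> K * N ^ D"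
      using res(2)[folded N_def] unfolding total_time_def by linarith
    then have "real (total_time n t \<tau>) \<le> real (K * N ^ D)" by (rule of_nat_mono)
    then have time: "real (total_time n t \<tau>) \<le> real K * real N ^ D" by simp
    let ?x = "(1 + real n) * (1 + 1 / \<epsilon>)"
    have x: "1 \<le> 1 + 1 / \<epsilon>" using \<epsilon> by simp
    have eq: "a\<^sup>2 * (8 * a * b)\<^sup>2 = 64 * (a ^ 4 * b\<^sup>2)" for a b :: real
      by (simp add: power2_eq_square power4_eq_xxxx)
    have "real N = (1 + real n)\<^sup>2 * (real L + 1)\<^sup>2" by (simp add: N_def add.commute)
    also have "\<dots> \<le> (1 + real n)\<^sup>2 * (8 * (1 + real n) * (1 + 1 / \<epsilon>))\<^sup>2"
      using res(4) by (intro mult_left_mono power_mono) auto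
    also have "\<dots> = 64 * ((1 + real n) ^ 4 * (1 + 1 / \<epsilon>)\<^sup>2)"
      by (rule eq)
    also have "\<dots> \<le> 64 * ((1 + real n) ^ 4 * (1 + 1 / \<epsilon>) ^ 4)"
      using power_increasing[of 2 4, OF _ x] by (intro mult_left_mono) auto
    also have "\<dots> = 64 * ?x ^ 4" by (simp only: power_mult_distrib)
    finally have "real N ^ D \<le> (64 * ?x ^ 4) ^ D" by (intro power_mono) auto
    then have "real K * real N ^ D \<le> real K * (64 * ?x ^ 4) ^ D" by (intro mult_left_mono) auto
    also have "\<dots> = c * ?x ^ (4 * D)" by (simp add: c_def power_mult_distrib power_mult)
    finally have "real (total_time n t \<tau>)
        \<le> poly2 (4 * D) (\<lambda>i j. c * real (4 * D choose i) * real (4 * D choose j)) (real n) (1 / \<epsilon>)"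
      using time by (simp only: poly2_binomial)
    then show "\<exists>t \<tau> p. exec fptas (input_state n s v C \<epsilon>) t \<tau> \<and>
        real (total_time n t \<tau>)
          \<le> poly2 (4 * D) (\<lambda>i j. c * real (4 * D choose i) * real (4 * D choose j)) (real n) (1 / \<epsilon>) \<and>
        outputs n \<tau> p \<and> p \<in> distributions n s C \<and>
        robustness n s v C p \<ge> (1 - \<epsilon>) * max_robustness n s v C"
      using res by blast
  qed
qed

end
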